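(* Let $M$ be a connected manifold, $L$ a Finsler structure on $M$, and $L\to\widetilde{L}=e^{\sigma(x)}L$ a conformal transformation, where $\sigma$ is a smooth function on $M$. Then every $\pi$-vector field that is $\overline{d}$-closed in $(M,L)$ remains $\overline{d}$-closed in $(M,\widetilde{L})$ if and only if the transformation is a homothety, i.e. $\sigma$ is constant.
   Context: All objects are $C^\infty$. $M$ is an $n$-dimensional manifold, $\mathcal{T}M$ is the bundle of nonzero tangent vectors, $\pi:\mathcal{T}M\to M$ the projection, and $\pi^{-1}(TM)\to\mathcal{T}M$ the pullback of $TM$ by $\pi$. Its sections are called $\pi$-vector fields; tensor fields (forms) on $\pi^{-1}(TM)$ are called $\pi$-tensor fields ($\pi$-forms). A Finsler structure $L$ on $M$ is positive and smooth on $\mathcal{T}M$, positively homogeneous of degree 1 on fibres, and the fibrewise Hessian $g$ of $\frac12L^2$, a metric on $\pi^{-1}(TM)$ called the Finsler metric, is positive definite. The Finsler metric of $\widetilde{L}=e^{\sigma}L$ is $\widetilde{g}=e^{2\sigma}g$ (with $\sigma$ pulled back to $\mathcal{T}M$). The fundamental $\pi$-vector field is $\overline{\eta}(u)=(u,u)$. Let $\rho:T(\mathcal{T}M)\to\pi^{-1}(TM)$, $\rho(X)=(u,d\pi(X))$ for $X\in T_u(\mathcal{T}M)$, and $\gamma:\pi^{-1}(TM)\to T(\mathcal{T}M)$, $\gamma(u,v)=\frac{d}{dt}\big|_{t=0}(u+tv)$. For a linear connection $\nabla$ in $\pi^{-1}(TM)$, its connection map is $K(X)=\nabla_X\overline{\eta}$;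 $\nabla$ is regular if $T(\mathcal{T}M)=V(\mathcal{T}M)\oplus H(\mathcal{T}M)$, where $V(\mathcal TM)=\ker\rho$ and $H(\mathcal TM)=\ker K$. For regular $\nabla$ set $\beta=(\rho|_{H(\mathcal{T}M)})^{-1}$. The torsion is $\mathbf{T}(X,Y)=\nabla_X\rho Y-\nabla_Y\rho X-\rho[X,Y]$, with $Q(\overline{X},\overline{Y})=\mathbf{T}(\beta\overline{X},\beta\overline{Y})$ and $T(\overline{X},\overline{Y})=\mathbf{T}(\gamma\overline{X},\beta\overline{Y})$. The Cartan connection of a Finsler manifold is the unique regular connection $\nabla$ in $\pi^{-1}(TM)$ with $\nabla g=0$, $Q=0$ and $g(T(\overline{X},\overline{Y}),\overline{Z})=g(T(\overline{X},\overline{Z}),\overline{Y})$; its $\beta$ is used below. For a 1-$\pi$-form $\omega$, $(\overline{d}\omega)(\overline{Y},\overline{Z})=\beta\overline{Y}\cdot\omega(\overline{Z})-\beta\overline{Z}\cdot\omega(\overline{Y})-\omega(\rho[\beta\overline{Y},\beta\overline{Z}])$. A $\pi$-vector field $\overline{X}$ is $\overline{d}$-closed in a Finsler manifold if $\overline{d}(i_{\overline{X}}g)=0$, where $i_{\overline{X}}g=g(\overline{X},\cdot)$ and $g$, $\beta$ are those of that Finsler manifold.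
   Formalization: The manifold M is assumed to have dimension at least 2; in dimension 1 the claim fails, since every π-vector field is then d̄-closed for every L (e.g. M = ℝ, L = |y|, σ(x) = x, which is not constant). *)

theory Defs
  imports "HOL-Analysis.Analysis"
begin

section \<open>Smooth maps between Euclidean spaces\<close>

text \<open>\<open>Ck_on k f S\<close> is used only for open \<open>S\<close>, where \<open>frechet_derivative f (at x) v\<close> is the
  directional derivative of \<open>f\<close> along \<open>v\<close>.\<close>

primrec Ck_on :: "nat \<Rightarrow> ('e::euclidean_space \<Rightarrow> 'f::real_normed_vector) \<Rightarrow> 'e set \<Rightarrow> bool" where
  "Ck_on 0 f S \<longleftrightarrow> continuous_on S f"
| "Ck_on (Suc k) f S \<longleftrightarrow> (\<forall>x\<in>S. f differentiable (at x)) \<and>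
     (\<forall>v. Ck_on k (\<lambda>x. frechet_derivative f (at x) v) S)"

definition smooth_on :: "('e::euclidean_space \<Rightarrow> 'f::real_normed_vector) \<Rightarrow> 'e set \<Rightarrow> bool" where
  "smooth_on f S \<longleftrightarrow> (\<forall>k. Ck_on k f S)"


section \<open>Smooth manifolds\<close>

text \<open>A manifold is given by an atlas of local parametrizations \<open>(V, \<psi>)\<close>: \<open>V\<close> is an open subset of
  the model space and \<open>\<psi>\<close>, the inverse of a chart, is an injection of \<open>V\<close> into the manifold.
  The dimension is \<open>DIM('e)\<close>.  The topology is the one for which all \<open>\<psi>\<close> are homeomorphisms onto
  open sets.\<close>

type_synonym ('e, 'a) atlas = "('e set \<times> ('e \<Rightarrow> 'a)) set"

definition atlas_carrier :: "('e::euclidean_space, 'a) atlas \<Rightarrow> 'a set" where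
  "atlas_carrier A = (\<Union>(V, \<psi>)\<in>A. \<psi> ` V)"

definition smooth_atlas :: "('e::euclidean_space, 'a) atlas \<Rightarrow> bool" where
  "smooth_atlas A \<longleftrightarrow>
     (\<forall>(V, \<psi>)\<in>A. open V \<and> inj_on \<psi> V) \<and>
     (\<forall>(V, \<psi>)\<in>A. \<forall>(W, \<phi>)\<in>A.
        open {x\<in>V. \<psi> x \<in> \<phi> ` W} \<and> smooth_on (inv_into W \<phi> \<circ> \<psi>) {x\<in>V. \<psi> x \<in> \<phi> ` W})"

definition atlas_topology :: "('e::euclidean_space, 'a) atlas \<Rightarrow> 'a topology" where
  "atlas_topology A =
     topology (\<lambda>U. U \<subseteq> atlas_carrier A \<and> (\<forall>(V, \<psi>)\<in>A. open {x\<in>V. \<psi> x \<in> U}))"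

definition smooth_manifold :: "('e::euclidean_space, 'a) atlas \<Rightarrow> bool" where
  "smooth_manifold A \<longleftrightarrow> smooth_atlas A \<and>
     Hausdorff_space (atlas_topology A) \<and> second_countable (atlas_topology A)"

definition smooth_fun_on :: "('e::euclidean_space, 'a) atlas \<Rightarrow> 'a set \<Rightarrow> ('a \<Rightarrow> real) \<Rightarrow> bool" where
  "smooth_fun_on A U f \<longleftrightarrow> openin (atlas_topology A) U \<and>
     (\<forall>(V, \<psi>)\<in>A. smooth_on (f \<circ> \<psi>) {x\<in>V. \<psi> x \<in> U})"

definition smooth_near :: "('e::euclidean_space, 'a) atlas \<Rightarrow> 'a \<Rightarrow> ('a \<Rightarrow> real) \<Rightarrow> bool" where
  "smooth_near A p f \<longleftrightarrow> (\<exists>U. p \<in> U \<and> smooth_fun_on A U f)"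


section \<open>Tangent vectors\<close>

text \<open>A tangent vector at \<open>p\<close> is the directional derivative, along some coordinate vector, acting on
  the functions that are smooth near \<open>p\<close>.  Its value on all other functions is set to \<open>0\<close>, so that
  it is determined by its action on smooth functions.\<close>

type_synonym 'a tvec = "('a \<Rightarrow> real) \<Rightarrow> real"

definition tv_zero :: "'a tvec" where
  "tv_zero = (\<lambda>f. 0)"

definition tv_add :: "'a tvec \<Rightarrow> 'a tvec \<Rightarrow> 'a tvec" where
  "tv_add v w = (\<lambda>f. v f + w f)"

definition tv_scale :: "real \<Rightarrow> 'a tvec \<Rightarrow> 'a tvec" where
  "tv_scale c v = (\<lambda>f. c * v f)"

definition tv_diff :: "'a tvec \<Rightarrow> 'a tvec \<Rightarrow> 'a tvec" where
  "tv_diff v w = (\<lambda>f. v f - w f)"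

definition dir_deriv :: "('e::euclidean_space, 'a) atlas \<Rightarrow> ('e \<Rightarrow> 'a) \<Rightarrow> 'e \<Rightarrow> 'e \<Rightarrow> 'a tvec" where
  "dir_deriv A \<psi> x y =
     (\<lambda>f. if smooth_near A (\<psi> x) f then frechet_derivative (f \<circ> \<psi>) (at x) y else 0)"

definition tangent_space :: "('e::euclidean_space, 'a) atlas \<Rightarrow> 'a \<Rightarrow> 'a tvec set" where
  "tangent_space A p = {dir_deriv A \<psi> x y | V \<psi> x y. (V, \<psi>) \<in> A \<and> x \<in> V \<and> \<psi> x = p}"

definition vector_field :: "('e::euclidean_space, 'a) atlas \<Rightarrow> ('a \<Rightarrow> 'a tvec) \<Rightarrow> bool" where
  "vector_field A X \<longleftrightarrow> (\<forall>p\<in>atlas_carrier A. X p \<in> tangent_space A p) \<and>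
     (\<forall>U f. smooth_fun_on A U f \<longrightarrow> smooth_fun_on A U (\<lambda>p. X p f))"

definition lie_bracket ::
  "('e::euclidean_space, 'a) atlas \<Rightarrow> ('a \<Rightarrow> 'a tvec) \<Rightarrow> ('a \<Rightarrow> 'a tvec) \<Rightarrow> 'a \<Rightarrow> 'a tvec" where
  "lie_bracket A X Y p =
     (\<lambda>f. if smooth_near A p f then X p (\<lambda>q. Y q f) - Y p (\<lambda>q. X q f) else 0)"


section \<open>The bundle of nonzero tangent vectors\<close>

text \<open>Points of the slit tangent bundle are pairs \<open>u = (p, v)\<close>; the projection \<open>\<pi>\<close> is \<open>fst\<close>.\<close>

definition slit_tangent :: "('e::euclidean_space, 'a) atlas \<Rightarrow> ('a \<times> 'a tvec) set" where
  "slit_tangent A = {(p, v). p \<in> atlas_carrier A \<and> v \<in> tangent_space A p \<and> v \<noteq> tv_zero}"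

text \<open>The manifold structure of the slit tangent bundle.\<close>

definition slit_atlas ::
  "('e::euclidean_space, 'a) atlas \<Rightarrow> ('e \<times> 'e, 'a \<times> 'a tvec) atlas" where
  "slit_atlas A = (\<lambda>(V, \<psi>). (V \<times> (- {0}), \<lambda>(x, y). (\<psi> x, dir_deriv A \<psi> x y))) ` A"

text \<open>A section of \<open>\<pi>\<^sup>-\<^sup>1(TM)\<close> is represented by its second component \<open>u \<mapsto> X u\<close>, a tangent vector
  at \<open>fst u\<close>.\<close>

definition pi_vector_field ::
  "('e::euclidean_space, 'a) atlas \<Rightarrow> ('a \<times> 'a tvec \<Rightarrow> 'a tvec) \<Rightarrow> bool" where
  "pi_vector_field A X \<longleftrightarrow> (\<forall>u\<in>slit_tangent A. X u \<in> tangent_space A (fst u)) \<and>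
     (\<forall>U f. smooth_fun_on A U f \<longrightarrow>
        smooth_fun_on (slit_atlas A) {u\<in>slit_tangent A. fst u \<in> U} (\<lambda>u. X u f))"

definition eta :: "'a \<times> 'a tvec \<Rightarrow> 'a tvec" where
  "eta u = snd u"

text \<open>\<open>rho \<xi>\<close> is \<open>d\<pi>(\<xi>)\<close>.\<close>

definition rho :: "('a \<times> 'a tvec) tvec \<Rightarrow> 'a tvec" where
  "rho \<xi> = (\<lambda>f. \<xi> (f \<circ> fst))"

definition vgamma ::
  "('e::euclidean_space, 'a) atlas \<Rightarrow> 'a \<times> 'a tvec \<Rightarrow> 'a tvec \<Rightarrow> ('a \<times> 'a tvec) tvec" where
  "vgamma A u w = (\<lambda>F. if smooth_near (slit_atlas A) u F
     then deriv (\<lambda>t. F (fst u, tv_add (snd u) (tv_scale t w))) 0 else 0)"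


section \<open>Finsler structures\<close>

text \<open>The Hessian at \<open>u\<close> of the restriction of \<open>L\<^sup>2 / 2\<close> to the fibre through \<open>u\<close>.\<close>

definition finsler_metric ::
  "('a \<times> 'a tvec \<Rightarrow> real) \<Rightarrow> 'a \<times> 'a tvec \<Rightarrow> 'a tvec \<Rightarrow> 'a tvec \<Rightarrow> real" where
  "finsler_metric L u v w =
     deriv (\<lambda>s. deriv (\<lambda>t. (L (fst u, tv_add (snd u) (tv_add (tv_scale s v) (tv_scale t w))))\<^sup>2 / 2) 0) 0"

definition finsler_structure ::
  "('e::euclidean_space, 'a) atlas \<Rightarrow> ('a \<times> 'a tvec \<Rightarrow> real) \<Rightarrow> bool" where
  "finsler_structure A L \<longleftrightarrow>
     (\<forall>u\<in>slit_tangent A. L u > 0) \<and>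
     smooth_fun_on (slit_atlas A) (slit_tangent A) L \<and>
     (\<forall>u\<in>slit_tangent A. \<forall>c>0. L (fst u, tv_scale c (snd u)) = c * L u) \<and>
     (\<forall>u\<in>slit_tangent A. \<forall>v\<in>tangent_space A (fst u). v \<noteq> tv_zero \<longrightarrow> finsler_metric L u v v > 0)"

definition conformal_change ::
  "('a \<Rightarrow> real) \<Rightarrow> ('a \<times> 'a tvec \<Rightarrow> real) \<Rightarrow> 'a \<times> 'a tvec \<Rightarrow> real" where
  "conformal_change \<sigma> L u = exp (\<sigma> (fst u)) * L u"


section \<open>Linear connections in the pullback bundle\<close>

text \<open>\<open>D u \<xi> Y\<close> is the covariant derivative at \<open>u\<close> of the \<open>\<pi>\<close>-vector field \<open>Y\<close> along the tangent
  vector \<open>\<xi>\<close> of the slit tangent bundle at \<open>u\<close>.\<close>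

type_synonym 'a pi_conn =
  "'a \<times> 'a tvec \<Rightarrow> ('a \<times> 'a tvec) tvec \<Rightarrow> ('a \<times> 'a tvec \<Rightarrow> 'a tvec) \<Rightarrow> 'a tvec"

text \<open>The second clause says that \<open>D\<close> ignores the values of \<open>Y\<close> outside the slit tangent bundle.\<close>

definition linear_connection :: "('e::euclidean_space, 'a) atlas \<Rightarrow> 'a pi_conn \<Rightarrow> bool" where
  "linear_connection A D \<longleftrightarrow>
     (\<forall>X Y. vector_field (slit_atlas A) X \<and> pi_vector_field A Y \<longrightarrow>
        pi_vector_field A (\<lambda>u. D u (X u) Y)) \<and>
     (\<forall>u\<in>slit_tangent A. \<forall>\<xi>\<in>tangent_space (slit_atlas A) u. \<forall>Y Z.
        pi_vector_field A Y \<and> pi_vector_field A Z \<and> (\<forall>w\<in>slit_tangent A. Y w = Z w) \<longrightarrow>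
        D u \<xi> Y = D u \<xi> Z) \<and>
     (\<forall>u\<in>slit_tangent A. \<forall>\<xi>\<in>tangent_space (slit_atlas A) u. \<forall>\<zeta>\<in>tangent_space (slit_atlas A) u.
        \<forall>a b Y. pi_vector_field A Y \<longrightarrow>
        D u (tv_add (tv_scale a \<xi>) (tv_scale b \<zeta>)) Y =
        tv_add (tv_scale a (D u \<xi> Y)) (tv_scale b (D u \<zeta> Y))) \<and>
     (\<forall>u\<in>slit_tangent A. \<forall>\<xi>\<in>tangent_space (slit_atlas A) u. \<forall>Y Z.
        pi_vector_field A Y \<and> pi_vector_field A Z \<longrightarrow>
        D u \<xi> (\<lambda>w. tv_add (Y w) (Z w)) = tv_add (D u \<xi> Y) (D u \<xi> Z)) \<and>
     (\<forall>u\<in>slit_tangent A. \<forall>\<xi>\<in>tangent_space (slit_atlas A) u. \<forall>f Y.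
        smooth_fun_on (slit_atlas A) (slit_tangent A) f \<and> pi_vector_field A Y \<longrightarrow>
        D u \<xi> (\<lambda>w. tv_scale (f w) (Y w)) =
        tv_add (tv_scale (\<xi> f) (Y u)) (tv_scale (f u) (D u \<xi> Y)))"

definition vertical_space ::
  "('e::euclidean_space, 'a) atlas \<Rightarrow> 'a \<times> 'a tvec \<Rightarrow> ('a \<times> 'a tvec) tvec set" where
  "vertical_space A u = {\<xi>\<in>tangent_space (slit_atlas A) u. rho \<xi> = tv_zero}"

text \<open>The kernel of the connection map \<open>K(\<xi>) = \<nabla>\<^sub>\<xi>\<eta>\<close>.\<close>

definition horizontal_space ::
  "('e::euclidean_space, 'a) atlas \<Rightarrow> 'a pi_conn \<Rightarrow> 'a \<times> 'a tvec \<Rightarrow> ('a \<times> 'a tvec) tvec set" where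
  "horizontal_space A D u = {\<xi>\<in>tangent_space (slit_atlas A) u. D u \<xi> eta = tv_zero}"

definition regular_connection :: "('e::euclidean_space, 'a) atlas \<Rightarrow> 'a pi_conn \<Rightarrow> bool" where
  "regular_connection A D \<longleftrightarrow> linear_connection A D \<and>
     (\<forall>u\<in>slit_tangent A.
        (\<forall>\<xi>\<in>tangent_space (slit_atlas A) u.
           \<exists>\<nu>\<in>vertical_space A u. \<exists>\<mu>\<in>horizontal_space A D u. \<xi> = tv_add \<nu> \<mu>) \<and>
        vertical_space A u \<inter> horizontal_space A D u = {tv_zero})"

definition hbeta ::
  "('e::euclidean_space, 'a) atlas \<Rightarrow> 'a pi_conn \<Rightarrow> 'a \<times> 'a tvec \<Rightarrow> 'a tvec \<Rightarrow> ('a \<times> 'a tvec) tvec" where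
  "hbeta A D u = inv_into (horizontal_space A D u) rho"

definition torsion ::
  "('e::euclidean_space, 'a) atlas \<Rightarrow> 'a pi_conn \<Rightarrow>
   ('a \<times> 'a tvec \<Rightarrow> ('a \<times> 'a tvec) tvec) \<Rightarrow> ('a \<times> 'a tvec \<Rightarrow> ('a \<times> 'a tvec) tvec) \<Rightarrow>
   'a \<times> 'a tvec \<Rightarrow> 'a tvec" where
  "torsion A D X Y u =
     tv_diff (tv_diff (D u (X u) (\<lambda>w. rho (Y w))) (D u (Y u) (\<lambda>w. rho (X w))))
       (rho (lie_bracket (slit_atlas A) X Y u))"

definition hh_torsion ::
  "('e::euclidean_space, 'a) atlas \<Rightarrow> 'a pi_conn \<Rightarrow>
   ('a \<times> 'a tvec \<Rightarrow> 'a tvec) \<Rightarrow> ('a \<times> 'a tvec \<Rightarrow> 'a tvec) \<Rightarrow> 'a \<times> 'a tvec \<Rightarrow> 'a tvec" where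
  "hh_torsion A D X Y =
     torsion A D (\<lambda>u. hbeta A D u (X u)) (\<lambda>u. hbeta A D u (Y u))"

definition hv_torsion ::
  "('e::euclidean_space, 'a) atlas \<Rightarrow> 'a pi_conn \<Rightarrow>
   ('a \<times> 'a tvec \<Rightarrow> 'a tvec) \<Rightarrow> ('a \<times> 'a tvec \<Rightarrow> 'a tvec) \<Rightarrow> 'a \<times> 'a tvec \<Rightarrow> 'a tvec" where
  "hv_torsion A D X Y =
     torsion A D (\<lambda>u. vgamma A u (X u)) (\<lambda>u. hbeta A D u (Y u))"

definition metric_connection ::
  "('e::euclidean_space, 'a) atlas \<Rightarrow> ('a \<times> 'a tvec \<Rightarrow> real) \<Rightarrow> 'a pi_conn \<Rightarrow> bool" where
  "metric_connection A L D \<longleftrightarrow>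
     (\<forall>u\<in>slit_tangent A. \<forall>\<xi>\<in>tangent_space (slit_atlas A) u. \<forall>Y Z.
        pi_vector_field A Y \<and> pi_vector_field A Z \<longrightarrow>
        \<xi> (\<lambda>w. finsler_metric L w (Y w) (Z w)) =
        finsler_metric L u (D u \<xi> Y) (Z u) + finsler_metric L u (Y u) (D u \<xi> Z))"

definition cartan_connection ::
  "('e::euclidean_space, 'a) atlas \<Rightarrow> ('a \<times> 'a tvec \<Rightarrow> real) \<Rightarrow> 'a pi_conn \<Rightarrow> bool" where
  "cartan_connection A L D \<longleftrightarrow>
     regular_connection A D \<and>
     metric_connection A L D \<and>
     (\<forall>X Y. pi_vector_field A X \<and> pi_vector_field A Y \<longrightarrow>
        (\<forall>u\<in>slit_tangent A. hh_torsion A D X Y u = tv_zero)) \<and>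
     (\<forall>X Y Z. pi_vector_field A X \<and> pi_vector_field A Y \<and> pi_vector_field A Z \<longrightarrow>
        (\<forall>u\<in>slit_tangent A.
           finsler_metric L u (hv_torsion A D X Y u) (Z u) =
           finsler_metric L u (hv_torsion A D X Z u) (Y u)))"


section \<open>Closed \<open>\<pi>\<close>-vector fields\<close>

definition dbar ::
  "('e::euclidean_space, 'a) atlas \<Rightarrow> 'a pi_conn \<Rightarrow> ('a \<times> 'a tvec \<Rightarrow> 'a tvec \<Rightarrow> real) \<Rightarrow>
   ('a \<times> 'a tvec \<Rightarrow> 'a tvec) \<Rightarrow> ('a \<times> 'a tvec \<Rightarrow> 'a tvec) \<Rightarrow> 'a \<times> 'a tvec \<Rightarrow> real" where
  "dbar A D \<omega> Y Z u =
     hbeta A D u (Y u) (\<lambda>w. \<omega> w (Z w)) - hbeta A D u (Z u) (\<lambda>w. \<omega> w (Y w)) -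
     \<omega> u (rho (lie_bracket (slit_atlas A)
       (\<lambda>w. hbeta A D w (Y w)) (\<lambda>w. hbeta A D w (Z w)) u))"

text \<open>The \<open>\<pi>\<close>-vector field \<open>X\<close> is closed in the Finsler manifold given by \<open>A\<close> and \<open>L\<close>, whose Cartan
  connection is \<open>D\<close>.\<close>

definition dbar_closed ::
  "('e::euclidean_space, 'a) atlas \<Rightarrow> ('a \<times> 'a tvec \<Rightarrow> real) \<Rightarrow> 'a pi_conn \<Rightarrow>
   ('a \<times> 'a tvec \<Rightarrow> 'a tvec) \<Rightarrow> bool" where
  "dbar_closed A L D X \<longleftrightarrow>
     (\<forall>Y Z. pi_vector_field A Y \<and> pi_vector_field A Z \<longrightarrow>
        (\<forall>u\<in>slit_tangent A. dbar A D (\<lambda>w. finsler_metric L w (X w)) Y Z u = 0))"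

end

theory Submission
  imports Defs
begin

text \<open>The bracket term of \<open>dbar\<close> is a commutator of derivations, so for a function \<open>f\<close> on the base the
  form \<open>df\<close> is closed for every horizontal lift, and \<open>exp \<tau> df\<close> has the differential
  \<open>exp \<tau> (d\<tau> \<and> df)\<close>.  Hence the \<open>L\<close>-gradient of \<open>f\<close> is closed for \<open>L\<close>, and it is closed for
  \<open>exp \<sigma> L\<close> only if \<open>d\<sigma> \<and> df = 0\<close>.  In dimension at least 2 this cannot hold for all \<open>f\<close>
  unless \<open>d\<sigma> = 0\<close>, and then \<open>\<sigma>\<close> is constant by connectedness.

  Conversely, if \<open>\<sigma>\<close> is constant then both connections are Cartan connections of \<open>L\<close>.  They have the
  same horizontal lift: their difference is skew for the metric, the symmetry of the mixed torsion kills its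
  vertical part, and Euler's relation together with the vanishing of the horizontal torsion kills the
  difference of the lifts.\<close>

section \<open>Smooth maps between Euclidean spaces\<close>

text \<open>The connections \<open>D\<close> and \<open>D'\<close> are known only through their
  axioms, so the axioms are tested on fields that can be built by hand: bump function extensions of
  vectors of the base, and the fundamental field. Of a connection only the horizontal lift enters
  \<open>dbar\<close>, and in the bracket only through \<open>rho\<close>; there the lift is never
  differentiated as a field, and vanishing horizontal torsion makes the projected bracket a tangent
  vector. For \<open>exp \<tau> df\<close> with \<tau> and \<open>f\<close> from the base the lift
  drops out altogether, since the lift of \<open>v\<close> acts on such functions as
  \<open>v\<close> does. Hence a non-constant \<sigma> is excluded without comparing
  \<open>D\<close> and \<open>D'\<close>. Other forms do feel the lift, which is why the converse
  needs its uniqueness. Since the metric depends on the direction, gradients live on the pullback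
  bundle; their smoothness comes from a positive definite linear system with smooth coefficients.
  Tangent vectors are derivations with value 0 on functions that are not smooth nearby, so
  equalities of vectors split into two cases, and smoothness on the base and on the slit bundle has
  to match exactly.\<close>

lemma Ck_on_cong:
  assumes "open S" "\<And>x. x \<in> S \<Longrightarrow> f x = g x" "Ck_on k f S"
  shows "Ck_on k g S"
  using assms(2,3)
proof (induction k arbitrary: f g)
  case 0
  then show ?case by (simp cong: continuous_on_cong_simp)
next
  case (Suc k)
  \<comment> \<open>The derivative at a point is taken in the whole space; \<open>f\<close> and
    \<open>g\<close> share it because \<open>S\<close> is open.\<close>
  have d: "(g has_derivative frechet_derivative f (at x)) (at x)" if "x \<in> S" for x
  proof (rule has_derivative_transform_within_open[OF _ assms(1) that])
    show "(f has_derivative frechet_derivative f (at x)) (at x)"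
      using Suc.prems(2) that by (simp flip: frechet_derivative_works)
  qed (use Suc.prems(1) in auto)
  have "Ck_on k (\<lambda>x. frechet_derivative g (at x) v) S" for v
    by (rule Suc.IH[of "\<lambda>x. frechet_derivative f (at x) v"])
      (use Suc.prems(2) in \<open>auto simp: frechet_derivative_at[OF d, symmetric]\<close>)
  with d show ?case by (auto simp: differentiable_def)
qed

lemma Ck_on_subset:
  assumes "Ck_on k f S" "T \<subseteq> S"
  shows "Ck_on k f T"
  using assms by (induction k arbitrary: f) (auto intro: continuous_on_subset)

lemma Ck_on_SucI:
  assumes "open S" "\<And>x. x \<in> S \<Longrightarrow> (f has_derivative f' x) (at x)"
    and "\<And>v. Ck_on k (\<lambda>x. f' x v) S"
  shows "Ck_on (Suc k) f S"
proof -
  have "Ck_on k (\<lambda>x. frechet_derivative f (at x) v) S" for v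
    by (rule Ck_on_cong[OF assms(1) _ assms(3)]) (simp add: frechet_derivative_at[OF assms(2), symmetric])
  with assms(2) show ?thesis by (auto simp: differentiable_def)
qed

lemma Ck_on_continuous_on:
  assumes "Ck_on k f S"
  shows "continuous_on S f"
proof (cases k)
  case (Suc m)
  with assms show ?thesis
    by (auto intro!: continuous_at_imp_continuous_on dest: differentiable_imp_continuous_within)
qed (use assms in simp)

lemma Ck_on_SucD: "Ck_on (Suc k) f S \<Longrightarrow> Ck_on k f S"
proof (induction k arbitrary: f)
  case 0
  from Ck_on_continuous_on[OF this] show ?case by simp
next
  case (Suc k)
  \<comment> \<open>Only one layer is unfolded, which leaves the derivative at level
    \<open>Suc k\<close>, as the induction hypothesis requires.\<close>
  have "\<forall>x\<in>S. f differentiable at x" "\<And>v. Ck_on (Suc k) (\<lambda>x. frechet_derivative f (at x) v) S"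
    using Suc.prems by (subst (asm) Ck_on.simps(2), blast)+
  with Suc.IH show ?case by simp
qed

lemma Ck_on_local:
  assumes "\<And>x. x \<in> S \<Longrightarrow> \<exists>W. open W \<and> x \<in> W \<and> Ck_on k f W"
  shows "Ck_on k f S"
  using assms
proof (induction k arbitrary: f)
  case 0
  then show ?case
    by (simp, meson continuous_at_imp_continuous_on continuous_on_eq_continuous_at)
next
  case (Suc k)
  have "Ck_on k (\<lambda>x. frechet_derivative f (at x) v) S" for v
    by (rule Suc.IH) (use Suc.prems in fastforce)
  moreover have "f differentiable (at x)" if "x \<in> S" for x
    using Suc.prems[OF that] by auto
  ultimately show ?case by simp
qed

lemma Ck_on_const: "Ck_on k (\<lambda>x. c) S"
  by (induction k arbitrary: c) auto

lemma Ck_on_add: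
  assumes "open S" "Ck_on k f S" "Ck_on k g S"
  shows "Ck_on k (\<lambda>x. f x + g x) S"
  using assms(2,3)
proof (induction k arbitrary: f g)
  case (Suc k)
  show ?case
  proof (rule Ck_on_SucI[OF assms(1)])
    show "((\<lambda>x. f x + g x) has_derivative
        (\<lambda>v. frechet_derivative f (at x) v + frechet_derivative g (at x) v)) (at x)" if "x \<in> S" for x
      using Suc.prems that by (auto intro!: has_derivative_add simp flip: frechet_derivative_works)
  qed (use Suc in auto)
qed (auto intro: continuous_on_add)

lemma Ck_on_bounded_linear:
  assumes "open S" "bounded_linear T" "Ck_on k f S"
  shows "Ck_on k (\<lambda>x. T (f x)) S"
  using assms(3)
proof (induction k arbitrary: f)
  case 0
  then show ?case using assms(2) by (auto intro: bounded_linear.continuous_on)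
next
  case (Suc k)
  show ?case
  proof (rule Ck_on_SucI[OF assms(1)])
    show "((\<lambda>x. T (f x)) has_derivative (\<lambda>v. T (frechet_derivative f (at x) v))) (at x)"
      if "x \<in> S" for x
      using Suc.prems that
      by (auto intro!: bounded_linear.has_derivative[OF assms(2)] simp flip: frechet_derivative_works)
  qed (use Suc in auto)
qed

lemma Ck_on_bounded_bilinear:
  assumes "open S" "bounded_bilinear prd" "Ck_on k f S" "Ck_on k g S"
  shows "Ck_on k (\<lambda>x. prd (f x) (g x)) S"
  using assms(3,4)
proof (induction k arbitrary: f g)
  case 0
  then show ?case using assms(2) by (auto intro: bounded_bilinear.continuous_on)
next
  case (Suc k)
  show ?case
  proof (rule Ck_on_SucI[OF assms(1)])
    show "((\<lambda>x. prd (f x) (g x)) has_derivative (\<lambda>v. prd (f x) (frechet_derivative g (at x) v)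
        + prd (frechet_derivative f (at x) v) (g x))) (at x)"
      if "x \<in> S" for x
      using Suc.prems that
      by (auto intro!: bounded_bilinear.FDERIV[OF assms(2)] simp flip: frechet_derivative_works)
    show "Ck_on k (\<lambda>x. prd (f x) (frechet_derivative g (at x) v)
        + prd (frechet_derivative f (at x) v) (g x)) S" for v
      using Suc.prems Ck_on_SucD[OF Suc.prems(1)] Ck_on_SucD[OF Suc.prems(2)]
      by (intro Ck_on_add assms(1) Suc.IH) auto
  qed
qed

lemma Ck_on_linear:
  assumes "open S" "bounded_linear T"
  shows "Ck_on k T S"
proof (cases k)
  case 0
  then show ?thesis by (simp add: assms(2) linear_continuous_on)
next
  case (Suc m)
  show ?thesis unfolding Suc
    by (rule Ck_on_SucI[OF assms(1), of _ "\<lambda>_. T"])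
      (auto intro: bounded_linear_imp_has_derivative assms(2) Ck_on_const)
qed

lemma Ck_on_sum:
  assumes "open S" "\<And>i. i \<in> I \<Longrightarrow> Ck_on k (f i) S"
  shows "Ck_on k (\<lambda>x. \<Sum>i\<in>I. f i x) S"
  using assms(2)
  by (induction I rule: infinite_finite_induct) (auto intro: Ck_on_const Ck_on_add assms(1))

text \<open>\<open>Ck_on\<close> speaks of derivatives in a fixed direction. Expanding over
  \<open>Basis\<close> turns a derivative in a direction that varies with the point into a finite
  sum of products, to which the sum and product rules apply.\<close>

lemma linear_expansion:
  fixes T :: "'a::euclidean_space \<Rightarrow> 'b::real_vector"
  assumes "linear T"
  shows "T v = (\<Sum>b\<in>Basis. (v \<bullet> b) *\<^sub>R T b)"
proof -
  have "T v = T (\<Sum>b\<in>Basis. (v \<bullet> b) *\<^sub>R b)" by (simp add: euclidean_representation)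
  also have "\<dots> = (\<Sum>b\<in>Basis. (v \<bullet> b) *\<^sub>R T b)"
    by (simp add: linear_sum[OF assms] linear_scale[OF assms])
  finally show ?thesis .
qed

lemma Ck_on_compose:
  fixes g :: "'a::euclidean_space \<Rightarrow> 'b::euclidean_space"
  assumes "open S" "open T" "g ` S \<subseteq> T" "Ck_on k f T" "Ck_on k g S"
  shows "Ck_on k (\<lambda>x. f (g x)) S"
  using assms(4,5)
proof (induction k arbitrary: f)
  case 0
  then show ?case using continuous_on_compose2[OF _ _ assms(3), of f] by simp
next
  case (Suc k)
  show ?case
  proof (rule Ck_on_SucI[OF assms(1)])
    fix x assume x: "x \<in> S"
    let ?f = "frechet_derivative f (at (g x))"
    have f: "(f has_derivative ?f) (at (g x))"
      using Suc.prems x assms(3) by (auto simp flip: frechet_derivative_works)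
    have "(g has_derivative frechet_derivative g (at x)) (at x)"
      using Suc.prems x by (auto simp flip: frechet_derivative_works)
    from diff_chain_at[OF this f]
    have "((\<lambda>x. f (g x)) has_derivative (\<lambda>v. ?f (frechet_derivative g (at x) v))) (at x)"
      by (simp add: o_def)
    \<comment> \<open>The direction in which \<open>f\<close> is differentiated moves with
      \<open>x\<close>; the sum over \<open>Basis\<close> is the form of the chain rule that the
      induction hypothesis can handle.\<close>
    then show "((\<lambda>x. f (g x)) has_derivative
      (\<lambda>v. \<Sum>b\<in>Basis. (frechet_derivative g (at x) v \<bullet> b) *\<^sub>R ?f b)) (at x)"
      by (subst (asm) linear_expansion[OF has_derivative_linear[OF f]])
  next
    fix v
    have gk: "Ck_on k g S" using Suc.prems Ck_on_SucD by blast
    have "Ck_on k (\<lambda>x. frechet_derivative f (at (g x)) b) S" for b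
      by (rule Suc.IH[of "\<lambda>z. frechet_derivative f (at z) b"]) (use Suc.prems(1) gk in auto)
    moreover have "Ck_on k (\<lambda>x. frechet_derivative g (at x) v \<bullet> b) S" for b
      using Suc.prems
      by (intro Ck_on_bounded_linear[of _ "\<lambda>z. z \<bullet> b"] assms(1) bounded_linear_inner_left) auto
    ultimately show "Ck_on k (\<lambda>x. \<Sum>b\<in>Basis. (frechet_derivative g (at x) v \<bullet> b) *\<^sub>R
        frechet_derivative f (at (g x)) b) S"
      by (intro Ck_on_sum Ck_on_bounded_bilinear[OF _ bounded_bilinear_scaleR] assms(1))
  qed
qed

lemma smooth_on_cong:
  "open S \<Longrightarrow> (\<And>x. x \<in> S \<Longrightarrow> f x = g x) \<Longrightarrow> smooth_on f S \<Longrightarrow> smooth_on g S"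
  using Ck_on_cong[of S f g] by (auto simp: smooth_on_def)

lemma smooth_on_subset: "smooth_on f S \<Longrightarrow> T \<subseteq> S \<Longrightarrow> smooth_on f T"
  using Ck_on_subset[of _ f S T] by (auto simp: smooth_on_def)

lemma smooth_on_local:
  "(\<And>x. x \<in> S \<Longrightarrow> \<exists>W. open W \<and> x \<in> W \<and> smooth_on f W) \<Longrightarrow> smooth_on f S"
  unfolding smooth_on_def by (intro allI Ck_on_local) blast

lemma smooth_on_const: "smooth_on (\<lambda>x. c) S"
  by (simp add: smooth_on_def Ck_on_const)

lemma smooth_on_add:
  "open S \<Longrightarrow> smooth_on f S \<Longrightarrow> smooth_on g S \<Longrightarrow> smooth_on (\<lambda>x. f x + g x) S"
  by (simp add: smooth_on_def Ck_on_add)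

lemma smooth_on_sum:
  "open S \<Longrightarrow> (\<And>i. i \<in> I \<Longrightarrow> smooth_on (f i) S) \<Longrightarrow> smooth_on (\<lambda>x. \<Sum>i\<in>I. f i x) S"
  by (simp add: smooth_on_def Ck_on_sum)

lemma smooth_on_bounded_linear:
  "open S \<Longrightarrow> bounded_linear T \<Longrightarrow> smooth_on f S \<Longrightarrow> smooth_on (\<lambda>x. T (f x)) S"
  by (simp add: smooth_on_def Ck_on_bounded_linear)

lemma smooth_on_linear: "open S \<Longrightarrow> bounded_linear T \<Longrightarrow> smooth_on T S"
  by (simp add: smooth_on_def Ck_on_linear)

lemma smooth_on_mult:
  fixes f g :: "'e::euclidean_space \<Rightarrow> real"
  shows "open S \<Longrightarrow> smooth_on f S \<Longrightarrow> smooth_on g S \<Longrightarrow> smooth_on (\<lambda>x. f x * g x) S"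
  by (simp add: smooth_on_def Ck_on_bounded_bilinear[OF _ bounded_bilinear_mult])

lemma smooth_on_scaleR:
  "open S \<Longrightarrow> smooth_on f S \<Longrightarrow> smooth_on g S \<Longrightarrow> smooth_on (\<lambda>x. f x *\<^sub>R g x) S"
  by (simp add: smooth_on_def Ck_on_bounded_bilinear[OF _ bounded_bilinear_scaleR])

lemma smooth_on_inner:
  fixes f g :: "'e::euclidean_space \<Rightarrow> 'f::real_inner"
  shows "open S \<Longrightarrow> smooth_on f S \<Longrightarrow> smooth_on g S \<Longrightarrow> smooth_on (\<lambda>x. f x \<bullet> g x) S"
  by (simp add: smooth_on_def Ck_on_bounded_bilinear[OF _ bounded_bilinear_inner])

lemma smooth_on_minus:
  assumes "open S" "smooth_on f S" shows "smooth_on (\<lambda>x. - f x) S"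
  using smooth_on_bounded_linear[OF assms(1) bounded_linear_minus[OF bounded_linear_ident] assms(2)] .

lemma smooth_on_diff:
  assumes "open S" "smooth_on f S" "smooth_on g S" shows "smooth_on (\<lambda>x. f x - g x) S"
  using smooth_on_add[OF assms(1,2) smooth_on_minus[OF assms(1,3)]] by simp

lemma smooth_on_compose:
  fixes g :: "'a::euclidean_space \<Rightarrow> 'b::euclidean_space"
  shows "open S \<Longrightarrow> open T \<Longrightarrow> g ` S \<subseteq> T \<Longrightarrow> smooth_on f T \<Longrightarrow> smooth_on g S \<Longrightarrow>
    smooth_on (\<lambda>x. f (g x)) S"
  unfolding smooth_on_def by (rule allI, rule Ck_on_compose[of S T g]) auto

lemma smooth_on_Pair:
  assumes "open S" "smooth_on f S" "smooth_on g S"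
  shows "smooth_on (\<lambda>x. (f x, g x)) S"
proof -
  have "smooth_on (\<lambda>x. (f x, 0) + (0, g x)) S"
    using assms
    by (intro smooth_on_add smooth_on_bounded_linear[of S "\<lambda>z. (z, 0)"]
        smooth_on_bounded_linear[of S "\<lambda>z. (0, z)"])
      (auto intro: bounded_linear_Pair bounded_linear_ident bounded_linear_zero)
  then show ?thesis by simp
qed

lemma smooth_on_continuous_on: "smooth_on f S \<Longrightarrow> continuous_on S f"
  using Ck_on_continuous_on smooth_on_def by blast

lemma smooth_on_differentiable: "smooth_on f S \<Longrightarrow> x \<in> S \<Longrightarrow> f differentiable (at x)"
  unfolding smooth_on_def by (metis Ck_on.simps(2))

lemma smooth_on_has_derivative:
  "smooth_on f S \<Longrightarrow> x \<in> S \<Longrightarrow> (f has_derivative frechet_derivative f (at x)) (at x)"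
  using smooth_on_differentiable frechet_derivative_works by blast

lemma smooth_on_frechet_derivative:
  "smooth_on f S \<Longrightarrow> smooth_on (\<lambda>x. frechet_derivative f (at x) v) S"
  unfolding smooth_on_def by (metis Ck_on.simps(2))

text \<open>Base point and direction may both move; tangent maps of transitions and the action of a
  field on a function have this form.\<close>

lemma smooth_on_frechet_derivative':
  fixes f :: "'a::euclidean_space \<Rightarrow> 'b::real_normed_vector"
  assumes "open S" "smooth_on f S" "open T" "smooth_on h T" "h ` T \<subseteq> S" "smooth_on v T"
  shows "smooth_on (\<lambda>x. frechet_derivative f (at (h x)) (v x)) T"
proof -
  have "smooth_on (\<lambda>x. \<Sum>b\<in>Basis. (v x \<bullet> b) *\<^sub>R frechet_derivative f (at (h x)) b) T"
    using assms
    by (intro smooth_on_sum smooth_on_scaleR smooth_on_inner smooth_on_const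
        smooth_on_compose[of T S h "\<lambda>z. frechet_derivative f (at z) _"] smooth_on_frechet_derivative)
  moreover have "(\<Sum>b\<in>Basis. (v x \<bullet> b) *\<^sub>R frechet_derivative f (at (h x)) b)
      = frechet_derivative f (at (h x)) (v x)" if "x \<in> T" for x
    using assms that
    by (intro linear_expansion[symmetric] has_derivative_linear[OF smooth_on_has_derivative]) auto
  ultimately show ?thesis using assms(3) smooth_on_cong by (metis (no_types, lifting))
qed

section \<open>Inverse, exponential and bump functions on Euclidean spaces\<close>

lemma smooth_on_inverse: "smooth_on (inverse :: real \<Rightarrow> real) (- {0})"
proof -
  have "Ck_on k (inverse :: real \<Rightarrow> real) (- {0})" for k
  proof (induction k)
    case (Suc k)
    have "Ck_on k (\<lambda>x::real. - (inverse x * v * inverse x)) (- {0})" for v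
      using Suc
      by (intro Ck_on_bounded_linear[OF _ bounded_linear_minus[OF bounded_linear_ident]]
          Ck_on_bounded_bilinear[OF _ bounded_bilinear_mult] Ck_on_const) auto
    then show ?case
      by (intro Ck_on_SucI[where f' = "\<lambda>x v. - (inverse x * v * inverse x)"] has_derivative_inverse') auto
  qed (auto intro: continuous_intros)
  then show ?thesis by (simp add: smooth_on_def)
qed

lemma smooth_on_divide:
  fixes f g :: "'e::euclidean_space \<Rightarrow> real"
  assumes "open S" "smooth_on f S" "smooth_on g S" "\<And>x. x \<in> S \<Longrightarrow> g x \<noteq> 0"
  shows "smooth_on (\<lambda>x. f x / g x) S"
  unfolding divide_inverse using assms
  by (intro smooth_on_mult smooth_on_compose[OF _ _ _ smooth_on_inverse]) auto

lemma smooth_on_exp: "smooth_on (exp :: real \<Rightarrow> real) UNIV"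
proof -
  have "Ck_on k (exp :: real \<Rightarrow> real) UNIV" for k
  proof (induction k)
    case (Suc k)
    have "Ck_on k (\<lambda>x::real. exp x * v) UNIV" for v
      using Suc by (intro Ck_on_bounded_bilinear[OF _ bounded_bilinear_mult] Ck_on_const) auto
    moreover have "(exp has_derivative (*) (exp x)) (at x)" for x :: real
      using DERIV_exp has_field_derivative_def by blast
    ultimately show ?case
      by (intro Ck_on_SucI) auto
  qed (auto intro: continuous_intros)
  then show ?thesis by (simp add: smooth_on_def)
qed

text \<open>For \<open>n = 0\<close> this is the standard function that is flat at 0. With the
  powers of \<open>1 / t\<close> the linear span of the family is closed under differentiation, so
  smoothness of every order follows by one induction.\<close>

definition flat_exp :: "nat \<Rightarrow> real \<Rightarrow> real" where
  "flat_exp n t = (if t > 0 then (1 / t) ^ n * exp (- (1 / t)) else 0)"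

lemma flat_exp_tendsto_0: "(flat_exp n \<longlongrightarrow> 0) (at 0)"
proof -
  have "((\<lambda>t. (1 / t) ^ n * exp (- (1 / t))) \<longlongrightarrow> 0) (at_right (0::real))"
  proof -
    have "((\<lambda>t. (1 / t) ^ n / exp (1 / t)) \<longlongrightarrow> 0) (at_right (0::real))"
      by (rule filterlim_compose[OF tendsto_power_div_exp_0])
        (simp add: divide_inverse filterlim_inverse_at_top_right)
    then show ?thesis by (simp add: exp_minus divide_inverse)
  qed
  then have "(flat_exp n \<longlongrightarrow> 0) (at_right 0)"
    by (rule tendsto_cong[THEN iffD1, rotated])
      (auto simp: eventually_at_filter flat_exp_def intro!: always_eventually)
  moreover have "(flat_exp n \<longlongrightarrow> 0) (at_left 0)"
    by (rule tendsto_eventually) (auto simp: eventually_at_filter flat_exp_def intro!: always_eventually)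
  ultimately show ?thesis by (simp add: filterlim_split_at)
qed

lemma has_real_derivative_flat_exp:
  "(flat_exp n has_real_derivative flat_exp (n + 2) t - real n * flat_exp (n + 1) t) (at t)"
proof -
  consider "t < 0" | "t = 0" | "t > 0" by linarith
  then show ?thesis
  proof cases
    case 1
    have "(flat_exp n has_real_derivative 0) (at t)"
      by (rule has_field_derivative_transform_within_open[OF DERIV_const, of "{..<0}" _ 0])
        (use 1 in \<open>auto simp: flat_exp_def\<close>)
    with 1 show ?thesis by (simp add: flat_exp_def)
  next
    case 2
    \<comment> \<open>The difference quotient at 0 is \<open>flat_exp (n + 1)\<close>, whose limit
      is known.\<close>
    have "((\<lambda>h. (flat_exp n h - flat_exp n 0) / h) \<longlongrightarrow> 0) (at 0)"
      by (rule tendsto_cong[THEN iffD1, OF _ flat_exp_tendsto_0[of "n + 1"]])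
        (auto simp: flat_exp_def eventually_at_filter intro!: always_eventually)
    with 2 show ?thesis by (simp add: DERIV_def flat_exp_def)
  next
    case 3
    have "((\<lambda>t. (1 / t) ^ n * exp (- (1 / t))) has_real_derivative
        flat_exp (n + 2) t - real n * flat_exp (n + 1) t) (at t)"
      using 3
      by (auto intro!: derivative_eq_intros simp: flat_exp_def)
        (cases n; simp add: field_simps power2_eq_square)
    then show ?thesis
      by (rule has_field_derivative_transform_within_open[of _ _ _ "{0<..}"])
        (use 3 in \<open>auto simp: flat_exp_def\<close>)
  qed
qed

lemma smooth_on_flat_exp: "smooth_on (flat_exp n) UNIV"
proof -
  have "Ck_on k (flat_exp n) UNIV" for k n
  proof (induction k arbitrary: n)
    case 0
    show ?case
      by (auto intro!: continuous_at_imp_continuous_on DERIV_isCont has_real_derivative_flat_exp)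
  next
    case (Suc k)
    have "Ck_on k (\<lambda>t. (flat_exp (n + 2) t + (- real n) * flat_exp (n + 1) t) * v) UNIV" for v
      by (intro Ck_on_bounded_bilinear[OF _ bounded_bilinear_mult] Ck_on_add Ck_on_const Suc) auto
    then show ?case
      using has_real_derivative_flat_exp[of n]
      by (intro Ck_on_SucI[where f' = "\<lambda>t v. (flat_exp (n + 2) t + (- real n) * flat_exp (n + 1) t) * v"])
        (auto simp: has_field_derivative_def)
  qed
  then show ?thesis by (simp add: smooth_on_def)
qed

lemma bump_function_ball:
  fixes a :: "'e::euclidean_space"
  assumes "r > 0"
  obtains \<theta> :: "'e \<Rightarrow> real" where "smooth_on \<theta> UNIV" "\<theta> a = 1" "\<And>x. x \<notin> cball a r \<Longrightarrow> \<theta> x = 0"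
proof
  \<comment> \<open>The squared norm is used because it is smooth at \<open>a\<close> too; the
    denominator is the value at the centre.\<close>
  let ?\<theta> = "\<lambda>x. flat_exp 0 (r\<^sup>2 - (x - a) \<bullet> (x - a)) / flat_exp 0 (r\<^sup>2)"
  have p: "flat_exp 0 (r\<^sup>2) > 0" using assms by (simp add: flat_exp_def)
  show "smooth_on ?\<theta> UNIV"
    using p
    by (intro smooth_on_divide smooth_on_const smooth_on_compose[OF _ _ _ smooth_on_flat_exp]
        smooth_on_diff smooth_on_inner smooth_on_linear bounded_linear_ident) auto
  show "?\<theta> a = 1" using p by simp
  show "?\<theta> x = 0" if "x \<notin> cball a r" for x
  proof -
    have "r\<^sup>2 < (norm (x - a))\<^sup>2"
      using that assms by (intro power_strict_mono) (auto simp: dist_norm norm_minus_commute)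
    then show ?thesis by (simp add: flat_exp_def dot_square_norm)
  qed
qed

section \<open>Symmetry of second derivatives\<close>

lemma mixed_difference_mvt:
  fixes f :: "real \<Rightarrow> real \<Rightarrow> real"
  assumes "h > 0"
    and 1: "\<And>s t. 0 \<le> s \<Longrightarrow> s \<le> h \<Longrightarrow> 0 \<le> t \<Longrightarrow> t \<le> h \<Longrightarrow> ((\<lambda>s. f s t) has_real_derivative f1 s t) (at s)"
    and 2: "\<And>s t. 0 \<le> s \<Longrightarrow> s \<le> h \<Longrightarrow> 0 \<le> t \<Longrightarrow> t \<le> h \<Longrightarrow> (f1 s has_real_derivative f12 s t) (at t)"
  obtains s t where "0 < s" "s < h" "0 < t" "t < h"
    "f h h - f h 0 - f 0 h + f 0 0 = h * h * f12 s t"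
proof -
  \<comment> \<open>Mean value theorem in \<open>s\<close> for \<open>f s h - f s 0\<close>; the
    next application is in \<open>t\<close>.\<close>
  have "\<exists>z>0. z < h \<and> (f h h - f h 0) - (f 0 h - f 0 0) = (h - 0) * (f1 z h - f1 z 0)"
    by (rule MVT2) (use assms(1) in \<open>auto intro!: derivative_eq_intros 1\<close>)
  then obtain s where s: "0 < s" "s < h" "(f h h - f h 0) - (f 0 h - f 0 0) = h * (f1 s h - f1 s 0)"
    by auto
  have "\<exists>z>0. z < h \<and> f1 s h - f1 s 0 = (h - 0) * f12 s z"
    by (rule MVT2) (use assms(1) s in \<open>auto intro!: 2\<close>)
  then obtain t where "0 < t" "t < h" "f1 s h - f1 s 0 = h * f12 s t" by auto
  with s show ?thesis by (intro that[of s t]) (auto simp: algebra_simps)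
qed

lemma has_real_derivative_along_line:
  fixes f :: "'e::euclidean_space \<Rightarrow> real"
  assumes "smooth_on f S" "a + t *\<^sub>R v \<in> S"
  shows "((\<lambda>t. f (a + t *\<^sub>R v)) has_real_derivative frechet_derivative f (at (a + t *\<^sub>R v)) v) (at t)"
proof -
  let ?D = "frechet_derivative f (at (a + t *\<^sub>R v))"
  have f: "(f has_derivative ?D) (at (a + t *\<^sub>R v))"
    using smooth_on_has_derivative assms by blast
  have "((\<lambda>t. a + t *\<^sub>R v) has_derivative (\<lambda>s. s *\<^sub>R v)) (at t)"
    by (auto intro!: derivative_eq_intros)
  from diff_chain_at[OF this f]
  have "((\<lambda>t. f (a + t *\<^sub>R v)) has_derivative (\<lambda>s. ?D (s *\<^sub>R v))) (at t)" by (simp add: o_def)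
  then show ?thesis
    by (simp add: has_field_derivative_def linear_scale[OF has_derivative_linear[OF f]] mult_commute_abs)
qed

lemma second_difference:
  fixes f :: "'e::euclidean_space \<Rightarrow> real"
  assumes "smooth_on f S" "h > 0"
    and "\<And>s t. 0 \<le> s \<Longrightarrow> s \<le> h \<Longrightarrow> 0 \<le> t \<Longrightarrow> t \<le> h \<Longrightarrow> a + s *\<^sub>R v + t *\<^sub>R w \<in> S"
  obtains s t where "0 < s" "s < h" "0 < t" "t < h"
    "f (a + h *\<^sub>R v + h *\<^sub>R w) - f (a + h *\<^sub>R v) - f (a + h *\<^sub>R w) + f a =
      h * h * frechet_derivative (\<lambda>x. frechet_derivative f (at x) v) (at (a + s *\<^sub>R v + t *\<^sub>R w)) w"
proof -
  let ?D = "\<lambda>x. frechet_derivative f (at x) v"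
  have "\<exists>s t. 0 < s \<and> s < h \<and> 0 < t \<and> t < h \<and>
    f (a + h *\<^sub>R v + h *\<^sub>R w) - f (a + h *\<^sub>R v + 0 *\<^sub>R w) - f (a + 0 *\<^sub>R v + h *\<^sub>R w)
      + f (a + 0 *\<^sub>R v + 0 *\<^sub>R w) =
    h * h * frechet_derivative ?D (at (a + s *\<^sub>R v + t *\<^sub>R w)) w"
  proof (rule mixed_difference_mvt[OF assms(2), of "\<lambda>s t. f (a + s *\<^sub>R v + t *\<^sub>R w)"
      "\<lambda>s t. ?D (a + s *\<^sub>R v + t *\<^sub>R w)" "\<lambda>s t. frechet_derivative ?D (at (a + s *\<^sub>R v + t *\<^sub>R w)) w"])
    fix s t assume st: "0 \<le> s" "s \<le> h" "0 \<le> t" "t \<le> h"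
    have "((\<lambda>s. f (a + t *\<^sub>R w + s *\<^sub>R v)) has_real_derivative ?D (a + t *\<^sub>R w + s *\<^sub>R v)) (at s)"
      using assms(1,3) st by (intro has_real_derivative_along_line[of f S]) (auto simp: ac_simps)
    then show "((\<lambda>s. f (a + s *\<^sub>R v + t *\<^sub>R w)) has_real_derivative ?D (a + s *\<^sub>R v + t *\<^sub>R w)) (at s)"
      by (simp add: ac_simps)
    show "((\<lambda>t. ?D (a + s *\<^sub>R v + t *\<^sub>R w)) has_real_derivative
        frechet_derivative ?D (at (a + s *\<^sub>R v + t *\<^sub>R w)) w) (at t)"
      using assms st
      by (intro has_real_derivative_along_line[of _ S] smooth_on_frechet_derivative) auto
  qed blast
  then show ?thesis using that by auto
qed

text \<open>The second difference over a small parallelogram does not depend on the order of its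
  edges, while the mean value theorem equates it with either mixed derivative at a nearby point;
  continuity at \<open>a\<close> then excludes a gap. The symmetry of the Finsler metric rests on
  this.\<close>

lemma frechet_derivative_commute:
  fixes f :: "'e::euclidean_space \<Rightarrow> real"
  assumes "open S" "smooth_on f S" "a \<in> S"
  shows "frechet_derivative (\<lambda>x. frechet_derivative f (at x) v) (at a) w =
         frechet_derivative (\<lambda>x. frechet_derivative f (at x) w) (at a) v"
    (is "?P a = ?Q a")
proof (rule ccontr)
  assume ne: "?P a \<noteq> ?Q a"
  define \<epsilon> where "\<epsilon> = \<bar>?P a - ?Q a\<bar> / 2"
  have "\<epsilon> > 0" using ne by (simp add: \<epsilon>_def)
  have "continuous_on S ?P" "continuous_on S ?Q"
    by (intro smooth_on_continuous_on smooth_on_frechet_derivative assms(2))+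
  then have "(?P \<longlongrightarrow> ?P a) (nhds a)" "(?Q \<longlongrightarrow> ?Q a) (nhds a)"
    using assms(1,3) tendsto_at_iff_tendsto_nhds[of ?P a] tendsto_at_iff_tendsto_nhds[of ?Q a]
    by (simp_all add: continuous_on_eq_continuous_at isCont_def)
  with \<open>\<epsilon> > 0\<close> have "\<forall>\<^sub>F x in nhds a. x \<in> S \<and> dist (?P x) (?P a) < \<epsilon> \<and> dist (?Q x) (?Q a) < \<epsilon>"
    using assms(1,3)
    by (intro eventually_conj eventually_nhds_in_open) (auto intro: tendstoD)
  then obtain r where r: "r > 0" "\<And>x. dist x a < r \<Longrightarrow> x \<in> S \<and> dist (?P x) (?P a) < \<epsilon> \<and> dist (?Q x) (?Q a) < \<epsilon>"
    unfolding eventually_nhds_metric by blast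
  \<comment> \<open>This \<open>h\<close> keeps the parallelogram with edges \<open>h\<close> times
    \<open>v\<close> and \<open>w\<close> inside the ball of radius \<open>r\<close>; the added 1
    avoids division by 0.\<close>
  define h where "h = r / (2 * (norm v + norm w + 1))"
  have "h > 0" using r by (simp add: h_def add_nonneg_pos)
  have near: "dist (a + s *\<^sub>R v + t *\<^sub>R w) a < r" "dist (a + s *\<^sub>R w + t *\<^sub>R v) a < r"
    if "0 \<le> s" "s \<le> h" "0 \<le> t" "t \<le> h" for s t
  proof -
    have *: "s * norm v \<le> h * norm v" "t * norm w \<le> h * norm w"
      "s * norm w \<le> h * norm w" "t * norm v \<le> h * norm v"
      using that by (auto intro: mult_right_mono)
    have "norm (s *\<^sub>R v + t *\<^sub>R w) \<le> h * (norm v + norm w)" "norm (s *\<^sub>R w + t *\<^sub>R v) \<le> h * (norm v + norm w)"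
      using that * norm_triangle_ineq[of "s *\<^sub>R v" "t *\<^sub>R w"] norm_triangle_ineq[of "s *\<^sub>R w" "t *\<^sub>R v"]
      by (simp_all add: distrib_left)
    moreover have "h * (norm v + norm w) < r"
    proof -
      have "r * (norm v + norm w) < r * (2 * (norm v + norm w + 1))"
        using r(1) by (intro mult_strict_left_mono) (auto simp: add_nonneg_pos)
      then show ?thesis by (simp add: h_def pos_divide_less_eq add_nonneg_pos)
    qed
    ultimately show "dist (a + s *\<^sub>R v + t *\<^sub>R w) a < r" "dist (a + s *\<^sub>R w + t *\<^sub>R v) a < r"
      by (auto simp: dist_norm add.assoc)
  qed
  let ?\<Delta> = "f (a + h *\<^sub>R v + h *\<^sub>R w) - f (a + h *\<^sub>R v) - f (a + h *\<^sub>R w) + f a"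
  obtain s t where 1: "0 < s" "s < h" "0 < t" "t < h" "?\<Delta> = h * h * ?P (a + s *\<^sub>R v + t *\<^sub>R w)"
    by (rule second_difference[OF assms(2) \<open>h > 0\<close>, of a v w]) (use near r(2) in auto)
  obtain s' t' where 2: "0 < s'" "s' < h" "0 < t'" "t' < h"
      "f (a + h *\<^sub>R w + h *\<^sub>R v) - f (a + h *\<^sub>R w) - f (a + h *\<^sub>R v) + f a = h * h * ?Q (a + s' *\<^sub>R w + t' *\<^sub>R v)"
    by (rule second_difference[OF assms(2) \<open>h > 0\<close>, of a w v]) (use near r(2) in auto)
  have "?P (a + s *\<^sub>R v + t *\<^sub>R w) = ?Q (a + s' *\<^sub>R w + t' *\<^sub>R v)"
  proof -
    have "?\<Delta> = f (a + h *\<^sub>R w + h *\<^sub>R v) - f (a + h *\<^sub>R w) - f (a + h *\<^sub>R v) + f a"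
      by (simp add: add.assoc add.commute[of "h *\<^sub>R v"])
    with 1(5) 2(5) have "h * h * ?P (a + s *\<^sub>R v + t *\<^sub>R w) = h * h * ?Q (a + s' *\<^sub>R w + t' *\<^sub>R v)"
      by (rule box_equals[rotated])
    with \<open>h > 0\<close> show ?thesis by simp
  qed
  moreover have "dist (?P (a + s *\<^sub>R v + t *\<^sub>R w)) (?P a) < \<epsilon>" "dist (?Q (a + s' *\<^sub>R w + t' *\<^sub>R v)) (?Q a) < \<epsilon>"
    using near 1 2 r(2) by auto
  ultimately show False by (simp add: \<epsilon>_def dist_real_def abs_if field_simps split: if_splits)
qed

text \<open>Induction on the index set: the solution for \<open>insert b I\<close> is the solution for \<open>I\<close> corrected by a
  multiple of a vector that is orthogonal to \<open>I\<close>.\<close>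

lemma smooth_solution:
  fixes G :: "'i \<Rightarrow> 'i \<Rightarrow> 'e::euclidean_space \<Rightarrow> real"
  assumes "finite I" "open S" "\<And>i j. i \<in> I \<Longrightarrow> j \<in> I \<Longrightarrow> smooth_on (G i j) S"
    and "\<And>x h. x \<in> S \<Longrightarrow> \<exists>i\<in>I. h i \<noteq> 0 \<Longrightarrow> (\<Sum>i\<in>I. \<Sum>j\<in>I. h i * h j * G i j x) > 0"
    and "\<And>i. i \<in> I \<Longrightarrow> smooth_on (c i) S"
  shows "\<exists>h. (\<forall>i\<in>I. smooth_on (h i) S) \<and> (\<forall>x\<in>S. \<forall>j\<in>I. (\<Sum>i\<in>I. h i x * G i j x) = c j x)"
  using assms(1,3-)
proof (induction I arbitrary: c)
  case empty
  then show ?case by simp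
next
  case (insert b I)
  have pos: "(\<Sum>i\<in>I. \<Sum>j\<in>I. h i * h j * G i j x) > 0" if "x \<in> S" "\<exists>i\<in>I. h i \<noteq> 0" for x h
  proof -
    let ?h = "\<lambda>i. if i = b then 0 else h i"
    have "(\<Sum>i\<in>insert b I. \<Sum>j\<in>insert b I. ?h i * ?h j * G i j x) > 0"
      using that insert.hyps by (intro insert.prems(2)) auto
    moreover have "(\<Sum>j\<in>I. ?h i * ?h j * G i j x) = (\<Sum>j\<in>I. h i * h j * G i j x)" if "i \<in> I" for i
      using that insert.hyps by (intro sum.cong) auto
    ultimately show ?thesis using insert.hyps by simp
  qed
  note IH = insert.IH[OF insert.prems(1) pos]
  have "\<exists>h. (\<forall>i\<in>I. smooth_on (h i) S) \<and> (\<forall>x\<in>S. \<forall>j\<in>I. (\<Sum>i\<in>I. h i x * G i j x) = c j x)"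
    by (rule IH) (use insert.prems(3) in auto)
  then obtain h1 where h1: "\<And>i. i \<in> I \<Longrightarrow> smooth_on (h1 i) S"
      "\<And>x j. x \<in> S \<Longrightarrow> j \<in> I \<Longrightarrow> (\<Sum>i\<in>I. h1 i x * G i j x) = c j x"
    by blast
  have "\<exists>h. (\<forall>i\<in>I. smooth_on (h i) S) \<and> (\<forall>x\<in>S. \<forall>j\<in>I. (\<Sum>i\<in>I. h i x * G i j x) = G b j x)"
    by (rule IH) (use insert.prems(1) in auto)
  then obtain k where k: "\<And>i. i \<in> I \<Longrightarrow> smooth_on (k i) S"
      "\<And>x j. x \<in> S \<Longrightarrow> j \<in> I \<Longrightarrow> (\<Sum>i\<in>I. k i x * G i j x) = G b j x"
    by blast
  \<comment> \<open>A Schur complement: the quadratic form at the vector with entry 1 at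
    \<open>b\<close> and \<open>- k i x\<close> at \<open>i\<close>, the one that is orthogonal to
    \<open>I\<close>. Hence it is positive and may be divided by.\<close>
  define d where "d x = G b b x - (\<Sum>i\<in>I. k i x * G i b x)" for x
  have d: "d x > 0" if x: "x \<in> S" for x
  proof -
    let ?h = "\<lambda>i. if i = b then 1 else - k i x"
    have I: "(\<Sum>i\<in>I. F i (?h i)) = (\<Sum>i\<in>I. F i (- k i x))" for F :: "'i \<Rightarrow> real \<Rightarrow> real"
      using insert.hyps by (intro sum.cong) auto
    have "0 < (\<Sum>i\<in>insert b I. \<Sum>j\<in>insert b I. ?h i * ?h j * G i j x)"
      using x by (intro insert.prems(2)) auto
    also have "\<dots> = G b b x + (\<Sum>j\<in>I. - k j x * G b j x)
        + (\<Sum>i\<in>I. - k i x * G i b x + (\<Sum>j\<in>I. k i x * k j x * G i j x))"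
      using insert.hyps I[of "\<lambda>j z. z * G b j x"]
        I[of "\<lambda>i y. y * G i b x + (\<Sum>j\<in>I. y * ?h j * G i j x)"]
        I[of "\<lambda>j z. - k i x * z * G i j x" for i]
      by simp
    also have "(\<Sum>i\<in>I. - k i x * G i b x + (\<Sum>j\<in>I. k i x * k j x * G i j x)) =
        (\<Sum>i\<in>I. - k i x * G i b x) + (\<Sum>j\<in>I. k j x * (\<Sum>i\<in>I. k i x * G i j x))"
      by (subst sum.distrib, subst sum.swap) (simp add: sum_distrib_left ac_simps)
    also have "(\<Sum>j\<in>I. k j x * (\<Sum>i\<in>I. k i x * G i j x)) = (\<Sum>j\<in>I. k j x * G b j x)"
      using k(2)[OF x] by simp
    finally show ?thesis by (simp add: d_def sum_negf)
  qed
  \<comment> \<open>The multiple that makes the equation for \<open>j = b\<close> hold; adding a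
    vector orthogonal to \<open>I\<close> leaves the other equations intact.\<close>
  define t where "t x = (c b x - (\<Sum>i\<in>I. h1 i x * G i b x)) / d x" for x
  have "smooth_on d S"
    unfolding d_def using insert.prems(1) k
    by (intro smooth_on_diff smooth_on_sum smooth_on_mult assms(2)) auto
  then have t: "smooth_on t S"
    unfolding t_def using insert.prems(1,3) h1 d
    by (intro smooth_on_divide smooth_on_diff smooth_on_sum smooth_on_mult assms(2)) (auto simp: less_imp_neq[symmetric] dest: d)
  let ?h = "\<lambda>i x. if i = b then t x else h1 i x - t x * k i x"
  have sm: "smooth_on (?h i) S" if "i \<in> insert b I" for i
    using that insert.hyps t h1(1) k(1)
    by (cases "i = b") (auto intro!: smooth_on_diff smooth_on_mult assms(2))
  have "(\<Sum>i\<in>insert b I. ?h i x * G i j x) = c j x" if x: "x \<in> S" and j: "j \<in> insert b I" for x j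
  proof -
    have "(\<Sum>i\<in>insert b I. ?h i x * G i j x) = t x * G b j x + (\<Sum>i\<in>I. ?h i x * G i j x)"
      using insert.hyps by simp
    also have "(\<Sum>i\<in>I. ?h i x * G i j x) = (\<Sum>i\<in>I. h1 i x * G i j x - t x * (k i x * G i j x))"
      using insert.hyps by (intro sum.cong) (auto simp: algebra_simps)
    also have "t x * G b j x + \<dots> = (\<Sum>i\<in>I. h1 i x * G i j x) + t x * (G b j x - (\<Sum>i\<in>I. k i x * G i j x))"
      by (simp add: sum_subtractf sum_distrib_left algebra_simps)
    also have "\<dots> = c j x"
    proof (cases "j \<in> I")
      case True
      then show ?thesis using h1(2) k(2) x by simp
    next
      case False
      with j have "j = b" by simp
      then show ?thesis using d[OF x] by (simp add: t_def flip: d_def)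
    qed
    finally show ?thesis .
  qed
  with sm show ?case by (intro exI[of _ ?h] conjI ballI)
qed

section \<open>Tangent vectors and bump functions on manifolds\<close>

lemma chart_open: "smooth_atlas A \<Longrightarrow> (V, \<psi>) \<in> A \<Longrightarrow> open V"
  and chart_inj: "smooth_atlas A \<Longrightarrow> (V, \<psi>) \<in> A \<Longrightarrow> inj_on \<psi> V"
  unfolding smooth_atlas_def by auto

lemma transition:
  assumes "smooth_atlas A" "(V, \<psi>) \<in> A" "(W, \<phi>) \<in> A"
  shows transition_open: "open {x\<in>V. \<psi> x \<in> \<phi> ` W}"
    and transition_smooth: "smooth_on (inv_into W \<phi> \<circ> \<psi>) {x\<in>V. \<psi> x \<in> \<phi> ` W}"
  using assms unfolding smooth_atlas_def by blast+

lemma carrierI: "(V, \<psi>) \<in> A \<Longrightarrow> x \<in> V \<Longrightarrow> \<psi> x \<in> atlas_carrier A"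
  unfolding atlas_carrier_def by auto

lemma carrierE:
  assumes "p \<in> atlas_carrier A"
  obtains V \<psi> x where "(V, \<psi>) \<in> A" "x \<in> V" "p = \<psi> x"
  using assms unfolding atlas_carrier_def by auto

text \<open>The axioms of \<open>istopology\<close> must be verified before \<open>topology\<close>
  can be evaluated; they hold because preimages under each chart commute with intersections and
  unions.\<close>

lemma openin_atlas_topology:
  fixes A :: "('e::euclidean_space, 'a) atlas"
  shows "openin (atlas_topology A) U \<longleftrightarrow>
     U \<subseteq> atlas_carrier A \<and> (\<forall>(V, \<psi>)\<in>A. open {x\<in>V. \<psi> x \<in> U})"
proof -
  let ?P = "\<lambda>U. U \<subseteq> atlas_carrier A \<and> (\<forall>(V, \<psi>)\<in>A. open {x\<in>V. \<psi> x \<in> U})"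
  have "istopology ?P"
    unfolding istopology_def
  proof (intro conjI allI impI)
    fix S T assume "?P S" "?P T"
    moreover have "{x\<in>V. \<psi> x \<in> S \<inter> T} = {x\<in>V. \<psi> x \<in> S} \<inter> {x\<in>V. \<psi> x \<in> T}"
      for V and \<psi> :: "'e \<Rightarrow> 'a" by auto
    ultimately show "S \<inter> T \<subseteq> atlas_carrier A" "\<forall>(V, \<psi>)\<in>A. open {x\<in>V. \<psi> x \<in> S \<inter> T}"
      by auto
  next
    fix K assume K: "\<forall>S\<in>K. ?P S"
    have "{x\<in>V. \<psi> x \<in> \<Union>K} = (\<Union>S\<in>K. {x\<in>V. \<psi> x \<in> S})" for V and \<psi> :: "'e \<Rightarrow> 'a" by auto
    with K show "\<Union>K \<subseteq> atlas_carrier A" "\<forall>(V, \<psi>)\<in>A. open {x\<in>V. \<psi> x \<in> \<Union>K}"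
      by (auto intro!: open_UN)
  qed
  then show ?thesis by (simp add: atlas_topology_def)
qed

lemma openin_carrier: "smooth_atlas A \<Longrightarrow> openin (atlas_topology A) (atlas_carrier A)"
  by (auto simp: openin_atlas_topology chart_open carrierI cong: conj_cong)

lemma topspace_atlas_topology:
  assumes "smooth_atlas A"
  shows "topspace (atlas_topology A) = atlas_carrier A"
proof
  show "topspace (atlas_topology A) \<subseteq> atlas_carrier A"
    using openin_topspace[of "atlas_topology A"] unfolding openin_atlas_topology by blast
  show "atlas_carrier A \<subseteq> topspace (atlas_topology A)"
    by (rule openin_subset[OF openin_carrier[OF assms]])
qed

lemma open_chart_preimage:
  "openin (atlas_topology A) U \<Longrightarrow> (V, \<psi>) \<in> A \<Longrightarrow> open {x\<in>V. \<psi> x \<in> U}"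
  unfolding openin_atlas_topology by auto

lemma open_transition_preimage:
  assumes "smooth_atlas A" "(V, \<psi>) \<in> A" "(W, \<phi>) \<in> A" "open S" "S \<subseteq> V"
  shows "open {y\<in>W. \<phi> y \<in> \<psi> ` S}"
proof -
  let ?D = "{y\<in>W. \<phi> y \<in> \<psi> ` V}"
  have "{y\<in>W. \<phi> y \<in> \<psi> ` S} = ?D \<inter> (inv_into V \<psi> \<circ> \<phi>) -` S"
    using assms(5) by (auto simp: inv_into_f_f[OF chart_inj[OF assms(1,2)]] subset_iff)
  moreover have "continuous_on ?D (inv_into V \<psi> \<circ> \<phi>)"
    by (rule smooth_on_continuous_on[OF transition_smooth[OF assms(1,3,2)]])
  ultimately show ?thesis
    using continuous_open_preimage[OF _ transition_open[OF assms(1,3,2)] assms(4)] by metis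
qed

text \<open>Openness in the atlas topology refers to all charts at once; continuity of the
  transition maps carries it from one chart to the others.\<close>

lemma openin_chart_image:
  assumes "smooth_atlas A" "(V, \<psi>) \<in> A" "open S" "S \<subseteq> V"
  shows "openin (atlas_topology A) (\<psi> ` S)"
  using assms open_transition_preimage[OF assms(1,2) _ assms(3,4)]
  unfolding openin_atlas_topology by (auto intro: carrierI)

text \<open>In any other chart the function is its local expression composed with a smooth
  transition map, so one chart decides. Most smoothness proofs below pass through this
  equivalence.\<close>

lemma smooth_near_chart:
  assumes "smooth_atlas A" "(V, \<psi>) \<in> A" "x \<in> V"
  shows "smooth_near A (\<psi> x) f \<longleftrightarrow> (\<exists>W. open W \<and> x \<in> W \<and> W \<subseteq> V \<and> smooth_on (\<lambda>z. f (\<psi> z)) W)"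
proof
  assume "smooth_near A (\<psi> x) f"
  then obtain U where U: "\<psi> x \<in> U" "openin (atlas_topology A) U"
      "\<forall>(V, \<psi>)\<in>A. smooth_on (f \<circ> \<psi>) {x\<in>V. \<psi> x \<in> U}"
    unfolding smooth_near_def smooth_fun_on_def by blast
  then show "\<exists>W. open W \<and> x \<in> W \<and> W \<subseteq> V \<and> smooth_on (\<lambda>z. f (\<psi> z)) W"
    using assms open_chart_preimage[OF U(2) assms(2)]
    by (intro exI[of _ "{x\<in>V. \<psi> x \<in> U}"]) (auto simp: o_def)
next
  assume "\<exists>W. open W \<and> x \<in> W \<and> W \<subseteq> V \<and> smooth_on (\<lambda>z. f (\<psi> z)) W"
  then obtain W where W: "open W" "x \<in> W" "W \<subseteq> V" "smooth_on (\<lambda>z. f (\<psi> z)) W" by blast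
  have "smooth_on (f \<circ> \<phi>) {y\<in>Y. \<phi> y \<in> \<psi> ` W}" (is "smooth_on _ ?E") if Y: "(Y, \<phi>) \<in> A" for Y \<phi>
  proof -
    have E: "open ?E" by (rule open_transition_preimage[OF assms(1,2) Y W(1,3)])
    have \<tau>: "smooth_on (inv_into V \<psi> \<circ> \<phi>) ?E"
      by (rule smooth_on_subset[OF transition_smooth[OF assms(1) Y assms(2)]]) (use W(3) in auto)
    have inv: "inv_into V \<psi> (\<phi> y) \<in> W" "\<psi> (inv_into V \<psi> (\<phi> y)) = \<phi> y" if "y \<in> ?E" for y
      using that W(3) inv_into_f_f[OF chart_inj[OF assms(1,2)]] by auto
    have "smooth_on (\<lambda>y. f (\<psi> ((inv_into V \<psi> \<circ> \<phi>) y))) ?E"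
      by (rule smooth_on_compose[OF E W(1) _ W(4) \<tau>]) (use inv in auto)
    then show ?thesis
      by (rule smooth_on_cong[OF E, rotated]) (simp add: inv)
  qed
  then have "smooth_fun_on A (\<psi> ` W) f"
    using openin_chart_image[OF assms(1,2) W(1,3)] by (auto simp: smooth_fun_on_def)
  with W(2) show "smooth_near A (\<psi> x) f" unfolding smooth_near_def by blast
qed

lemma smooth_near_chartD:
  assumes "smooth_atlas A" "(V, \<psi>) \<in> A" "x \<in> V" "smooth_near A (\<psi> x) f"
  shows "((\<lambda>z. f (\<psi> z)) has_derivative frechet_derivative (f \<circ> \<psi>) (at x)) (at x)"
  using assms smooth_near_chart[OF assms(1-3), of f] by (auto simp: o_def intro: smooth_on_has_derivative)

lemma smooth_fun_on_iff:
  assumes "smooth_atlas A"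
  shows "smooth_fun_on A U f \<longleftrightarrow> openin (atlas_topology A) U \<and> (\<forall>p\<in>U. smooth_near A p f)"
proof
  assume "openin (atlas_topology A) U \<and> (\<forall>p\<in>U. smooth_near A p f)"
  then have U: "openin (atlas_topology A) U" "\<And>p. p \<in> U \<Longrightarrow> smooth_near A p f" by auto
  have "smooth_on (f \<circ> \<psi>) {x\<in>V. \<psi> x \<in> U}" if V: "(V, \<psi>) \<in> A" for V \<psi>
  proof (rule smooth_on_local)
    fix x assume "x \<in> {x\<in>V. \<psi> x \<in> U}"
    then show "\<exists>W. open W \<and> x \<in> W \<and> smooth_on (f \<circ> \<psi>) W"
      using smooth_near_chart[OF assms V, of x f] U(2) by (auto simp: o_def)
  qed
  with U(1) show "smooth_fun_on A U f" unfolding smooth_fun_on_def by blast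
next
  assume "smooth_fun_on A U f"
  then show "openin (atlas_topology A) U \<and> (\<forall>p\<in>U. smooth_near A p f)"
    unfolding smooth_near_def using smooth_fun_on_def by blast
qed

lemma smooth_near_carrier:
  assumes "smooth_near A p f"
  shows "p \<in> atlas_carrier A"
  using assms unfolding smooth_near_def smooth_fun_on_def openin_atlas_topology by blast

lemma smooth_near_cong:
  assumes "smooth_atlas A" "openin (atlas_topology A) U" "p \<in> U"
    and "\<And>q. q \<in> U \<Longrightarrow> f q = h q" "smooth_near A p f"
  shows "smooth_near A p h"
proof -
  obtain V \<psi> x where V: "(V, \<psi>) \<in> A" "x \<in> V" "p = \<psi> x"
    using carrierE[OF smooth_near_carrier[OF assms(5)]] .
  obtain W where W: "open W" "x \<in> W" "W \<subseteq> V" "smooth_on (\<lambda>z. f (\<psi> z)) W"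
    using assms(5) V smooth_near_chart[OF assms(1) V(1,2)] by auto
  let ?W = "W \<inter> {x\<in>V. \<psi> x \<in> U}"
  have o: "open ?W" using W(1) open_chart_preimage[OF assms(2) V(1)] by auto
  have "smooth_on (\<lambda>z. h (\<psi> z)) ?W"
    by (rule smooth_on_cong[OF o _ smooth_on_subset[OF W(4)]]) (use assms(4) in auto)
  with o W V assms(3) show ?thesis
    using smooth_near_chart[OF assms(1) V(1,2)] by (metis (no_types, lifting) Int_iff inf.coboundedI1 mem_Collect_eq)
qed

text \<open>Smoothness of \<open>G\<close> is expressed as a closure property of
  \<open>smooth_on\<close>, so that unary operations, which ignore one argument, and binary ones
  share one proof.\<close>

lemma smooth_near_lift:
  assumes "smooth_atlas A" "smooth_near A p f" "smooth_near A p h"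
    and "\<And>(S :: 'e::euclidean_space set) F H. open S \<Longrightarrow> smooth_on F S \<Longrightarrow> smooth_on H S \<Longrightarrow>
      smooth_on (\<lambda>x. G (F x) (H x)) S"
  shows "smooth_near (A :: ('e, 'a) atlas) p (\<lambda>q. G (f q) (h q))"
proof -
  obtain V \<psi> x where V: "(V, \<psi>) \<in> A" "x \<in> V" "p = \<psi> x"
    using carrierE[OF smooth_near_carrier[OF assms(2)]] .
  obtain W1 where W1: "open W1" "x \<in> W1" "W1 \<subseteq> V" "smooth_on (\<lambda>z. f (\<psi> z)) W1"
    using assms(2) V smooth_near_chart[OF assms(1) V(1,2)] by auto
  obtain W2 where W2: "open W2" "x \<in> W2" "W2 \<subseteq> V" "smooth_on (\<lambda>z. h (\<psi> z)) W2"
    using assms(3) V smooth_near_chart[OF assms(1) V(1,2)] by auto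
  have "smooth_on (\<lambda>z. G (f (\<psi> z)) (h (\<psi> z))) (W1 \<inter> W2)"
    using W1 W2 by (intro assms(4)) (auto intro: smooth_on_subset)
  moreover have "open (W1 \<inter> W2)" "x \<in> W1 \<inter> W2" "W1 \<inter> W2 \<subseteq> V" using W1 W2 by auto
  ultimately show ?thesis using V smooth_near_chart[OF assms(1) V(1,2)] by blast
qed

lemma smooth_near_const:
  assumes "smooth_atlas A" "p \<in> atlas_carrier A"
  shows "smooth_near A p (\<lambda>q. c)"
proof -
  obtain V \<psi> x where V: "(V, \<psi>) \<in> A" "x \<in> V" "p = \<psi> x" using carrierE[OF assms(2)] .
  show ?thesis
    unfolding V(3) smooth_near_chart[OF assms(1) V(1,2)]
    by (intro exI[of _ V]) (auto simp: V chart_open[OF assms(1) V(1)] smooth_on_const)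
qed

lemma smooth_near_mult:
  "smooth_atlas A \<Longrightarrow> smooth_near A p f \<Longrightarrow> smooth_near A p h \<Longrightarrow> smooth_near A p (\<lambda>q. f q * h q)"
  by (rule smooth_near_lift) (auto intro: smooth_on_mult)

lemma smooth_near_cmult:
  "smooth_atlas A \<Longrightarrow> smooth_near A p f \<Longrightarrow> smooth_near A p (\<lambda>q. c * f q)"
  by (intro smooth_near_mult smooth_near_const smooth_near_carrier)

lemma smooth_near_exp:
  "smooth_atlas A \<Longrightarrow> smooth_near A p f \<Longrightarrow> smooth_near A p (\<lambda>q. exp (f q))"
  by (rule smooth_near_lift[where h = f and G = "\<lambda>x y. exp x"])
    (auto intro!: smooth_on_compose[OF _ _ _ smooth_on_exp])

section \<open>Tangent vectors in charts and as derivations\<close>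

lemma dir_deriv_change:
  assumes "smooth_atlas A" "(V, \<psi>) \<in> A" "x \<in> V" "(W, \<phi>) \<in> A" "x' \<in> W" "\<psi> x = \<phi> x'"
  shows "dir_deriv A \<phi> x' y = dir_deriv A \<psi> x (frechet_derivative (inv_into V \<psi> \<circ> \<phi>) (at x') y)"
proof
  fix f
  let ?E = "{y\<in>W. \<phi> y \<in> \<psi> ` V}" and ?\<tau> = "inv_into V \<psi> \<circ> \<phi>"
  show "dir_deriv A \<phi> x' y f = dir_deriv A \<psi> x (frechet_derivative ?\<tau> (at x') y) f"
  proof (cases "smooth_near A (\<psi> x) f")
    case True
    have x': "x' \<in> ?E" "?\<tau> x' = x"
      using assms inv_into_f_f[OF chart_inj[OF assms(1,2)] assms(3)] by (auto simp flip: assms(6))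
    have "(?\<tau> has_derivative frechet_derivative ?\<tau> (at x')) (at x')"
      by (rule smooth_on_has_derivative[OF transition_smooth[OF assms(1,4,2)] x'(1)])
    from diff_chain_at[OF this, of "\<lambda>z. f (\<psi> z)" "frechet_derivative (f \<circ> \<psi>) (at x)"]
    have "((\<lambda>z. f (\<psi> (?\<tau> z))) has_derivative
        (\<lambda>y. frechet_derivative (f \<circ> \<psi>) (at x) (frechet_derivative ?\<tau> (at x') y))) (at x')"
      using smooth_near_chartD[OF assms(1-3) True] x'(2) by (simp add: o_def)
    then have "((f \<circ> \<phi>) has_derivative
        (\<lambda>y. frechet_derivative (f \<circ> \<psi>) (at x) (frechet_derivative ?\<tau> (at x') y))) (at x')"
      by (rule has_derivative_transform_within_open[OF _ transition_open[OF assms(1,4,2)] x'(1)])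
        (auto simp: f_inv_into_f)
    with True show ?thesis
      by (simp add: dir_deriv_def flip: assms(6) frechet_derivative_at)
  next
    case False
    then show ?thesis by (simp add: dir_deriv_def flip: assms(6))
  qed
qed

text \<open>By \<open>dir_deriv_change\<close> the chart that occurs in the definition is
  immaterial, so all vectors at a point can be written with one fixed parametrization.\<close>

lemma tangent_space_chart:
  assumes "smooth_atlas A" "(V, \<psi>) \<in> A" "x \<in> V"
  shows "tangent_space A (\<psi> x) = range (dir_deriv A \<psi> x)"
proof
  show "tangent_space A (\<psi> x) \<subseteq> range (dir_deriv A \<psi> x)"
    unfolding tangent_space_def using dir_deriv_change[OF assms] by fastforce
  show "range (dir_deriv A \<psi> x) \<subseteq> tangent_space A (\<psi> x)"
    unfolding tangent_space_def using assms by blast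
qed

lemma dir_deriv_linear:
  assumes "smooth_atlas A" "(V, \<psi>) \<in> A" "x \<in> V"
  shows dir_deriv_add: "dir_deriv A \<psi> x (a + b) = tv_add (dir_deriv A \<psi> x a) (dir_deriv A \<psi> x b)"
    and dir_deriv_scale: "dir_deriv A \<psi> x (c *\<^sub>R a) = tv_scale c (dir_deriv A \<psi> x a)"
    and dir_deriv_zero: "dir_deriv A \<psi> x 0 = tv_zero"
proof -
  note l = has_derivative_linear[OF smooth_near_chartD[OF assms]]
  show "dir_deriv A \<psi> x (a + b) = tv_add (dir_deriv A \<psi> x a) (dir_deriv A \<psi> x b)"
    "dir_deriv A \<psi> x (c *\<^sub>R a) = tv_scale c (dir_deriv A \<psi> x a)"
    "dir_deriv A \<psi> x 0 = tv_zero"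
    by (auto simp: dir_deriv_def tv_add_def tv_scale_def tv_zero_def fun_eq_iff
        linear_add[OF l] linear_scale[OF l] linear_0[OF l])
qed

lemma coordinate_smooth:
  assumes "smooth_atlas A" "(V, \<psi>) \<in> A"
  shows "smooth_fun_on A (\<psi> ` V) (\<lambda>p. inv_into V \<psi> p \<bullet> b)"
  unfolding smooth_fun_on_iff[OF assms(1)]
proof (intro conjI ballI)
  show "openin (atlas_topology A) (\<psi> ` V)"
    using openin_chart_image[OF assms] chart_open[OF assms] by auto
  fix p assume "p \<in> \<psi> ` V"
  then obtain x where x: "x \<in> V" "p = \<psi> x" by auto
  have "smooth_on (\<lambda>z. inv_into V \<psi> (\<psi> z) \<bullet> b) V"
    by (rule smooth_on_cong[of V "\<lambda>z. z \<bullet> b"])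
      (use assms in \<open>auto simp: inv_into_f_f[OF chart_inj] chart_open intro!: smooth_on_linear bounded_linear_inner_left\<close>)
  then show "smooth_near A p (\<lambda>p. inv_into V \<psi> p \<bullet> b)"
    unfolding x(2) smooth_near_chart[OF assms x(1)] using x assms chart_open by blast
qed

text \<open>Coordinate functions recover the components of a vector. This gives injectivity of
  \<open>dir_deriv\<close> and, later, smooth components of pi-vector fields. They are smooth only
  on the chart image, which suffices because vectors are local.\<close>

lemma dir_deriv_coordinate:
  assumes "smooth_atlas A" "(V, \<psi>) \<in> A" "x \<in> V"
  shows "dir_deriv A \<psi> x y (\<lambda>p. inv_into V \<psi> p \<bullet> b) = y \<bullet> b"
proof -
  have "smooth_near A (\<psi> x) (\<lambda>p. inv_into V \<psi> p \<bullet> b)"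
    using coordinate_smooth[OF assms(1,2)] assms(3) smooth_fun_on_iff[OF assms(1)] by blast
  moreover have "((\<lambda>z. inv_into V \<psi> (\<psi> z) \<bullet> b) has_derivative (\<lambda>y. y \<bullet> b)) (at x)"
    by (rule has_derivative_transform_within_open[of "\<lambda>z. z \<bullet> b" _ _ _ V])
      (use assms in \<open>auto simp: inv_into_f_f[OF chart_inj] chart_open intro!: derivative_eq_intros\<close>)
  ultimately show ?thesis
    by (simp add: dir_deriv_def o_def flip: frechet_derivative_at)
qed

lemma dir_deriv_inj:
  assumes "smooth_atlas A" "(V, \<psi>) \<in> A" "x \<in> V" "dir_deriv A \<psi> x a = dir_deriv A \<psi> x b"
  shows "a = b"
  using dir_deriv_coordinate[OF assms(1-3)] assms(4) euclidean_eq_iff by metis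

lemma dir_deriv_eq_zero_iff:
  assumes "smooth_atlas A" "(V, \<psi>) \<in> A" "x \<in> V"
  shows "dir_deriv A \<psi> x a = tv_zero \<longleftrightarrow> a = 0"
  using dir_deriv_inj[OF assms, of a 0] dir_deriv_zero[OF assms] by auto

lemma tangent_spaceE:
  assumes "smooth_atlas A" "(V, \<psi>) \<in> A" "x \<in> V" "\<xi> \<in> tangent_space A (\<psi> x)"
  obtains a where "\<xi> = dir_deriv A \<psi> x a"
  using assms tangent_space_chart by blast

lemma tangent_space_carrier: "\<xi> \<in> tangent_space A p \<Longrightarrow> p \<in> atlas_carrier A"
  unfolding tangent_space_def by (auto intro: carrierI)

lemma tangent_space_add:
  assumes "smooth_atlas A" "\<xi> \<in> tangent_space A p" "\<zeta> \<in> tangent_space A p"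
  shows "tv_add \<xi> \<zeta> \<in> tangent_space A p"
proof -
  obtain V \<psi> x where V: "(V, \<psi>) \<in> A" "x \<in> V" "p = \<psi> x"
    using carrierE[OF tangent_space_carrier[OF assms(2)]] .
  show ?thesis using assms(2,3)
    unfolding V(3) tangent_space_chart[OF assms(1) V(1,2)]
    by (auto simp flip: dir_deriv_add[OF assms(1) V(1,2)])
qed

lemma tangent_space_scale:
  assumes "smooth_atlas A" "\<xi> \<in> tangent_space A p"
  shows "tv_scale c \<xi> \<in> tangent_space A p"
proof -
  obtain V \<psi> x where V: "(V, \<psi>) \<in> A" "x \<in> V" "p = \<psi> x"
    using carrierE[OF tangent_space_carrier[OF assms(2)]] .
  show ?thesis using assms(2)
    unfolding V(3) tangent_space_chart[OF assms(1) V(1,2)]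
    by (auto simp flip: dir_deriv_scale[OF assms(1) V(1,2)])
qed

lemma tangent_space_zero:
  assumes "smooth_atlas A" "p \<in> atlas_carrier A"
  shows "tv_zero \<in> tangent_space A p"
  using assms(2) by (rule carrierE)
    (metis assms(1) dir_deriv_zero rangeI tangent_space_chart)

lemma tangent_not_smooth:
  assumes "\<xi> \<in> tangent_space A p" "\<not> smooth_near A p f"
  shows "\<xi> f = 0"
  using assms unfolding tangent_space_def dir_deriv_def by auto

text \<open>Functions that agree near \<open>p\<close> are both smooth near \<open>p\<close> or both
  not, so the default value 0 does not break locality.\<close>

lemma tangent_cong:
  assumes "smooth_atlas A" "\<xi> \<in> tangent_space A p" "openin (atlas_topology A) U" "p \<in> U"
    and "\<And>q. q \<in> U \<Longrightarrow> f q = h q"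
  shows "\<xi> f = \<xi> h"
proof (cases "smooth_near A p f")
  case True
  then have h: "smooth_near A p h" using assms(3-5) by (intro smooth_near_cong[OF assms(1), of U p f h]) auto
  obtain V \<psi> x where V: "(V, \<psi>) \<in> A" "x \<in> V" "p = \<psi> x"
    using carrierE[OF smooth_near_carrier[OF h]] .
  obtain a where a: "\<xi> = dir_deriv A \<psi> x a"
    using tangent_spaceE[OF assms(1) V(1,2)] assms(2) V(3) by metis
  have "((\<lambda>z. h (\<psi> z)) has_derivative frechet_derivative (f \<circ> \<psi>) (at x)) (at x)"
    by (rule has_derivative_transform_within_open[of "\<lambda>z. f (\<psi> z)", OF _ open_chart_preimage[OF assms(3) V(1)]])
      (use smooth_near_chartD[OF assms(1) V(1,2)] True V assms(4,5) in auto)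
  with True h show ?thesis
    by (simp add: a dir_deriv_def o_def V(3) flip: frechet_derivative_at)
next
  case False
  then have "\<not> smooth_near A p h" using smooth_near_cong[OF assms(1,3,4), of h f] assms(5) by metis
  with False show ?thesis using tangent_not_smooth[OF assms(2)] by simp
qed

lemma tangent_cong_carrier:
  assumes "smooth_atlas A" "\<xi> \<in> tangent_space A p"
    and "\<And>q. q \<in> atlas_carrier A \<Longrightarrow> f q = h q"
  shows "\<xi> f = \<xi> h"
  by (rule tangent_cong[OF assms(1,2) openin_carrier[OF assms(1)] tangent_space_carrier[OF assms(2)] assms(3)])

text \<open>With a pair as the argument of \<open>G\<close>, the rules for products, scalar
  multiples and exponentials are instances of one chain rule; the unary ones take
  \<open>h = f\<close>.\<close>

lemma tangent_chain:
  fixes \<xi> :: "'a tvec"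
  assumes "smooth_atlas A" "\<xi> \<in> tangent_space A p" "smooth_near A p f" "smooth_near A p h"
    and "smooth_near A p (\<lambda>q. G (f q, h q))" "(G has_derivative G') (at (f p, h p))"
  shows "\<xi> (\<lambda>q. G (f q, h q)) = G' (\<xi> f, \<xi> h)"
proof -
  obtain V \<psi> x where V: "(V, \<psi>) \<in> A" "x \<in> V" "p = \<psi> x"
    using carrierE[OF smooth_near_carrier[OF assms(3)]] .
  obtain a where a: "\<xi> = dir_deriv A \<psi> x a"
    using tangent_spaceE[OF assms(1) V(1,2)] assms(2) V(3) by metis
  have f: "((\<lambda>z. f (\<psi> z)) has_derivative frechet_derivative (f \<circ> \<psi>) (at x)) (at x)"
    and h: "((\<lambda>z. h (\<psi> z)) has_derivative frechet_derivative (h \<circ> \<psi>) (at x)) (at x)"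
    using smooth_near_chartD[OF assms(1) V(1,2)] assms(3,4) V(3) by auto
  have "((\<lambda>z. G (f (\<psi> z), h (\<psi> z))) has_derivative
      (\<lambda>y. G' (frechet_derivative (f \<circ> \<psi>) (at x) y, frechet_derivative (h \<circ> \<psi>) (at x) y))) (at x)"
    using diff_chain_at[OF has_derivative_Pair[OF f h], of G G'] assms(6) V(3) by (simp add: o_def)
  with assms(3,4,5) show ?thesis
    by (simp add: a dir_deriv_def o_def V(3) flip: frechet_derivative_at)
qed

lemma tangent_mult:
  assumes "smooth_atlas A" "\<xi> \<in> tangent_space A p" "smooth_near A p f" "smooth_near A p h"
  shows "\<xi> (\<lambda>q. f q * h q) = \<xi> f * h p + f p * \<xi> h"
proof -
  have "((\<lambda>z :: real \<times> real. fst z * snd z) has_derivative (\<lambda>z. fst z * h p + f p * snd z)) (at (f p, h p))"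
    by (auto intro!: derivative_eq_intros)
  from tangent_chain[OF assms _ this] show ?thesis
    using smooth_near_mult[OF assms(1,3,4)] by simp
qed

lemma tangent_cmult:
  assumes "smooth_atlas A" "\<xi> \<in> tangent_space A p" "smooth_near A p f"
  shows "\<xi> (\<lambda>q. c * f q) = c * \<xi> f"
proof -
  have "((\<lambda>z :: real \<times> real. c * fst z) has_derivative (\<lambda>z. c * fst z)) (at (f p, f p))"
    by (auto intro!: derivative_eq_intros)
  from tangent_chain[OF assms assms(3) _ this] show ?thesis
    using smooth_near_cmult[OF assms(1,3)] by simp
qed

lemma tangent_exp:
  assumes "smooth_atlas A" "\<xi> \<in> tangent_space A p" "smooth_near A p f"
  shows "\<xi> (\<lambda>q. exp (f q)) = exp (f p) * \<xi> f"
proof -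
  have "((\<lambda>z :: real \<times> real. exp (fst z)) has_derivative (\<lambda>z. exp (f p) * fst z)) (at (f p, f p))"
    by (auto intro!: derivative_eq_intros)
  from tangent_chain[OF assms assms(3) _ this] show ?thesis
    using smooth_near_exp[OF assms(1,3)] by simp
qed

lemma tangent_const:
  assumes "smooth_atlas A" "\<xi> \<in> tangent_space A p"
  shows "\<xi> (\<lambda>q. c) = 0"
  using tangent_cmult[OF assms, of "\<lambda>q. c" 0] tangent_cmult[OF assms, of "\<lambda>q. 1" c]
    smooth_near_const[OF assms(1) tangent_space_carrier[OF assms(2)]]
    tangent_mult[OF assms, of "\<lambda>q. 1" "\<lambda>q. 1"] by simp

section \<open>Bump functions and extension of tangent vectors to fields\<close>

lemma bump_function:
  assumes "smooth_atlas A" "Hausdorff_space (atlas_topology A)" "(V, \<psi>) \<in> A" "x \<in> V"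
  obtains \<theta> N where "smooth_fun_on A (atlas_carrier A) \<theta>" "\<theta> (\<psi> x) = 1"
    "openin (atlas_topology A) N" "atlas_carrier A \<subseteq> N \<union> \<psi> ` V" "\<And>q. q \<in> N \<Longrightarrow> \<theta> q = 0"
proof -
  note inv = inv_into_f_f[OF chart_inj[OF assms(1,3)]]
  obtain r where r: "r > 0" "cball x r \<subseteq> V"
    using chart_open[OF assms(1,3)] assms(4) open_contains_cball by blast
  obtain \<beta> :: "_ \<Rightarrow> real" where \<beta>: "smooth_on \<beta> UNIV" "\<beta> x = 1" "\<And>z. z \<notin> cball x r \<Longrightarrow> \<beta> z = 0"
    using bump_function_ball[OF r(1), of x] by metis
  define \<theta> where "\<theta> q = (if q \<in> \<psi> ` V then \<beta> (inv_into V \<psi> q) else 0)" for q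
  \<comment> \<open>Extension by zero is smooth if the vanishing holds on an open set that covers
    the manifold together with the chart image; \<open>N\<close> is that set.\<close>
  define N where "N = atlas_carrier A - \<psi> ` cball x r"
  have "continuous_map (top_of_set V) (atlas_topology A) \<psi>"
    unfolding continuous_map_def
  proof (intro conjI allI impI)
    show "\<psi> \<in> topspace (top_of_set V) \<rightarrow> topspace (atlas_topology A)"
      using assms by (auto simp: topspace_atlas_topology intro: carrierI)
    fix U assume "openin (atlas_topology A) U"
    from open_chart_preimage[OF this assms(3)]
    show "openin (top_of_set V) {x \<in> topspace (top_of_set V). \<psi> x \<in> U}"
      by (simp add: open_subset)
  qed
  then have "compactin (atlas_topology A) (\<psi> ` cball x r)"
    by (rule image_compactin[rotated]) (use r(2) in \<open>simp add: compactin_subtopology\<close>)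
  \<comment> \<open>The Hausdorff property enters here: a compact set is closed, so \<open>N\<close>
    is open.\<close>
  then have "closedin (atlas_topology A) (\<psi> ` cball x r)"
    by (rule compactin_imp_closedin[OF assms(2)])
  then have N: "openin (atlas_topology A) N"
    unfolding N_def by (simp add: closedin_def topspace_atlas_topology[OF assms(1)])
  have \<theta>N: "\<theta> q = 0" if "q \<in> N" for q
  proof (cases "q \<in> \<psi> ` V")
    case True
    then obtain z where "z \<in> V" "q = \<psi> z" by auto
    moreover from this that have "z \<notin> cball x r" unfolding N_def by blast
    ultimately show ?thesis using \<beta>(3) by (auto simp: \<theta>_def inv)
  qed (simp add: \<theta>_def)
  have "smooth_near A q \<theta>" if "q \<in> atlas_carrier A" for q
  proof (cases "q \<in> \<psi> ` V")
    case True
    then obtain z where z: "z \<in> V" "q = \<psi> z" by auto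
    have "smooth_on (\<lambda>z. \<theta> (\<psi> z)) V"
      by (rule smooth_on_cong[OF chart_open[OF assms(1,3)] _ smooth_on_subset[OF \<beta>(1)]])
        (auto simp: \<theta>_def inv)
    then show ?thesis
      unfolding z(2) smooth_near_chart[OF assms(1,3) z(1)] using z(1) chart_open[OF assms(1,3)] by blast
  next
    case False
    then have "q \<in> N" using that r(2) by (auto simp: N_def)
    then show ?thesis
      by (rule smooth_near_cong[OF assms(1) N _ _ smooth_near_const[OF assms(1) that, of 0]])
        (simp add: \<theta>N)
  qed
  then have "smooth_fun_on A (atlas_carrier A) \<theta>"
    using smooth_fun_on_iff[OF assms(1)] openin_carrier[OF assms(1)] by blast
  moreover have "\<theta> (\<psi> x) = 1" using assms(4) by (simp add: \<theta>_def inv \<beta>(2))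
  moreover have "atlas_carrier A \<subseteq> N \<union> \<psi> ` V" using r(2) by (auto simp: N_def)
  ultimately show ?thesis using that N \<theta>N by blast
qed

text \<open>Stated for any function that vanishes on an open \<open>N\<close>, so that it also
  serves the slit bundle, where the bump function is pulled back from the base.\<close>

lemma bump_vector_field:
  assumes "smooth_atlas A" "(V, \<psi>) \<in> A" "smooth_fun_on A (atlas_carrier A) \<theta>"
    "openin (atlas_topology A) N" "atlas_carrier A \<subseteq> N \<union> \<psi> ` V" "\<And>q. q \<in> N \<Longrightarrow> \<theta> q = 0"
  shows "vector_field A (\<lambda>q. if q \<in> \<psi> ` V then tv_scale (\<theta> q) (dir_deriv A \<psi> (inv_into V \<psi> q) a)
    else tv_zero)" (is "vector_field A ?X")
  unfolding vector_field_def
proof (intro conjI ballI allI impI)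
  note inv = inv_into_f_f[OF chart_inj[OF assms(1,2)]]
  show "?X q \<in> tangent_space A q" if "q \<in> atlas_carrier A" for q
    using that tangent_space_chart[OF assms(1,2)]
    by (auto simp: inv intro!: tangent_space_zero tangent_space_scale assms(1))
  fix U f assume Uf: "smooth_fun_on A U f"
  then have U: "openin (atlas_topology A) U" "\<And>q. q \<in> U \<Longrightarrow> smooth_near A q f"
    using smooth_fun_on_iff[OF assms(1)] by auto
  have "smooth_near A q (\<lambda>q. ?X q f)" if q: "q \<in> U" for q
  proof (cases "q \<in> \<psi> ` V")
    case True
    then obtain z where z: "z \<in> V" "q = \<psi> z" by auto
    let ?W = "{x\<in>V. \<psi> x \<in> U}"
    have W: "open ?W" by (rule open_chart_preimage[OF U(1) assms(2)])
    have "smooth_on (\<lambda>x. f (\<psi> x)) ?W" "smooth_on (\<lambda>x. \<theta> (\<psi> x)) ?W"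
      using Uf assms(2,3) unfolding smooth_fun_on_def
      by (auto simp: o_def intro: smooth_on_subset carrierI)
    then have "smooth_on (\<lambda>x. \<theta> (\<psi> x) * frechet_derivative (\<lambda>x. f (\<psi> x)) (at x) a) ?W"
      by (intro smooth_on_mult W smooth_on_frechet_derivative)
    then have "smooth_on (\<lambda>x. ?X (\<psi> x) f) ?W"
      by (rule smooth_on_cong[OF W, rotated])
        (auto simp: inv tv_scale_def dir_deriv_def o_def U(2))
    then show ?thesis
      unfolding z(2) smooth_near_chart[OF assms(1,2) z(1)] using W q z by blast
  next
    case False
    have qc: "q \<in> atlas_carrier A" using U q unfolding openin_atlas_topology by blast
    with False have "q \<in> N" using assms(5) by auto
    then show ?thesis
      by (rule smooth_near_cong[OF assms(1,4) _ _ smooth_near_const[OF assms(1) qc, of 0]])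
        (simp add: assms(6) tv_scale_def tv_zero_def)
  qed
  with U(1) show "smooth_fun_on A U (\<lambda>q. ?X q f)"
    using smooth_fun_on_iff[OF assms(1)] by blast
qed

text \<open>The axioms of connections and the torsion conditions quantify over global fields;
  conclusions about a single vector need it to be the value of one.\<close>

lemma vector_field_extension:
  assumes "smooth_atlas A" "Hausdorff_space (atlas_topology A)" "v \<in> tangent_space A p"
  obtains X where "vector_field A X" "X p = v"
proof -
  obtain V \<psi> x where V: "(V, \<psi>) \<in> A" "x \<in> V" "p = \<psi> x"
    using carrierE[OF tangent_space_carrier[OF assms(3)]] .
  obtain a where a: "v = dir_deriv A \<psi> x a"
    using tangent_spaceE[OF assms(1) V(1,2)] assms(3) V(3) by metis
  obtain \<theta> N where \<theta>: "smooth_fun_on A (atlas_carrier A) \<theta>" "\<theta> (\<psi> x) = 1"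
    "openin (atlas_topology A) N" "atlas_carrier A \<subseteq> N \<union> \<psi> ` V" "\<And>q. q \<in> N \<Longrightarrow> \<theta> q = 0"
    using bump_function[OF assms(1,2) V(1,2)] by blast
  show ?thesis
    by (rule that[OF bump_vector_field[OF assms(1) V(1) \<theta>(1,3,4,5), of a]])
      (use V a \<theta>(2) in \<open>auto simp: inv_into_f_f[OF chart_inj[OF assms(1) V(1)]] tv_scale_def\<close>)
qed

section \<open>The slit tangent bundle\<close>

text \<open>A name for the parametrization that occurs anonymously in
  \<open>slit_atlas\<close>.\<close>

definition slit_chart :: "('e::euclidean_space, 'a) atlas \<Rightarrow> ('e \<Rightarrow> 'a) \<Rightarrow> 'e \<times> 'e \<Rightarrow> 'a \<times> 'a tvec" where
  "slit_chart A \<psi> = (\<lambda>(x, y). (\<psi> x, dir_deriv A \<psi> x y))"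

lemma open_slit: "open V \<Longrightarrow> open (V \<times> (- {0 :: 'b::real_normed_vector}))"
  by (rule open_Times) (simp_all add: open_Compl)

lemma slit_chart_apply: "slit_chart A \<psi> (x, y) = (\<psi> x, dir_deriv A \<psi> x y)"
  by (simp add: slit_chart_def)

lemma fst_slit_chart: "fst (slit_chart A \<psi> z) = \<psi> (fst z)"
  by (simp add: slit_chart_def split_beta)

lemma slit_atlas_chart: "(V, \<psi>) \<in> A \<Longrightarrow> (V \<times> (- {0}), slit_chart A \<psi>) \<in> slit_atlas A"
  unfolding slit_atlas_def slit_chart_def by force

lemma slit_atlasE:
  assumes "(V', \<Psi>) \<in> slit_atlas A"
  obtains V \<psi> where "(V, \<psi>) \<in> A" "V' = V \<times> (- {0})" "\<Psi> = slit_chart A \<psi>"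
  using assms unfolding slit_atlas_def slit_chart_def by auto

lemma slit_chart_inj:
  assumes "smooth_atlas A" "(V, \<psi>) \<in> A"
  shows "inj_on (slit_chart A \<psi>) (V \<times> (- {0}))"
  using chart_inj[OF assms] dir_deriv_inj[OF assms]
  by (auto simp: inj_on_def slit_chart_def)

text \<open>A transition of the slit bundle is the tangent map of a transition of the base. It
  avoids zero because a nonzero coordinate vector represents a nonzero tangent vector in every
  chart.\<close>

lemma slit_transition:
  assumes "smooth_atlas A" "(V, \<psi>) \<in> A" "(W, \<phi>) \<in> A" "x \<in> V" "\<psi> x \<in> \<phi> ` W" "y \<noteq> 0"
  defines "\<tau> \<equiv> inv_into W \<phi> \<circ> \<psi>"
  shows "slit_chart A \<psi> (x, y) = slit_chart A \<phi> (\<tau> x, frechet_derivative \<tau> (at x) y)"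
    and "\<tau> x \<in> W" "frechet_derivative \<tau> (at x) y \<noteq> 0"
proof -
  have \<tau>: "\<tau> x \<in> W" "\<phi> (\<tau> x) = \<psi> x"
    using assms(5) by (auto simp: \<tau>_def inv_into_into f_inv_into_f)
  have *: "dir_deriv A \<psi> x y = dir_deriv A \<phi> (\<tau> x) (frechet_derivative \<tau> (at x) y)"
    unfolding \<tau>_def using \<tau> by (intro dir_deriv_change[OF assms(1,3) _ assms(2,4)]) (auto simp: \<tau>_def)
  then show "slit_chart A \<psi> (x, y) = slit_chart A \<phi> (\<tau> x, frechet_derivative \<tau> (at x) y)"
    unfolding slit_chart_apply \<tau>(2) by simp
  show "\<tau> x \<in> W" by (rule \<tau>(1))
  show "frechet_derivative \<tau> (at x) y \<noteq> 0"
    using * assms(6) dir_deriv_eq_zero_iff[OF assms(1,2,4)] dir_deriv_zero[OF assms(1,3) \<tau>(1)] by metis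
qed

lemma smooth_on_fst: "open S \<Longrightarrow> smooth_on fst S" and smooth_on_snd: "open S \<Longrightarrow> smooth_on snd S"
  by (auto intro: smooth_on_linear bounded_linear_fst bounded_linear_snd)

lemma smooth_atlas_slit:
  fixes A :: "('e::euclidean_space, 'a) atlas"
  assumes "smooth_atlas A"
  shows "smooth_atlas (slit_atlas A)"
proof -
  have 1: "open V' \<and> inj_on \<Psi> V'" if "(V', \<Psi>) \<in> slit_atlas A" for V' \<Psi>
    using that
    by (rule slit_atlasE) (use slit_chart_inj[OF assms] open_slit[OF chart_open[OF assms]] in auto)
  have 2: "open {z\<in>V \<times> (- {0}). slit_chart A \<psi> z \<in> slit_chart A \<phi> ` (W \<times> (- {0}))} \<and>
      smooth_on (inv_into (W \<times> (- {0})) (slit_chart A \<phi>) \<circ> slit_chart A \<psi>)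
        {z\<in>V \<times> (- {0}). slit_chart A \<psi> z \<in> slit_chart A \<phi> ` (W \<times> (- {0}))}"
    if V: "(V, \<psi>) \<in> A" and W: "(W, \<phi>) \<in> A" for V \<psi> W \<phi>
  proof -
    let ?D = "{x\<in>V. \<psi> x \<in> \<phi> ` W}" and ?\<tau> = "inv_into W \<phi> \<circ> \<psi>"
    let ?E = "{z\<in>V \<times> (- {0}). slit_chart A \<psi> z \<in> slit_chart A \<phi> ` (W \<times> (- {0}))}"
    \<comment> \<open>Overlaps of slit charts contain whole punctured fibres, so their openness
      reduces to the base.\<close>
    have E: "?E = ?D \<times> (- {0})"
    proof
      show "?E \<subseteq> ?D \<times> (- {0})" by (auto simp: slit_chart_apply)
      show "?D \<times> (- {0}) \<subseteq> ?E"
      proof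
        fix z assume z: "z \<in> ?D \<times> (- {0 :: 'e})"
        then have "slit_chart A \<psi> z \<in> slit_chart A \<phi> ` (W \<times> (- {0}))"
          using slit_transition[OF assms V W, of "fst z" "snd z"] by (auto intro!: image_eqI)
        with z show "z \<in> ?E" by auto
      qed
    qed
    have D: "open ?D" "smooth_on ?\<tau> ?D"
      using transition_open[OF assms V W] transition_smooth[OF assms V W] .
    have o: "open (?D \<times> (- {0::'e}))" using D(1) by (rule open_slit)
    have "smooth_on (\<lambda>z. (?\<tau> (fst z), frechet_derivative ?\<tau> (at (fst z)) (snd z))) (?D \<times> (- {0}))"
      using D o
      by (intro smooth_on_Pair smooth_on_frechet_derivative'[of ?D] smooth_on_fst smooth_on_snd
          smooth_on_compose[of _ ?D fst ?\<tau>]) auto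
    moreover have "(?\<tau> (fst z), frechet_derivative ?\<tau> (at (fst z)) (snd z)) =
        (inv_into (W \<times> (- {0})) (slit_chart A \<phi>) \<circ> slit_chart A \<psi>) z" if "z \<in> ?D \<times> (- {0})" for z
    proof -
      let ?w = "(?\<tau> (fst z), frechet_derivative ?\<tau> (at (fst z)) (snd z))"
      have "fst z \<in> V" "\<psi> (fst z) \<in> \<phi> ` W" "snd z \<noteq> 0" using that by auto
      note t = slit_transition[OF assms V W this]
      have "?w \<in> W \<times> (- {0})" using t(2,3) by blast
      from inv_into_f_f[OF slit_chart_inj[OF assms W] this] show ?thesis
        using t(1) by simp
    qed
    ultimately have "smooth_on (inv_into (W \<times> (- {0})) (slit_chart A \<phi>) \<circ> slit_chart A \<psi>) (?D \<times> (- {0}))"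
      by (rule smooth_on_cong[OF o, rotated])
    with o E show ?thesis by simp
  qed
  have 3: "open {z\<in>V'. \<Psi> z \<in> \<Phi> ` W'} \<and> smooth_on (inv_into W' \<Phi> \<circ> \<Psi>) {z\<in>V'. \<Psi> z \<in> \<Phi> ` W'}"
    if "(V', \<Psi>) \<in> slit_atlas A" "(W', \<Phi>) \<in> slit_atlas A" for V' \<Psi> W' \<Phi>
    by (rule slit_atlasE[OF that(1)], rule slit_atlasE[OF that(2)]) (use 2 in simp)
  show ?thesis unfolding smooth_atlas_def using 1 3 by blast
qed

lemma slit_chart_in_slit_tangent:
  assumes "smooth_atlas A" "(V, \<psi>) \<in> A" "z \<in> V \<times> (- {0})"
  shows "slit_chart A \<psi> z \<in> slit_tangent A"
  using assms tangent_space_chart[OF assms(1,2)] dir_deriv_eq_zero_iff[OF assms(1,2)]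
  by (auto simp: slit_tangent_def slit_chart_def intro: carrierI)

lemma slit_tangentE:
  assumes "smooth_atlas A" "u \<in> slit_tangent A"
  obtains V \<psi> x y where "(V, \<psi>) \<in> A" "x \<in> V" "y \<noteq> 0" "u = slit_chart A \<psi> (x, y)"
proof -
  have u: "fst u \<in> atlas_carrier A" "snd u \<in> tangent_space A (fst u)" "snd u \<noteq> tv_zero"
    using assms(2) by (auto simp: slit_tangent_def)
  obtain V \<psi> x where V: "(V, \<psi>) \<in> A" "x \<in> V" "fst u = \<psi> x" using carrierE[OF u(1)] .
  obtain y where y: "snd u = dir_deriv A \<psi> x y"
    using tangent_spaceE[OF assms(1) V(1,2)] u(2) V(3) by metis
  have "y \<noteq> 0" using u(3) y dir_deriv_zero[OF assms(1) V(1,2)] by auto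
  then show ?thesis using that V y by (metis prod.collapse slit_chart_apply)
qed

lemma carrier_slit_atlas:
  assumes "smooth_atlas A"
  shows "atlas_carrier (slit_atlas A) = slit_tangent A"
proof
  show "atlas_carrier (slit_atlas A) \<subseteq> slit_tangent A"
  proof
    fix u assume "u \<in> atlas_carrier (slit_atlas A)"
    then obtain V' \<Psi> z where "(V', \<Psi>) \<in> slit_atlas A" "z \<in> V'" "u = \<Psi> z" by (rule carrierE)
    then show "u \<in> slit_tangent A"
      using slit_chart_in_slit_tangent[OF assms] by (metis slit_atlasE)
  qed
  show "slit_tangent A \<subseteq> atlas_carrier (slit_atlas A)"
  proof
    fix u assume "u \<in> slit_tangent A"
    then show "u \<in> atlas_carrier (slit_atlas A)"
      by (rule slit_tangentE[OF assms]) (auto intro!: carrierI[OF slit_atlas_chart])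
  qed
qed

lemma openin_slit_preimage:
  fixes A :: "('e::euclidean_space, 'a) atlas"
  assumes "smooth_atlas A" "openin (atlas_topology A) U"
  shows "openin (atlas_topology (slit_atlas A)) {u\<in>slit_tangent A. fst u \<in> U}"
  unfolding openin_atlas_topology carrier_slit_atlas[OF assms(1)]
proof (intro conjI ballI)
  have *: "open {z\<in>V \<times> (- {0}). slit_chart A \<psi> z \<in> slit_tangent A \<and> fst (slit_chart A \<psi> z) \<in> U}"
    if V: "(V, \<psi>) \<in> A" for V \<psi>
  proof -
    have "{z\<in>V \<times> (- {0}). slit_chart A \<psi> z \<in> slit_tangent A \<and> fst (slit_chart A \<psi> z) \<in> U} =
        {x\<in>V. \<psi> x \<in> U} \<times> (- {0})"
      using slit_chart_in_slit_tangent[OF assms(1) V] by (auto simp: fst_slit_chart)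
    moreover have "open ({x\<in>V. \<psi> x \<in> U} \<times> (- {0 :: 'e}))"
      using open_chart_preimage[OF assms(2) V] by (rule open_slit)
    ultimately show ?thesis by simp
  qed
  fix c assume "c \<in> slit_atlas A"
  then show "case c of (V', \<Psi>) \<Rightarrow> open {z\<in>V'. \<Psi> z \<in> {u\<in>slit_tangent A. fst u \<in> U}}"
    using * by (auto elim!: slit_atlasE)
qed auto

lemma smooth_near_slit_chart:
  assumes "smooth_atlas A" "(V, \<psi>) \<in> A" "z \<in> V \<times> (- {0})"
  shows "smooth_near (slit_atlas A) (slit_chart A \<psi> z) F \<longleftrightarrow>
    (\<exists>W. open W \<and> z \<in> W \<and> W \<subseteq> V \<times> (- {0}) \<and> smooth_on (\<lambda>z. F (slit_chart A \<psi> z)) W)"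
  by (rule smooth_near_chart[OF smooth_atlas_slit[OF assms(1)] slit_atlas_chart[OF assms(2)] assms(3)])

text \<open>Restriction to a slice with fixed \<open>y\<close> gives the less obvious direction. It
  makes \<open>rho\<close> respect the default value 0: a function that is not smooth on the base
  stays so after pulling back.\<close>

lemma smooth_near_fst_iff:
  fixes A :: "('e::euclidean_space, 'a) atlas"
  assumes "smooth_atlas A" "u \<in> slit_tangent A"
  shows "smooth_near (slit_atlas A) u (\<lambda>w. f (fst w)) \<longleftrightarrow> smooth_near A (fst u) f"
proof -
  obtain V \<psi> x y where V: "(V, \<psi>) \<in> A" "x \<in> V" "y \<noteq> 0" "u = slit_chart A \<psi> (x, y)"
    using slit_tangentE[OF assms] .
  have "(\<exists>W. open W \<and> (x, y) \<in> W \<and> W \<subseteq> V \<times> (- {0}) \<and> smooth_on (\<lambda>z. f (\<psi> (fst z))) W) \<longleftrightarrow>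
    (\<exists>W. open W \<and> x \<in> W \<and> W \<subseteq> V \<and> smooth_on (\<lambda>x. f (\<psi> x)) W)"
  proof (intro iffI; elim exE conjE)
    fix W assume W: "open W" "(x, y) \<in> W" "W \<subseteq> V \<times> (- {0})" "smooth_on (\<lambda>z. f (\<psi> (fst z))) W"
    let ?S = "(\<lambda>x. (x, y)) -` W"
    have S: "open ?S" by (intro open_vimage W(1) continuous_intros)
    have "smooth_on (\<lambda>x. f (\<psi> (fst (x, y)))) ?S"
      by (rule smooth_on_compose[OF S W(1) _ W(4)])
        (auto intro!: smooth_on_Pair[OF S smooth_on_linear[OF S bounded_linear_ident] smooth_on_const])
    with S W show "\<exists>W. open W \<and> x \<in> W \<and> W \<subseteq> V \<and> smooth_on (\<lambda>x. f (\<psi> x)) W"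
      by (intro exI[of _ ?S]) auto
  next
    fix W assume W: "open W" "x \<in> W" "W \<subseteq> V" "smooth_on (\<lambda>x. f (\<psi> x)) W"
    have o: "open (W \<times> (- {0::'e}))" using W(1) by (rule open_slit)
    have "smooth_on (\<lambda>z. f (\<psi> (fst z))) (W \<times> (- {0 :: 'e}))"
      by (rule smooth_on_compose[OF o W(1) _ W(4) smooth_on_fst[OF o]]) auto
    with o W V show "\<exists>W. open W \<and> (x, y) \<in> W \<and> W \<subseteq> V \<times> (- {0}) \<and> smooth_on (\<lambda>z. f (\<psi> (fst z))) W"
      by (intro exI[of _ "W \<times> (- {0})"]) auto
  qed
  then show ?thesis
    using smooth_near_slit_chart[OF assms(1) V(1), of "(x, y)" "\<lambda>w. f (fst w)"]
      smooth_near_chart[OF assms(1) V(1,2), of f] V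
    by (simp add: fst_slit_chart)
qed

lemma frechet_derivative_fst:
  assumes "f differentiable (at (fst z))"
  shows "frechet_derivative (\<lambda>z. f (fst z)) (at z) w = frechet_derivative f (at (fst z)) (fst w)"
proof -
  have "(f has_derivative frechet_derivative f (at (fst z))) (at (fst z))"
    using assms by (simp flip: frechet_derivative_works)
  from diff_chain_at[OF has_derivative_fst[OF has_derivative_ident] this]
  have "((\<lambda>z. f (fst z)) has_derivative (\<lambda>w. frechet_derivative f (at (fst z)) (fst w))) (at z)"
    by (simp add: o_def)
  from frechet_derivative_at[OF this] show ?thesis by metis
qed

lemma rho_dir_deriv:
  assumes "smooth_atlas A" "(V, \<psi>) \<in> A" "x \<in> V" "y \<noteq> 0"
  shows "rho (dir_deriv (slit_atlas A) (slit_chart A \<psi>) (x, y) w) = dir_deriv A \<psi> x (fst w)"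
proof
  fix f
  let ?u = "slit_chart A \<psi> (x, y)"
  have u: "?u \<in> slit_tangent A" using slit_chart_in_slit_tangent assms by blast
  have *: "smooth_near (slit_atlas A) ?u (f \<circ> fst) \<longleftrightarrow> smooth_near A (\<psi> x) f"
    using smooth_near_fst_iff[OF assms(1) u, of f] by (simp add: o_def fst_slit_chart)
  show "rho (dir_deriv (slit_atlas A) (slit_chart A \<psi>) (x, y) w) f = dir_deriv A \<psi> x (fst w) f"
  proof (cases "smooth_near A (\<psi> x) f")
    case True
    then have "(\<lambda>z. f (\<psi> z)) differentiable (at (fst (x, y)))"
      using smooth_near_chartD[OF assms(1-3)] by (auto simp: differentiable_def)
    from frechet_derivative_fst[OF this, of w] True * show ?thesis
      by (simp add: rho_def dir_deriv_def o_def fst_slit_chart)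
  qed (use * in \<open>simp add: rho_def dir_deriv_def\<close>)
qed

lemma vgamma_dir_deriv:
  assumes "smooth_atlas A" "(V, \<psi>) \<in> A" "x \<in> V" "y \<noteq> 0"
  shows "vgamma A (slit_chart A \<psi> (x, y)) (dir_deriv A \<psi> x b) =
    dir_deriv (slit_atlas A) (slit_chart A \<psi>) (x, y) (0, b)"
proof
  fix F
  let ?u = "slit_chart A \<psi> (x, y)"
  have z: "(x, y) \<in> V \<times> (- {0})" using assms by auto
  show "vgamma A ?u (dir_deriv A \<psi> x b) F = dir_deriv (slit_atlas A) (slit_chart A \<psi>) (x, y) (0, b) F"
  proof (cases "smooth_near (slit_atlas A) ?u F")
    case True
    then obtain W where W: "open W" "(x, y) \<in> W" "smooth_on (\<lambda>z. F (slit_chart A \<psi> z)) W"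
      using smooth_near_slit_chart[OF assms(1,2) z] by blast
    have "((\<lambda>t. F (slit_chart A \<psi> ((x, y) + t *\<^sub>R (0, b)))) has_real_derivative
        frechet_derivative (\<lambda>z. F (slit_chart A \<psi> z)) (at ((x, y) + 0 *\<^sub>R (0, b))) (0, b)) (at 0)"
      by (rule has_real_derivative_along_line[OF W(3)]) (use W(2) in simp)
    from DERIV_imp_deriv[OF this] True show ?thesis
      by (simp add: vgamma_def dir_deriv_def[of "slit_atlas A"] o_def slit_chart_apply dir_deriv_add[OF assms(1-3)]
          dir_deriv_scale[OF assms(1-3)])
  qed (simp add: vgamma_def dir_deriv_def[of "slit_atlas A"])
qed

lemma vgamma_tangent:
  assumes "smooth_atlas A" "u \<in> slit_tangent A" "n \<in> tangent_space A (fst u)"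
  shows vgamma_in_tangent_space: "vgamma A u n \<in> tangent_space (slit_atlas A) u"
    and rho_vgamma: "rho (vgamma A u n) = tv_zero"
proof -
  obtain V \<psi> x y where V: "(V, \<psi>) \<in> A" "x \<in> V" "y \<noteq> 0" "u = slit_chart A \<psi> (x, y)"
    using slit_tangentE[OF assms(1,2)] .
  then have z: "(x, y) \<in> V \<times> (- {0})" by simp
  obtain b where b: "n = dir_deriv A \<psi> x b"
    using assms(3) tangent_spaceE[OF assms(1) V(1,2)] V(4) by (metis fst_conv slit_chart_apply)
  show "vgamma A u n \<in> tangent_space (slit_atlas A) u" "rho (vgamma A u n) = tv_zero"
    using tangent_space_chart[OF smooth_atlas_slit[OF assms(1)] slit_atlas_chart[OF V(1)] z]
      rho_dir_deriv[OF assms(1) V(1-3)]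
    by (auto simp: b V(4) vgamma_dir_deriv[OF assms(1) V(1-3)] dir_deriv_zero[OF assms(1) V(1,2)])
qed

text \<open>In a chart \<open>rho\<close> keeps the first component of a direction and
  \<open>vgamma\<close> fills the second, so the kernel of one is the range of the other.\<close>

lemma vertical_vgamma:
  assumes "smooth_atlas A" "\<xi> \<in> tangent_space (slit_atlas A) u" "rho \<xi> = tv_zero"
  obtains n where "n \<in> tangent_space A (fst u)" "\<xi> = vgamma A u n"
proof -
  have "u \<in> slit_tangent A"
    using tangent_space_carrier[OF assms(2)] carrier_slit_atlas[OF assms(1)] by simp
  then obtain V \<psi> x y where V: "(V, \<psi>) \<in> A" "x \<in> V" "y \<noteq> 0" "u = slit_chart A \<psi> (x, y)"
    by (rule slit_tangentE[OF assms(1)])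
  then have "(x, y) \<in> V \<times> (- {0})" by simp
  note t = tangent_space_chart[OF smooth_atlas_slit[OF assms(1)] slit_atlas_chart[OF V(1)] this]
  then obtain w where w: "\<xi> = dir_deriv (slit_atlas A) (slit_chart A \<psi>) (x, y) w"
    using assms(2) V(4) by auto
  have "fst w = 0"
    using assms(3) rho_dir_deriv[OF assms(1) V(1-3)] dir_deriv_eq_zero_iff[OF assms(1) V(1,2)]
    by (simp add: w)
  then have "w = (0, snd w)" by (simp add: prod_eq_iff)
  then have "\<xi> = vgamma A u (dir_deriv A \<psi> x (snd w))"
    unfolding w V(4) vgamma_dir_deriv[OF assms(1) V(1-3)] by simp
  moreover have "dir_deriv A \<psi> x (snd w) \<in> tangent_space A (fst u)"
    using tangent_space_chart[OF assms(1) V(1,2)] V(4) by (simp add: fst_slit_chart)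
  ultimately show ?thesis using that by blast
qed

lemma vgamma_scale:
  assumes "smooth_atlas A" "u \<in> slit_tangent A" "n \<in> tangent_space A (fst u)"
  shows "vgamma A u (tv_scale c n) = tv_scale c (vgamma A u n)"
proof -
  obtain V \<psi> x y where V: "(V, \<psi>) \<in> A" "x \<in> V" "y \<noteq> 0" "u = slit_chart A \<psi> (x, y)"
    using slit_tangentE[OF assms(1,2)] .
  then have z: "(x, y) \<in> V \<times> (- {0})" by simp
  obtain b where b: "n = dir_deriv A \<psi> x b"
    using assms(3) tangent_spaceE[OF assms(1) V(1,2)] V(4) by (metis fst_conv slit_chart_apply)
  show ?thesis
    using dir_deriv_scale[OF smooth_atlas_slit[OF assms(1)] slit_atlas_chart[OF V(1)] z, of c "(0, b)"]
    by (simp add: b V(4) vgamma_dir_deriv[OF assms(1) V(1-3)] flip: dir_deriv_scale[OF assms(1) V(1,2)])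
qed

section \<open>Pi-vector fields and their components\<close>

lemma pi_vector_field_tangent:
  "pi_vector_field A X \<Longrightarrow> u \<in> slit_tangent A \<Longrightarrow> X u \<in> tangent_space A (fst u)"
  unfolding pi_vector_field_def by blast

lemma pi_vector_field_iff:
  assumes "smooth_atlas A"
  shows "pi_vector_field A X \<longleftrightarrow> (\<forall>u\<in>slit_tangent A. X u \<in> tangent_space A (fst u) \<and>
     (\<forall>f. smooth_near A (fst u) f \<longrightarrow> smooth_near (slit_atlas A) u (\<lambda>u. X u f)))"
    (is "_ \<longleftrightarrow> ?R")
proof
  assume X: "pi_vector_field A X"
  show ?R
  proof (intro ballI conjI allI impI)
    fix u f assume u: "u \<in> slit_tangent A"
    then show "X u \<in> tangent_space A (fst u)" by (rule pi_vector_field_tangent[OF X])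
    assume "smooth_near A (fst u) f"
    then obtain U where "fst u \<in> U" "smooth_fun_on A U f" unfolding smooth_near_def by blast
    with X u have 1: "smooth_fun_on (slit_atlas A) {u\<in>slit_tangent A. fst u \<in> U} (\<lambda>u. X u f)"
      and 2: "u \<in> {u\<in>slit_tangent A. fst u \<in> U}"
      unfolding pi_vector_field_def by auto
    show "smooth_near (slit_atlas A) u (\<lambda>u. X u f)"
      unfolding smooth_near_def by (intro exI conjI) (rule 2, rule 1)
  qed
next
  assume R: ?R
  show "pi_vector_field A X"
    unfolding pi_vector_field_def
  proof (intro conjI ballI allI impI)
    fix U f assume "smooth_fun_on A U f"
    then have U: "openin (atlas_topology A) U" "\<And>p. p \<in> U \<Longrightarrow> smooth_near A p f"
      using smooth_fun_on_iff[OF assms] by auto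
    show "smooth_fun_on (slit_atlas A) {u\<in>slit_tangent A. fst u \<in> U} (\<lambda>u. X u f)"
      unfolding smooth_fun_on_iff[OF smooth_atlas_slit[OF assms]]
      using openin_slit_preimage[OF assms U(1)] R U(2) by auto
  qed (use R in auto)
qed

lemma pi_vector_field_smooth:
  assumes "smooth_atlas A" "pi_vector_field A X" "u \<in> slit_tangent A" "smooth_near A (fst u) f"
  shows "smooth_near (slit_atlas A) u (\<lambda>u. X u f)"
  using assms(2-) unfolding pi_vector_field_iff[OF assms(1)] by blast

lemma pi_vector_field_cong:
  assumes "smooth_atlas A" "pi_vector_field A X" "\<And>u. u \<in> slit_tangent A \<Longrightarrow> X u = Y u"
  shows "pi_vector_field A Y"
proof -
  have "smooth_near (slit_atlas A) u (\<lambda>u. Y u f)"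
    if "u \<in> slit_tangent A" "smooth_near (slit_atlas A) u (\<lambda>u. X u f)" for u f
    by (rule smooth_near_cong[OF smooth_atlas_slit[OF assms(1)]
          openin_carrier[OF smooth_atlas_slit[OF assms(1)]] _ _ that(2)])
      (use that assms(3) in \<open>auto simp: carrier_slit_atlas[OF assms(1)]\<close>)
  then show ?thesis
    using assms(2,3) unfolding pi_vector_field_iff[OF assms(1)] by auto
qed

lemma pi_vector_field_chart:
  fixes A :: "('e::euclidean_space, 'a) atlas"
  assumes "smooth_atlas A" "pi_vector_field A X" "(V, \<psi>) \<in> A"
  obtains \<xi> where "smooth_on \<xi> (V \<times> (- {0}))"
    "\<And>z. z \<in> V \<times> (- {0}) \<Longrightarrow> X (slit_chart A \<psi> z) = dir_deriv A \<psi> (fst z) (\<xi> z)"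
proof -
  let ?S = "V \<times> (- {0 :: 'e})"
  \<comment> \<open>Applying the field to the coordinate functions yields its components, which
    inherit smoothness from the definition of a pi-vector field.\<close>
  let ?\<xi> = "\<lambda>z. \<Sum>b\<in>Basis. X (slit_chart A \<psi> z) (\<lambda>p. inv_into V \<psi> p \<bullet> b) *\<^sub>R b"
  have S: "open ?S" using chart_open[OF assms(1,3)] by (rule open_slit)
  have "smooth_on (\<lambda>z. X (slit_chart A \<psi> z) (\<lambda>p. inv_into V \<psi> p \<bullet> b)) ?S" for b
  proof (rule smooth_on_local)
    fix z assume z: "z \<in> ?S"
    then have "smooth_near A (fst (slit_chart A \<psi> z)) (\<lambda>p. inv_into V \<psi> p \<bullet> b)"
      using coordinate_smooth[OF assms(1,3)] smooth_fun_on_iff[OF assms(1)] by (auto simp: fst_slit_chart)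
    from pi_vector_field_smooth[OF assms(1,2) slit_chart_in_slit_tangent[OF assms(1,3) z] this]
    obtain W where "open W" "z \<in> W" "smooth_on (\<lambda>z. X (slit_chart A \<psi> z) (\<lambda>p. inv_into V \<psi> p \<bullet> b)) W"
      unfolding smooth_near_slit_chart[OF assms(1,3) z] by (elim exE conjE)
    then show "\<exists>W. open W \<and> z \<in> W \<and> smooth_on (\<lambda>z. X (slit_chart A \<psi> z) (\<lambda>p. inv_into V \<psi> p \<bullet> b)) W"
      by (intro exI[of _ W] conjI)
  qed
  then have "smooth_on ?\<xi> ?S" by (intro smooth_on_sum smooth_on_scaleR S smooth_on_const)
  moreover have "X (slit_chart A \<psi> z) = dir_deriv A \<psi> (fst z) (?\<xi> z)" if z: "z \<in> ?S" for z
  proof -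
    have zV: "fst z \<in> V" using z by auto
    obtain a where a: "X (slit_chart A \<psi> z) = dir_deriv A \<psi> (fst z) a"
      using pi_vector_field_tangent[OF assms(2) slit_chart_in_slit_tangent[OF assms(1,3) z]]
        tangent_spaceE[OF assms(1,3) zV] by (metis fst_slit_chart)
    have "?\<xi> z = a"
      unfolding a dir_deriv_coordinate[OF assms(1,3) zV] by (rule euclidean_representation)
    with a show ?thesis by metis
  qed
  ultimately show ?thesis using that by blast
qed

lemma pi_vector_fieldI:
  assumes "smooth_atlas A"
    and "\<And>V \<psi> z. (V, \<psi>) \<in> A \<Longrightarrow> z \<in> V \<times> (- {0}) \<Longrightarrow> \<exists>W \<xi>. open W \<and> z \<in> W \<and> W \<subseteq> V \<times> (- {0}) \<and>
      smooth_on \<xi> W \<and> (\<forall>z\<in>W. X (slit_chart A \<psi> z) = dir_deriv A \<psi> (fst z) (\<xi> z))"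
  shows "pi_vector_field A X"
  unfolding pi_vector_field_iff[OF assms(1)]
proof (rule ballI)
  fix u assume "u \<in> slit_tangent A"
  then obtain V \<psi> x y where V: "(V, \<psi>) \<in> A" "x \<in> V" "y \<noteq> 0" "u = slit_chart A \<psi> (x, y)"
    by (rule slit_tangentE[OF assms(1)])
  then have z: "(x, y) \<in> V \<times> (- {0})" by simp
  obtain W \<xi> where W: "open W" "(x, y) \<in> W" "W \<subseteq> V \<times> (- {0})" "smooth_on \<xi> W"
      "\<And>z. z \<in> W \<Longrightarrow> X (slit_chart A \<psi> z) = dir_deriv A \<psi> (fst z) (\<xi> z)"
    using assms(2)[OF V(1) z] by blast
  have "smooth_near (slit_atlas A) u (\<lambda>u. X u f)" if f: "smooth_near A (fst u) f" for f
  proof -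
    obtain S where S: "openin (atlas_topology A) S" "\<psi> x \<in> S" "smooth_fun_on A S f"
      using f unfolding smooth_near_def smooth_fun_on_def V(4) by (auto simp: fst_slit_chart)
    let ?S = "{x\<in>V. \<psi> x \<in> S}" and ?W = "{z\<in>W. fst z \<in> V \<and> \<psi> (fst z) \<in> S}"
    have oS: "open ?S" by (rule open_chart_preimage[OF S(1) V(1)])
    have eq: "?W = W \<inter> fst -` ?S" by auto
    have oW: "open ?W" unfolding eq using W(1) oS by (intro open_Int open_vimage_fst)
    have fS: "smooth_on (\<lambda>x. f (\<psi> x)) ?S"
      using S(3) V(1) unfolding smooth_fun_on_def by (auto simp: o_def)
    have "smooth_on (\<lambda>z. frechet_derivative (\<lambda>x. f (\<psi> x)) (at (fst z)) (\<xi> z)) ?W"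
      by (rule smooth_on_frechet_derivative'[OF oS fS oW])
        (auto intro: smooth_on_fst oW smooth_on_subset[OF W(4)])
    moreover have "frechet_derivative (\<lambda>x. f (\<psi> x)) (at (fst z)) (\<xi> z) = X (slit_chart A \<psi> z) f" if "z \<in> ?W" for z
    proof -
      have "smooth_near A (\<psi> (fst z)) f" using S(3) that unfolding smooth_near_def by blast
      then show ?thesis using W(5) that by (simp add: dir_deriv_def o_def)
    qed
    ultimately have "smooth_on (\<lambda>z. X (slit_chart A \<psi> z) f) ?W"
      by (rule smooth_on_cong[OF oW, rotated])
    with oW W S V show ?thesis
      unfolding V(4) smooth_near_slit_chart[OF assms(1) V(1) z]
      by (intro exI[of _ ?W]) auto
  qed
  moreover have "X u \<in> tangent_space A (fst u)"
    using tangent_space_chart[OF assms(1) V(1,2)] W(2,5) by (auto simp: V(4) fst_slit_chart)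
  ultimately show "X u \<in> tangent_space A (fst u) \<and>
     (\<forall>f. smooth_near A (fst u) f \<longrightarrow> smooth_near (slit_atlas A) u (\<lambda>u. X u f))" by blast
qed

lemma pi_vector_field_eta:
  fixes A :: "('e::euclidean_space, 'a) atlas"
  assumes "smooth_atlas A"
  shows "pi_vector_field A eta"
proof (rule pi_vector_fieldI[OF assms])
  fix V \<psi> z assume "(V, \<psi>) \<in> A" "z \<in> V \<times> (- {0::'e})"
  then show "\<exists>W \<xi>. open W \<and> z \<in> W \<and> W \<subseteq> V \<times> (- {0}) \<and>
      smooth_on \<xi> W \<and> (\<forall>z\<in>W. eta (slit_chart A \<psi> z) = dir_deriv A \<psi> (fst z) (\<xi> z))"
    using chart_open[OF assms]
    by (intro exI[of _ "V \<times> (- {0})"] exI[of _ snd])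
      (auto simp: eta_def slit_chart_def intro!: open_slit smooth_on_snd)
qed

lemma pi_vector_field_zero:
  fixes A :: "('e::euclidean_space, 'a) atlas"
  assumes "smooth_atlas A"
  shows "pi_vector_field A (\<lambda>u. tv_zero)"
proof (rule pi_vector_fieldI[OF assms])
  fix V \<psi> z assume "(V, \<psi>) \<in> A" "z \<in> V \<times> (- {0::'e})"
  then show "\<exists>W \<xi>. open W \<and> z \<in> W \<and> W \<subseteq> V \<times> (- {0}) \<and>
      smooth_on \<xi> W \<and> (\<forall>z\<in>W. tv_zero = dir_deriv A \<psi> (fst z) (\<xi> z))"
    using chart_open[OF assms]
    by (intro exI[of _ "V \<times> (- {0})"] exI[of _ "\<lambda>_. 0"])
      (auto simp: dir_deriv_zero[OF assms] intro!: open_slit smooth_on_const)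
qed

lemma pi_vector_field_basic:
  assumes "smooth_atlas A" "vector_field A X"
  shows "pi_vector_field A (\<lambda>u. X (fst u))"
  unfolding pi_vector_field_iff[OF assms(1)]
proof (intro ballI conjI allI impI)
  fix u f assume u: "u \<in> slit_tangent A"
  then show "X (fst u) \<in> tangent_space A (fst u)"
    using assms(2) unfolding vector_field_def slit_tangent_def by auto
  assume "smooth_near A (fst u) f"
  then have "smooth_near A (fst u) (\<lambda>p. X p f)"
    using assms(2) unfolding vector_field_def smooth_near_def by blast
  then show "smooth_near (slit_atlas A) u (\<lambda>u. X (fst u) f)"
    using smooth_near_fst_iff[OF assms(1) u, of "\<lambda>p. X p f"] by simp
qed

text \<open>The Hausdorff assumption concerns the base, so the bump function is taken there and
  pulled back. Being constant on fibres does no harm, since a slit chart covers the whole punctured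
  fibre over each of its base points.\<close>

lemma slit_vector_field_extension:
  assumes "smooth_atlas A" "Hausdorff_space (atlas_topology A)" "\<xi> \<in> tangent_space (slit_atlas A) u"
  obtains X where "vector_field (slit_atlas A) X" "X u = \<xi>"
proof -
  note B = smooth_atlas_slit[OF assms(1)]
  have "u \<in> slit_tangent A"
    using tangent_space_carrier[OF assms(3)] carrier_slit_atlas[OF assms(1)] by simp
  then obtain V \<psi> x y where V: "(V, \<psi>) \<in> A" "x \<in> V" "y \<noteq> 0" "u = slit_chart A \<psi> (x, y)"
    by (rule slit_tangentE[OF assms(1)])
  note C = slit_atlas_chart[OF V(1)]
  have z: "(x, y) \<in> V \<times> (- {0})" using V by simp
  obtain w where w: "\<xi> = dir_deriv (slit_atlas A) (slit_chart A \<psi>) (x, y) w"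
    using tangent_spaceE[OF B C z] assms(3) V(4) by metis
  obtain \<theta> N where \<theta>: "smooth_fun_on A (atlas_carrier A) \<theta>" "\<theta> (\<psi> x) = 1"
    "openin (atlas_topology A) N" "atlas_carrier A \<subseteq> N \<union> \<psi> ` V" "\<And>q. q \<in> N \<Longrightarrow> \<theta> q = 0"
    using bump_function[OF assms(1,2) V(1,2)] by blast
  let ?N = "{u\<in>slit_tangent A. fst u \<in> N}" and ?C = "slit_chart A \<psi> ` (V \<times> (- {0}))"
  have 1: "smooth_fun_on (slit_atlas A) (atlas_carrier (slit_atlas A)) (\<lambda>w. \<theta> (fst w))"
    unfolding smooth_fun_on_iff[OF B]
    using openin_carrier[OF B] smooth_near_fst_iff[OF assms(1)] \<theta>(1) smooth_fun_on_iff[OF assms(1)]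
    by (auto simp: carrier_slit_atlas[OF assms(1)] slit_tangent_def)
  have 2: "slit_tangent A \<subseteq> ?N \<union> ?C"
  proof
    fix q assume q: "q \<in> slit_tangent A"
    show "q \<in> ?N \<union> ?C"
    proof (cases "fst q \<in> N")
      case False
      with q \<theta>(4) obtain x' where x': "x' \<in> V" "fst q = \<psi> x'" by (auto simp: slit_tangent_def)
      then have "snd q \<in> tangent_space A (\<psi> x')" using q by (auto simp: slit_tangent_def)
      then obtain y' where y': "snd q = dir_deriv A \<psi> x' y'"
        by (rule tangent_spaceE[OF assms(1) V(1) x'(1)])
      then have "y' \<noteq> 0" using q dir_deriv_zero[OF assms(1) V(1) x'(1)] by (auto simp: slit_tangent_def)
      with x' y' show ?thesis
        by (auto intro!: image_eqI[of _ _ "(x', y')"] simp: slit_chart_apply prod_eq_iff)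
    qed (use q in auto)
  qed
  have 3: "vector_field (slit_atlas A) (\<lambda>q. if q \<in> ?C then tv_scale (\<theta> (fst q))
      (dir_deriv (slit_atlas A) (slit_chart A \<psi>) (inv_into (V \<times> (- {0})) (slit_chart A \<psi>) q) w) else tv_zero)"
    using bump_vector_field[OF B C 1 openin_slit_preimage[OF assms(1) \<theta>(3)], of w] 2 \<theta>(5)
    by (auto simp: carrier_slit_atlas[OF assms(1)])
  show ?thesis
    by (rule that[OF 3])
      (use z in \<open>auto simp: V(4) w inv_into_f_f[OF slit_chart_inj[OF assms(1) V(1)]] tv_scale_def fst_slit_chart \<theta>(2)\<close>)
qed

text \<open>Fields pulled back from the base are constant along the fibres, so their vertical
  derivatives vanish; this makes them convenient test fields for the axioms of a Cartan
  connection.\<close>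

lemma basic_extension:
  assumes "smooth_atlas A" "Hausdorff_space (atlas_topology A)" "v \<in> tangent_space A p"
  obtains Y where "pi_vector_field A (\<lambda>u. Y (fst u))" "Y p = v"
  using vector_field_extension[OF assms] pi_vector_field_basic[OF assms(1)] by metis

section \<open>The Finsler metric in coordinates\<close>

definition energy :: "('e::euclidean_space, 'a) atlas \<Rightarrow> ('a \<times> 'a tvec \<Rightarrow> real) \<Rightarrow> ('e \<Rightarrow> 'a) \<Rightarrow> 'e \<times> 'e \<Rightarrow> real" where
  "energy A L \<psi> z = (L (slit_chart A \<psi> z))\<^sup>2 / 2"

text \<open>The order follows \<open>finsler_metric\<close>: the derivative along the last argument
  is taken first. The pairs \<open>(0, w)\<close> are the vertical directions.\<close>

definition fibre_hessian ::
  "('e::euclidean_space, 'a) atlas \<Rightarrow> ('a \<times> 'a tvec \<Rightarrow> real) \<Rightarrow> ('e \<Rightarrow> 'a) \<Rightarrow> 'e \<times> 'e \<Rightarrow> 'e \<Rightarrow> 'e \<Rightarrow> real" where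
  "fibre_hessian A L \<psi> z v w =
     frechet_derivative (\<lambda>z. frechet_derivative (energy A L \<psi>) (at z) (0, w)) (at z) (0, v)"

lemma smooth_on_energy:
  fixes A :: "('e::euclidean_space, 'a) atlas"
  assumes "smooth_atlas A" "smooth_fun_on (slit_atlas A) (slit_tangent A) L" "(V, \<psi>) \<in> A"
  shows "smooth_on (energy A L \<psi>) (V \<times> (- {0}))"
proof -
  let ?S = "V \<times> (- {0 :: 'e})"
  have S: "open ?S" using chart_open[OF assms(1,3)] by (rule open_slit)
  have "smooth_on (L \<circ> slit_chart A \<psi>) {z\<in>?S. slit_chart A \<psi> z \<in> slit_tangent A}"
    using assms(2) slit_atlas_chart[OF assms(3)] unfolding smooth_fun_on_def by blast
  moreover have "{z\<in>?S. slit_chart A \<psi> z \<in> slit_tangent A} = ?S"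
    using slit_chart_in_slit_tangent[OF assms(1,3)] by blast
  ultimately have L: "smooth_on (\<lambda>z. L (slit_chart A \<psi> z)) ?S" by (simp add: o_def)
  have "smooth_on (\<lambda>z. (1 / 2) * (L (slit_chart A \<psi> z) * L (slit_chart A \<psi> z))) ?S"
    by (intro smooth_on_mult smooth_on_const S L)
  then show ?thesis
    by (rule smooth_on_cong[OF S, rotated]) (simp add: energy_def power2_eq_square)
qed

lemma slit_chart_translate:
  assumes "smooth_atlas A" "(V, \<psi>) \<in> A" "x \<in> V"
  shows "(\<psi> x, tv_add (dir_deriv A \<psi> x y) (tv_scale t (dir_deriv A \<psi> x w))) =
    slit_chart A \<psi> ((x, y) + t *\<^sub>R (0, w))"
  by (simp add: slit_chart_apply dir_deriv_add[OF assms] dir_deriv_scale[OF assms])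

text \<open>Lines in a fibre may run through the missing zero vector, but \<open>deriv\<close> at 0
  sees only small parameters.\<close>

lemma eventually_translate_nonzero:
  fixes y v :: "'e::euclidean_space"
  assumes "y \<noteq> 0"
  shows "\<forall>\<^sub>F s in nhds 0. y + s *\<^sub>R v \<noteq> 0"
proof -
  have "((\<lambda>s. y + s *\<^sub>R v) \<longlongrightarrow> y + 0 *\<^sub>R v) (nhds 0)"
    by (intro tendsto_intros filterlim_ident)
  then show ?thesis
    using assms by (intro tendsto_imp_eventually_ne) auto
qed

lemma finsler_inner_derivative:
  assumes "smooth_atlas A" "smooth_fun_on (slit_atlas A) (slit_tangent A) L" "(V, \<psi>) \<in> A"
    and "x \<in> V" "y \<noteq> 0"
  shows "((\<lambda>t. (L (\<psi> x, tv_add (dir_deriv A \<psi> x y) (tv_scale t (dir_deriv A \<psi> x w))))\<^sup>2 / 2)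
    has_real_derivative frechet_derivative (energy A L \<psi>) (at (x, y)) (0, w)) (at 0)"
  using has_real_derivative_along_line[OF smooth_on_energy[OF assms(1-3)], of "(x, y)" 0 "(0, w)"] assms(4,5)
  by (simp add: slit_chart_translate[OF assms(1,3,4)] energy_def)

lemma finsler_outer_derivative:
  assumes "smooth_atlas A" "smooth_fun_on (slit_atlas A) (slit_tangent A) L" "(V, \<psi>) \<in> A"
    and "x \<in> V" "y \<noteq> 0"
  shows "((\<lambda>s. frechet_derivative (energy A L \<psi>) (at (x, y + s *\<^sub>R v)) (0, w))
    has_real_derivative fibre_hessian A L \<psi> (x, y) v w) (at 0)"
  using has_real_derivative_along_line[OF smooth_on_frechet_derivative[OF smooth_on_energy[OF assms(1-3)]],
      of "(x, y)" 0 "(0, v)" "(0, w)"] assms(4,5)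
  by (simp add: fibre_hessian_def)

text \<open>Serves twice: \<open>c = 1\<close> gives the coordinate form of the metric, and
  \<open>c = exp (2 * \<sigma> (\<psi> x))\<close> gives its conformal law, because the conformal
  factor is constant on each fibre.\<close>

lemma finsler_metric_scaled:
  assumes "smooth_atlas A" "smooth_fun_on (slit_atlas A) (slit_tangent A) L" "(V, \<psi>) \<in> A"
    and "x \<in> V" "y \<noteq> 0" "\<And>t. (L' (\<psi> x, t))\<^sup>2 = c * (L (\<psi> x, t))\<^sup>2"
  shows "finsler_metric L' (slit_chart A \<psi> (x, y)) (dir_deriv A \<psi> x v) (dir_deriv A \<psi> x w) =
    c * fibre_hessian A L \<psi> (x, y) v w"
proof -
  let ?d = "dir_deriv A \<psi> x"
  have "deriv (\<lambda>t. (L' (\<psi> x, tv_add (?d y) (tv_add (tv_scale s (?d v)) (tv_scale t (?d w)))))\<^sup>2 / 2) 0 =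
      c * frechet_derivative (energy A L \<psi>) (at (x, y + s *\<^sub>R v)) (0, w)"
    if "y + s *\<^sub>R v \<noteq> 0" for s
  proof -
    have "tv_add (?d y) (tv_add (tv_scale s (?d v)) (tv_scale t (?d w))) =
      tv_add (?d (y + s *\<^sub>R v)) (tv_scale t (?d w))" for t
      by (simp add: dir_deriv_add[OF assms(1,3,4)] dir_deriv_scale[OF assms(1,3,4)] tv_add_def add.assoc)
    then show ?thesis
      using DERIV_imp_deriv[OF DERIV_cmult[OF finsler_inner_derivative[OF assms(1-4) that], of c]]
      by (simp add: assms(6))
  qed
  then have "\<forall>\<^sub>F s in nhds 0.
      deriv (\<lambda>t. (L' (\<psi> x, tv_add (?d y) (tv_add (tv_scale s (?d v)) (tv_scale t (?d w)))))\<^sup>2 / 2) 0 =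
      c * frechet_derivative (energy A L \<psi>) (at (x, y + s *\<^sub>R v)) (0, w)"
    using eventually_translate_nonzero[OF assms(5), of v] by (auto elim: eventually_mono)
  from deriv_cong_ev[OF this] show ?thesis
    using DERIV_imp_deriv[OF DERIV_cmult[OF finsler_outer_derivative[OF assms(1-5)], of c]]
    by (simp add: finsler_metric_def slit_chart_apply)
qed

lemma finsler_metric_chart:
  assumes "smooth_atlas A" "smooth_fun_on (slit_atlas A) (slit_tangent A) L" "(V, \<psi>) \<in> A"
    and "x \<in> V" "y \<noteq> 0"
  shows "finsler_metric L (slit_chart A \<psi> (x, y)) (dir_deriv A \<psi> x v) (dir_deriv A \<psi> x w) =
    fibre_hessian A L \<psi> (x, y) v w"
  using finsler_metric_scaled[OF assms, of L 1] by simp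

lemma fibre_hessian_commute:
  fixes A :: "('e::euclidean_space, 'a) atlas"
  assumes "smooth_atlas A" "smooth_fun_on (slit_atlas A) (slit_tangent A) L" "(V, \<psi>) \<in> A"
    and "z \<in> V \<times> (- {0})"
  shows "fibre_hessian A L \<psi> z v w = fibre_hessian A L \<psi> z w v"
  unfolding fibre_hessian_def
  by (rule frechet_derivative_commute[OF open_slit[OF chart_open[OF assms(1,3)]] smooth_on_energy[OF assms(1-3)] assms(4)])

lemma fibre_hessian_linear:
  fixes A :: "('e::euclidean_space, 'a) atlas"
  assumes "smooth_atlas A" "smooth_fun_on (slit_atlas A) (slit_tangent A) L" "(V, \<psi>) \<in> A"
    and "z \<in> V \<times> (- {0})"
  shows fibre_hessian_linear_left: "linear (\<lambda>v. fibre_hessian A L \<psi> z v w)"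
    and fibre_hessian_linear_right: "linear (fibre_hessian A L \<psi> z v)"
proof -
  have l: "linear (\<lambda>v. fibre_hessian A L \<psi> z v w)" for w
  proof -
    have "linear (frechet_derivative (\<lambda>z. frechet_derivative (energy A L \<psi>) (at z) (0, w)) (at z))"
      by (rule has_derivative_linear[OF smooth_on_has_derivative[OF
          smooth_on_frechet_derivative[OF smooth_on_energy[OF assms(1-3)]] assms(4)]])
    from linear_compose[OF _ this, of "\<lambda>v. (0, v)"] show ?thesis
      by (simp add: fibre_hessian_def o_def linear_iff)
  qed
  then show "linear (\<lambda>v. fibre_hessian A L \<psi> z v w)" .
  show "linear (fibre_hessian A L \<psi> z v)"
    using l[of v] by (simp add: fibre_hessian_commute[OF assms, of _ v])
qed

lemma smooth_on_fibre_hessian: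
  fixes A :: "('e::euclidean_space, 'a) atlas"
  assumes "smooth_atlas A" "smooth_fun_on (slit_atlas A) (slit_tangent A) L" "(V, \<psi>) \<in> A"
  shows "smooth_on (\<lambda>z. fibre_hessian A L \<psi> z v w) (V \<times> (- {0}))"
  unfolding fibre_hessian_def
  by (intro smooth_on_frechet_derivative smooth_on_energy assms)

lemma tangent_fibreE:
  assumes "smooth_atlas A" "u \<in> slit_tangent A"
  obtains V \<psi> x y where "(V, \<psi>) \<in> A" "x \<in> V" "y \<noteq> 0" "u = slit_chart A \<psi> (x, y)"
    "\<And>v. v \<in> tangent_space A (fst u) \<Longrightarrow> \<exists>a. v = dir_deriv A \<psi> x a"
proof -
  obtain V \<psi> x y where V: "(V, \<psi>) \<in> A" "x \<in> V" "y \<noteq> 0" "u = slit_chart A \<psi> (x, y)"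
    using slit_tangentE[OF assms] .
  moreover have "\<exists>a. v = dir_deriv A \<psi> x a" if "v \<in> tangent_space A (fst u)" for v
    using that tangent_space_chart[OF assms(1) V(1,2)] by (auto simp: V(4) fst_slit_chart)
  ultimately show ?thesis using that by blast
qed

lemma finsler_metric_bilinear:
  assumes "smooth_atlas A" "smooth_fun_on (slit_atlas A) (slit_tangent A) L" "u \<in> slit_tangent A"
    and "v \<in> tangent_space A (fst u)" "w \<in> tangent_space A (fst u)"
  shows finsler_metric_commute: "finsler_metric L u v w = finsler_metric L u w v"
    and finsler_metric_scale: "finsler_metric L u (tv_scale c v) w = c * finsler_metric L u v w"
    and finsler_metric_add: "v' \<in> tangent_space A (fst u) \<Longrightarrow>
      finsler_metric L u (tv_add v v') w = finsler_metric L u v w + finsler_metric L u v' w"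
proof -
  obtain V \<psi> x y where V: "(V, \<psi>) \<in> A" "x \<in> V" "y \<noteq> 0" "u = slit_chart A \<psi> (x, y)"
    and t: "\<And>v. v \<in> tangent_space A (fst u) \<Longrightarrow> \<exists>a. v = dir_deriv A \<psi> x a"
    using tangent_fibreE[OF assms(1,3)] by metis
  have z: "(x, y) \<in> V \<times> (- {0})" using V by simp
  note l = fibre_hessian_linear_left[OF assms(1,2) V(1) z]
  note m = finsler_metric_chart[OF assms(1,2) V(1-3)]
  obtain a b where ab: "v = dir_deriv A \<psi> x a" "w = dir_deriv A \<psi> x b" using t assms(4,5) by metis
  show "finsler_metric L u v w = finsler_metric L u w v"
    unfolding ab V(4) m by (rule fibre_hessian_commute[OF assms(1,2) V(1) z])
  show "finsler_metric L u (tv_scale c v) w = c * finsler_metric L u v w"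
    unfolding ab V(4) m dir_deriv_scale[OF assms(1) V(1,2), symmetric] by (simp add: linear_scale[OF l])
  assume "v' \<in> tangent_space A (fst u)"
  then obtain a' where a': "v' = dir_deriv A \<psi> x a'" using t by metis
  show "finsler_metric L u (tv_add v v') w = finsler_metric L u v w + finsler_metric L u v' w"
    unfolding ab a' V(4) m dir_deriv_add[OF assms(1) V(1,2), symmetric] by (simp add: linear_add[OF l])
qed

lemma finsler_structure_smooth:
  "finsler_structure A L \<Longrightarrow> smooth_fun_on (slit_atlas A) (slit_tangent A) L"
  unfolding finsler_structure_def by blast

lemma finsler_metric_pos:
  assumes "finsler_structure A L" "u \<in> slit_tangent A" "v \<in> tangent_space A (fst u)" "v \<noteq> tv_zero"
  shows "finsler_metric L u v v > 0"
  using assms unfolding finsler_structure_def by blast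

lemma finsler_metric_nondegenerate:
  assumes "smooth_atlas A" "finsler_structure A L" "u \<in> slit_tangent A"
    and "v \<in> tangent_space A (fst u)" "w \<in> tangent_space A (fst u)"
    and "\<And>z. z \<in> tangent_space A (fst u) \<Longrightarrow> finsler_metric L u v z = finsler_metric L u w z"
  shows "v = w"
proof -
  let ?d = "tv_add v (tv_scale (- 1) w)"
  note b = finsler_metric_bilinear[OF assms(1) finsler_structure_smooth[OF assms(2)] assms(3)]
  have d: "?d \<in> tangent_space A (fst u)"
    by (intro tangent_space_add tangent_space_scale assms)
  have "finsler_metric L u ?d ?d = finsler_metric L u v ?d + finsler_metric L u (tv_scale (- 1) w) ?d"
    by (rule b(3)[OF assms(4) d tangent_space_scale[OF assms(1,5)]])
  also have "\<dots> = 0" using b(2)[OF assms(5) d] assms(6)[OF d] by simp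
  finally have "?d = tv_zero" using finsler_metric_pos[OF assms(2,3) d] by fastforce
  then show ?thesis by (auto simp: tv_add_def tv_scale_def tv_zero_def fun_eq_iff)
qed

lemma finsler_metric_smooth:
  fixes A :: "('e::euclidean_space, 'a) atlas"
  assumes "smooth_atlas A" "smooth_fun_on (slit_atlas A) (slit_tangent A) L"
    and "pi_vector_field A X" "pi_vector_field A Y" "u \<in> slit_tangent A"
  shows "smooth_near (slit_atlas A) u (\<lambda>w. finsler_metric L w (X w) (Y w))"
proof -
  obtain V \<psi> x y where V: "(V, \<psi>) \<in> A" "x \<in> V" "y \<noteq> 0" "u = slit_chart A \<psi> (x, y)"
    using slit_tangentE[OF assms(1,5)] .
  let ?S = "V \<times> (- {0 :: 'e})"
  have z: "(x, y) \<in> ?S" using V by simp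
  have S: "open ?S" by (rule open_slit[OF chart_open[OF assms(1) V(1)]])
  obtain \<xi> where \<xi>: "smooth_on \<xi> ?S" "\<And>z. z \<in> ?S \<Longrightarrow> X (slit_chart A \<psi> z) = dir_deriv A \<psi> (fst z) (\<xi> z)"
    using pi_vector_field_chart[OF assms(1,3) V(1)] by blast
  obtain \<zeta> where \<zeta>: "smooth_on \<zeta> ?S" "\<And>z. z \<in> ?S \<Longrightarrow> Y (slit_chart A \<psi> z) = dir_deriv A \<psi> (fst z) (\<zeta> z)"
    using pi_vector_field_chart[OF assms(1,4) V(1)] by blast
  have "smooth_on (\<lambda>z. \<Sum>b\<in>Basis. \<Sum>c\<in>Basis. (\<xi> z \<bullet> b) * ((\<zeta> z \<bullet> c) * fibre_hessian A L \<psi> z b c)) ?S"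
    by (intro smooth_on_sum smooth_on_mult smooth_on_inner smooth_on_const S \<xi>(1) \<zeta>(1)
        smooth_on_fibre_hessian assms V)
  moreover have "(\<Sum>b\<in>Basis. \<Sum>c\<in>Basis. (\<xi> z \<bullet> b) * ((\<zeta> z \<bullet> c) * fibre_hessian A L \<psi> z b c)) =
      finsler_metric L (slit_chart A \<psi> z) (X (slit_chart A \<psi> z)) (Y (slit_chart A \<psi> z))" if "z \<in> ?S" for z
  proof -
    have "finsler_metric L (slit_chart A \<psi> z) (X (slit_chart A \<psi> z)) (Y (slit_chart A \<psi> z)) =
        fibre_hessian A L \<psi> z (\<xi> z) (\<zeta> z)"
    proof -
      have "fst z \<in> V" "snd z \<noteq> 0" using that by auto
      from finsler_metric_chart[OF assms(1,2) V(1) this, of "\<xi> z" "\<zeta> z"]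
      show ?thesis unfolding \<xi>(2)[OF that] \<zeta>(2)[OF that] by simp
    qed
    also have "\<dots> = (\<Sum>b\<in>Basis. (\<xi> z \<bullet> b) * fibre_hessian A L \<psi> z b (\<zeta> z))"
      by (subst linear_expansion[OF fibre_hessian_linear_left[OF assms(1,2) V(1) that]]) simp
    also have "\<dots> = (\<Sum>b\<in>Basis. (\<xi> z \<bullet> b) * (\<Sum>c\<in>Basis. (\<zeta> z \<bullet> c) * fibre_hessian A L \<psi> z b c))"
    proof -
      have "fibre_hessian A L \<psi> z b (\<zeta> z) = (\<Sum>c\<in>Basis. (\<zeta> z \<bullet> c) * fibre_hessian A L \<psi> z b c)" for b
        by (subst linear_expansion[OF fibre_hessian_linear_right[OF assms(1,2) V(1) that]]) simp
      then show ?thesis by simp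
    qed
    finally show ?thesis by (simp add: sum_distrib_left)
  qed
  ultimately have "smooth_on (\<lambda>z. finsler_metric L (slit_chart A \<psi> z) (X (slit_chart A \<psi> z)) (Y (slit_chart A \<psi> z))) ?S"
    by (rule smooth_on_cong[OF S, rotated])
  with S z show ?thesis
    unfolding V(4) smooth_near_slit_chart[OF assms(1) V(1) z] by (intro exI[of _ ?S] conjI) auto
qed

lemma finsler_metric_conformal:
  assumes "smooth_atlas A" "smooth_fun_on (slit_atlas A) (slit_tangent A) L" "u \<in> slit_tangent A"
    and "v \<in> tangent_space A (fst u)" "w \<in> tangent_space A (fst u)"
  shows "finsler_metric (conformal_change \<sigma> L) u v w = exp (2 * \<sigma> (fst u)) * finsler_metric L u v w"
proof -
  obtain V \<psi> x y where V: "(V, \<psi>) \<in> A" "x \<in> V" "y \<noteq> 0" "u = slit_chart A \<psi> (x, y)"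
    and t: "\<And>v. v \<in> tangent_space A (fst u) \<Longrightarrow> \<exists>a. v = dir_deriv A \<psi> x a"
    using tangent_fibreE[OF assms(1,3)] by metis
  obtain a b where ab: "v = dir_deriv A \<psi> x a" "w = dir_deriv A \<psi> x b" using t assms(4,5) by metis
  have "(conformal_change \<sigma> L (\<psi> x, t))\<^sup>2 = exp (2 * \<sigma> (\<psi> x)) * (L (\<psi> x, t))\<^sup>2" for t
    by (simp add: conformal_change_def power_mult_distrib exp_double)
  from finsler_metric_scaled[OF assms(1,2) V(1-3) this] show ?thesis
    unfolding ab V(4) finsler_metric_chart[OF assms(1,2) V(1-3)] by (simp add: fst_slit_chart)
qed

text \<open>Euler's relation for the derivative of the energy, which is homogeneous of degree 1.\<close>

lemma finsler_metric_eta: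
  assumes "smooth_atlas A" "finsler_structure A L" "u \<in> slit_tangent A" "v \<in> tangent_space A (fst u)"
  shows "finsler_metric L u v (snd u) = deriv (\<lambda>t. (L (fst u, tv_add (snd u) (tv_scale t v)))\<^sup>2 / 2) 0"
proof -
  note sm = finsler_structure_smooth[OF assms(2)]
  obtain V \<psi> x y where V: "(V, \<psi>) \<in> A" "x \<in> V" "y \<noteq> 0" "u = slit_chart A \<psi> (x, y)"
    and t: "\<And>v. v \<in> tangent_space A (fst u) \<Longrightarrow> \<exists>a. v = dir_deriv A \<psi> x a"
    using tangent_fibreE[OF assms(1,3)] by metis
  obtain a where a: "v = dir_deriv A \<psi> x a" using t assms(4) by metis
  let ?D = "\<lambda>y. frechet_derivative (energy A L \<psi>) (at (x, y)) (0, a)"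
  have hom: "energy A L \<psi> (x, c *\<^sub>R y') = c\<^sup>2 * energy A L \<psi> (x, y')" if "c > 0" "y' \<noteq> 0" for c y'
  proof -
    have "slit_chart A \<psi> (x, y') \<in> slit_tangent A"
      using slit_chart_in_slit_tangent[OF assms(1) V(1)] V(2) that by auto
    then have "L (\<psi> x, tv_scale c (dir_deriv A \<psi> x y')) = c * L (\<psi> x, dir_deriv A \<psi> x y')"
      using assms(2) that unfolding finsler_structure_def slit_chart_apply by fastforce
    then show ?thesis
      by (simp add: energy_def slit_chart_apply dir_deriv_scale[OF assms(1) V(1,2)] power_mult_distrib)
  qed
  \<comment> \<open>Pulling \<open>c\<close> out of \<open>c *\<^sub>R y + t *\<^sub>R a\<close>
    costs a factor \<open>c\<^sup>2\<close> of the energy and rescales the parameter to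
    \<open>t / c\<close>, which leaves one factor \<open>c\<close> in the derivative.\<close>
  have D: "?D (c *\<^sub>R y) = c * ?D y" if c: "c > 0" for c
  proof -
    let ?E = "energy A L \<psi>"
    have line: "((\<lambda>t. ?E ((x, y') + t *\<^sub>R (0, a))) has_real_derivative ?D y') (at 0)" if "y' \<noteq> 0" for y'
      using has_real_derivative_along_line[OF smooth_on_energy[OF assms(1) sm V(1)], of "(x, y')" 0 "(0, a)"] V(2) that
      by simp
    have "((\<lambda>t. t / c) has_real_derivative 1 / c) (at 0)" by (rule DERIV_cdivide[OF DERIV_ident])
    from DERIV_cmult[OF DERIV_chain2[OF _ this, of "\<lambda>t. ?E ((x, y) + t *\<^sub>R (0, a))" "?D y"], of "c\<^sup>2"]
    have "((\<lambda>t. c\<^sup>2 * ?E ((x, y) + (t / c) *\<^sub>R (0, a))) has_real_derivative c\<^sup>2 * (?D y * (1 / c))) (at 0)"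
      using line[OF V(3)] by simp
    moreover have "\<forall>\<^sub>F t in nhds 0. c\<^sup>2 * ?E ((x, y) + (t / c) *\<^sub>R (0, a)) = ?E ((x, c *\<^sub>R y) + t *\<^sub>R (0, a))"
      using eventually_translate_nonzero[OF V(3), of "a /\<^sub>R c"]
    proof (rule eventually_mono)
      fix t assume "y + t *\<^sub>R (a /\<^sub>R c) \<noteq> 0"
      from hom[OF c this] c show "c\<^sup>2 * ?E ((x, y) + (t / c) *\<^sub>R (0, a)) = ?E ((x, c *\<^sub>R y) + t *\<^sub>R (0, a))"
        by (simp add: scaleR_add_right divide_inverse mult.left_commute[of c])
    qed
    ultimately have "((\<lambda>t. ?E ((x, c *\<^sub>R y) + t *\<^sub>R (0, a))) has_real_derivative c\<^sup>2 * (?D y * (1 / c))) (at 0)"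
      by (rule iffD1[OF DERIV_cong_ev[OF refl _ refl], rotated])
    moreover have "c *\<^sub>R y \<noteq> 0" using less_imp_neq[OF c] V(3) by simp
    ultimately have "?D (c *\<^sub>R y) = c\<^sup>2 * (?D y * (1 / c))"
      using DERIV_unique[OF line] by blast
    then show ?thesis using less_imp_neq[OF c] by (simp add: power2_eq_square)
  qed
  have "((\<lambda>s. ?D (y + s *\<^sub>R y)) has_real_derivative fibre_hessian A L \<psi> (x, y) y a) (at 0)"
    by (rule finsler_outer_derivative[OF assms(1) sm V(1-3)])
  \<comment> \<open>By the homogeneity just shown, \<open>?D\<close> is linear along the ray through
    \<open>y\<close>; the bound \<open>s > - 1\<close> keeps the factor \<open>1 + s\<close>
    positive.\<close>
  moreover have "((\<lambda>s. ?D (y + s *\<^sub>R y)) has_real_derivative ?D y) (at 0)"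
  proof -
    have 1: "((\<lambda>s. (1 + s) * ?D y) has_real_derivative ?D y) (at 0)"
      by (auto intro!: derivative_eq_intros)
    have 2: "(1 + s) * ?D y = ?D (y + s *\<^sub>R y)" if "s > - 1" for s
      using D[of "1 + s"] that by (simp add: scaleR_add_left)
    show ?thesis
      by (rule has_field_derivative_transform_within_open[OF 1, of "{- 1<..}"]) (auto intro: 2)
  qed
  ultimately have "fibre_hessian A L \<psi> (x, y) y a = ?D y" by (rule DERIV_unique)
  then have "finsler_metric L u v (snd u) = ?D y"
    unfolding a V(4) slit_chart_apply snd_conv
    using finsler_metric_chart[OF assms(1) sm V(1-3), of a y] fibre_hessian_commute[OF assms(1) sm V(1), of "(x, y)" a y] V(2,3)
    by (simp add: slit_chart_apply)
  also have "?D y = deriv (\<lambda>t. (L (fst u, tv_add (snd u) (tv_scale t v)))\<^sup>2 / 2) 0"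
    using DERIV_imp_deriv[OF finsler_inner_derivative[OF assms(1) sm V(1-3), of a]]
    by (simp add: a V(4) slit_chart_apply)
  finally show ?thesis .
qed

text \<open>By Euler's relation the differentiated function is the first fibre derivative of the
  energy along \<open>Y\<close>, so one more derivative along \<open>n\<close> gives the Hessian. In
  classical terms, the Cartan tensor vanishes when \<open>eta\<close> is inserted.\<close>

lemma vgamma_finsler_metric_eta:
  assumes "smooth_atlas A" "finsler_structure A L" "u \<in> slit_tangent A"
    and "n \<in> tangent_space A (fst u)" "pi_vector_field A (\<lambda>w. Y (fst w))"
  shows "vgamma A u n (\<lambda>w. finsler_metric L w (Y (fst w)) (eta w)) = finsler_metric L u n (Y (fst u))"
proof -
  note sm = finsler_structure_smooth[OF assms(2)]
  obtain V \<psi> x y where V: "(V, \<psi>) \<in> A" "x \<in> V" "y \<noteq> 0" "u = slit_chart A \<psi> (x, y)"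
    and t: "\<And>v. v \<in> tangent_space A (fst u) \<Longrightarrow> \<exists>a. v = dir_deriv A \<psi> x a"
    using tangent_fibreE[OF assms(1,3)] by metis
  obtain b where b: "n = dir_deriv A \<psi> x b" using t assms(4) by metis
  let ?F = "\<lambda>w. finsler_metric L w (Y (fst w)) (eta w)"
  have "smooth_near (slit_atlas A) u ?F"
    using finsler_metric_smooth[OF assms(1) sm assms(5) pi_vector_field_eta[OF assms(1)] assms(3)] .
  then have "vgamma A u n ?F = deriv (\<lambda>s. ?F (fst u, tv_add (snd u) (tv_scale s n))) 0"
    by (simp add: vgamma_def)
  also have "\<dots> = finsler_metric L u n (Y (fst u))"
    unfolding finsler_metric_def[of L u]
  proof (rule deriv_cong_ev)
    show "\<forall>\<^sub>F s in nhds 0. ?F (fst u, tv_add (snd u) (tv_scale s n)) =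
      deriv (\<lambda>t. (L (fst u, tv_add (snd u) (tv_add (tv_scale s n) (tv_scale t (Y (fst u))))))\<^sup>2 / 2) 0"
      using eventually_translate_nonzero[OF V(3), of b]
    proof (rule eventually_mono)
      fix s assume s: "y + s *\<^sub>R b \<noteq> 0"
      let ?w = "(fst u, tv_add (snd u) (tv_scale s n))"
      have w: "?w = slit_chart A \<psi> (x, y + s *\<^sub>R b)"
        using slit_chart_translate[OF assms(1) V(1,2), of y s b] by (simp add: V(4) b slit_chart_apply)
      have ws: "?w \<in> slit_tangent A"
        unfolding w using slit_chart_in_slit_tangent[OF assms(1) V(1)] V(2) s by auto
      have "Y (fst u) \<in> tangent_space A (fst ?w)"
        using pi_vector_field_tangent[OF assms(5,3)] by simp
      from finsler_metric_eta[OF assms(1,2) ws this]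
      show "?F ?w = deriv (\<lambda>t. (L (fst u, tv_add (snd u) (tv_add (tv_scale s n) (tv_scale t (Y (fst u))))))\<^sup>2 / 2) 0"
        by (simp add: eta_def tv_add_def add.assoc)
    qed
  qed simp
  finally show ?thesis .
qed

text \<open>The metric depends on the direction \<open>u\<close>, so even the gradient of a function
  on the base is in general a field on the pullback bundle only.\<close>

lemma finsler_gradient:
  fixes A :: "('e::euclidean_space, 'a) atlas"
  assumes "smooth_atlas A" "finsler_structure A L" "smooth_fun_on A (atlas_carrier A) f"
  obtains X where "pi_vector_field A X"
    "\<And>u v. u \<in> slit_tangent A \<Longrightarrow> v \<in> tangent_space A (fst u) \<Longrightarrow> finsler_metric L u (X u) v = v f"
proof -
  note sm = finsler_structure_smooth[OF assms(2)]
  let ?P = "\<lambda>u v. v \<in> tangent_space A (fst u) \<and> (\<forall>w\<in>tangent_space A (fst u). finsler_metric L u v w = w f)"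
  \<comment> \<open>Chosen point by point; nondegeneracy identifies the choice with the smooth local
    solutions, which replaces a gluing argument.\<close>
  define X where "X u = (SOME v. ?P u v)" for u
  have unique: "X u = v" if "?P u v" "u \<in> slit_tangent A" for u v
  proof -
    have "?P u (X u)" unfolding X_def by (rule someI[where P = "?P u"], rule that(1))
    with that show ?thesis by (intro finsler_metric_nondegenerate[OF assms(1,2)]) auto
  qed
  have local: "\<exists>\<xi>. smooth_on \<xi> (V \<times> (- {0})) \<and> (\<forall>z\<in>V \<times> (- {0}). ?P (slit_chart A \<psi> z) (dir_deriv A \<psi> (fst z) (\<xi> z)))"
    if V: "(V, \<psi>) \<in> A" for V \<psi>
  proof -
    let ?S = "V \<times> (- {0 :: 'e})" and ?H = "fibre_hessian A L \<psi>"
    have S: "open ?S" by (rule open_slit[OF chart_open[OF assms(1) V]])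
    have f: "smooth_on (\<lambda>x. f (\<psi> x)) V"
      using assms(3) V carrierI[OF V] unfolding smooth_fun_on_def
      by (auto simp: o_def elim!: smooth_on_subset)
    let ?c = "\<lambda>j z. frechet_derivative (\<lambda>x. f (\<psi> x)) (at (fst z)) j"
    \<comment> \<open>The components of the gradient solve a linear system with the fibre Hessian as
      matrix and the partial derivatives of \<open>f\<close> on the right; positive definiteness
      makes \<open>smooth_solution\<close> applicable.\<close>
    have "\<exists>h. (\<forall>i\<in>Basis. smooth_on (h i) ?S) \<and>
        (\<forall>z\<in>?S. \<forall>j\<in>Basis. (\<Sum>i\<in>Basis. h i z * ?H z i j) = ?c j z)"
    proof (rule smooth_solution[OF finite_Basis S, of "\<lambda>i j z. ?H z i j"])
      show "smooth_on (\<lambda>z. ?H z i j) ?S" for i j by (rule smooth_on_fibre_hessian[OF assms(1) sm V])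
      show "smooth_on (?c j) ?S" for j
        by (rule smooth_on_frechet_derivative'[OF chart_open[OF assms(1) V] f S])
          (auto intro: smooth_on_fst S smooth_on_const)
      fix z and h :: "'e \<Rightarrow> real" assume z: "z \<in> ?S" and h: "\<exists>i\<in>Basis. h i \<noteq> 0"
      have zz: "fst z \<in> V" "snd z \<noteq> 0" using z by auto
      let ?v = "\<Sum>i\<in>Basis. h i *\<^sub>R i"
      have "?v \<noteq> 0"
        using h by (auto simp: euclidean_eq_iff[of ?v] inner_sum_left inner_Basis if_distrib cong: if_cong)
      then have "dir_deriv A \<psi> (fst z) ?v \<noteq> tv_zero"
        using dir_deriv_eq_zero_iff[OF assms(1) V zz(1)] by blast
      then have "0 < finsler_metric L (slit_chart A \<psi> z) (dir_deriv A \<psi> (fst z) ?v) (dir_deriv A \<psi> (fst z) ?v)"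
        using tangent_space_chart[OF assms(1) V zz(1)]
        by (intro finsler_metric_pos[OF assms(2) slit_chart_in_slit_tangent[OF assms(1) V z]])
          (auto simp: fst_slit_chart)
      also have "\<dots> = ?H z ?v ?v"
        using finsler_metric_chart[OF assms(1) sm V zz, of ?v ?v] by simp
      also have "\<dots> = (\<Sum>i\<in>Basis. \<Sum>j\<in>Basis. h i * h j * ?H z i j)"
      proof -
        note l = fibre_hessian_linear_left[OF assms(1) sm V z]
        note r = fibre_hessian_linear_right[OF assms(1) sm V z]
        have 1: "?H z ?v w = (\<Sum>i\<in>Basis. h i * ?H z i w)" for w
          by (simp add: linear_sum[OF l] linear_scale[OF l])
        have 2: "?H z v ?v = (\<Sum>j\<in>Basis. h j * ?H z v j)" for v
          by (simp add: linear_sum[OF r] linear_scale[OF r])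
        show ?thesis by (subst 1) (simp add: 2 sum_distrib_left mult.assoc)
      qed
      finally show "0 < (\<Sum>i\<in>Basis. \<Sum>j\<in>Basis. h i * h j * ?H z i j)" .
    qed
    then obtain h where h: "\<And>i. i \<in> Basis \<Longrightarrow> smooth_on (h i) ?S"
        "\<And>z j. z \<in> ?S \<Longrightarrow> j \<in> Basis \<Longrightarrow> (\<Sum>i\<in>Basis. h i z * ?H z i j) = ?c j z" by blast
    let ?\<xi> = "\<lambda>z. \<Sum>i\<in>Basis. h i z *\<^sub>R i"
    have "smooth_on ?\<xi> ?S" by (intro smooth_on_sum smooth_on_scaleR smooth_on_const S h(1))
    moreover have "?P (slit_chart A \<psi> z) (dir_deriv A \<psi> (fst z) (?\<xi> z))" if z: "z \<in> ?S" for z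
    proof (intro conjI ballI)
      have zz: "fst z \<in> V" "snd z \<noteq> 0" using z by auto
      show "dir_deriv A \<psi> (fst z) (?\<xi> z) \<in> tangent_space A (fst (slit_chart A \<psi> z))"
        using tangent_space_chart[OF assms(1) V zz(1)] by (simp add: fst_slit_chart)
      fix w assume "w \<in> tangent_space A (fst (slit_chart A \<psi> z))"
      then obtain b where b: "w = dir_deriv A \<psi> (fst z) b"
        using tangent_space_chart[OF assms(1) V zz(1)] by (auto simp: fst_slit_chart)
      have near: "smooth_near A (\<psi> (fst z)) f"
        using assms(3) carrierI[OF V zz(1)] unfolding smooth_near_def by blast
      have lin: "linear (frechet_derivative (\<lambda>x. f (\<psi> x)) (at (fst z)))"
        using has_derivative_linear[OF smooth_near_chartD[OF assms(1) V zz(1) near]] by (simp add: o_def)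
      have "finsler_metric L (slit_chart A \<psi> z) (dir_deriv A \<psi> (fst z) (?\<xi> z)) w = ?H z (?\<xi> z) b"
        unfolding b using finsler_metric_chart[OF assms(1) sm V zz, of "?\<xi> z" b] by simp
      also have "\<dots> = (\<Sum>j\<in>Basis. (b \<bullet> j) * ?H z (?\<xi> z) j)"
        by (subst linear_expansion[OF fibre_hessian_linear_right[OF assms(1) sm V z]]) simp
      also have "\<dots> = (\<Sum>j\<in>Basis. (b \<bullet> j) * ?c j z)"
      proof (rule sum.cong[OF refl])
        fix j :: 'e assume j: "j \<in> Basis"
        note l = fibre_hessian_linear_left[OF assms(1) sm V z, of j]
        have "?H z (?\<xi> z) j = (\<Sum>i\<in>Basis. h i z * ?H z i j)"
          by (simp add: linear_sum[OF l] linear_scale[OF l])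
        then show "(b \<bullet> j) * ?H z (?\<xi> z) j = (b \<bullet> j) * ?c j z" using h(2)[OF z j] by simp
      qed
      also have "\<dots> = frechet_derivative (\<lambda>x. f (\<psi> x)) (at (fst z)) b"
        by (subst linear_expansion[OF lin, of b]) simp
      also have "\<dots> = w f" using near by (simp add: b dir_deriv_def o_def)
      finally show "finsler_metric L (slit_chart A \<psi> z) (dir_deriv A \<psi> (fst z) (?\<xi> z)) w = w f" .
    qed
    ultimately show ?thesis by blast
  qed
  show ?thesis
  proof (rule that)
    show "pi_vector_field A X"
    proof (rule pi_vector_fieldI[OF assms(1)])
      fix V \<psi> z assume V: "(V, \<psi>) \<in> A" and z: "z \<in> V \<times> (- {0 :: 'e})"
      obtain \<xi> where \<xi>: "smooth_on \<xi> (V \<times> (- {0}))"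
          "\<And>z. z \<in> V \<times> (- {0}) \<Longrightarrow> ?P (slit_chart A \<psi> z) (dir_deriv A \<psi> (fst z) (\<xi> z))"
        using local[OF V] by blast
      show "\<exists>W \<xi>. open W \<and> z \<in> W \<and> W \<subseteq> V \<times> (- {0}) \<and>
          smooth_on \<xi> W \<and> (\<forall>z\<in>W. X (slit_chart A \<psi> z) = dir_deriv A \<psi> (fst z) (\<xi> z))"
        using z \<xi>(1) unique[OF \<xi>(2) slit_chart_in_slit_tangent[OF assms(1) V]]
        by (intro exI[of _ "V \<times> (- {0})"] exI[of _ \<xi>]) (auto intro!: open_slit chart_open[OF assms(1) V])
    qed
    fix u v assume u: "u \<in> slit_tangent A" and v: "v \<in> tangent_space A (fst u)"
    obtain V \<psi> x y where V: "(V, \<psi>) \<in> A" "x \<in> V" "y \<noteq> 0" "u = slit_chart A \<psi> (x, y)"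
      using slit_tangentE[OF assms(1) u] .
    have z: "(x, y) \<in> V \<times> (- {0})" using V by simp
    obtain a where "?P u a" using local[OF V(1)] z V(4) by blast
    with unique[OF this u] v show "finsler_metric L u (X u) v = v f" by blast
  qed
qed

section \<open>Closed fields under non-constant conformal changes\<close>

lemma tv_scale_one: "tv_scale 1 a = a"
  and tv_scale_zero: "tv_scale 0 a = tv_zero"
  and tv_add_zero: "tv_add a tv_zero = a"
  and tv_diff_zero: "tv_diff a tv_zero = a"
  and tv_diff_eq: "tv_diff a b = tv_add a (tv_scale (- 1) b)"
  and tv_diff_eq_zero: "tv_diff a b = tv_zero \<longleftrightarrow> a = b"
  by (auto simp: tv_add_def tv_scale_def tv_zero_def tv_diff_def fun_eq_iff)

lemma rho_linear:
  shows rho_add: "rho (tv_add \<xi> \<zeta>) = tv_add (rho \<xi>) (rho \<zeta>)"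
    and rho_scale: "rho (tv_scale c \<xi>) = tv_scale c (rho \<xi>)"
  by (auto simp: rho_def tv_add_def tv_scale_def tv_zero_def)

lemma tangent_space_diff:
  assumes "smooth_atlas A" "\<xi> \<in> tangent_space A p" "\<zeta> \<in> tangent_space A p"
  shows "tv_diff \<xi> \<zeta> \<in> tangent_space A p"
  unfolding tv_diff_eq by (intro tangent_space_add tangent_space_scale assms)

lemma finsler_metric_diff:
  assumes "smooth_atlas A" "smooth_fun_on (slit_atlas A) (slit_tangent A) L" "u \<in> slit_tangent A"
    and "v \<in> tangent_space A (fst u)" "v' \<in> tangent_space A (fst u)" "w \<in> tangent_space A (fst u)"
  shows "finsler_metric L u (tv_diff v v') w = finsler_metric L u v w - finsler_metric L u v' w"
  unfolding tv_diff_eq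
  using finsler_metric_add[OF assms(1-4,6) tangent_space_scale[OF assms(1,5)]] finsler_metric_scale[OF assms(1-3,5,6)]
  by simp

lemma finsler_metric_zero:
  assumes "smooth_atlas A" "smooth_fun_on (slit_atlas A) (slit_tangent A) L" "u \<in> slit_tangent A"
    and "w \<in> tangent_space A (fst u)"
  shows "finsler_metric L u tv_zero w = 0"
  using finsler_metric_scale[OF assms(1-4,4), of 0] by (simp add: tv_scale_zero)

lemma eta_tangent: "u \<in> slit_tangent A \<Longrightarrow> snd u \<in> tangent_space A (fst u)"
  by (auto simp: slit_tangent_def)

section \<open>Linear connections and their horizontal lifts\<close>

lemma rho_surjective:
  assumes "smooth_atlas A" "u \<in> slit_tangent A" "v \<in> tangent_space A (fst u)"
  obtains \<xi> where "\<xi> \<in> tangent_space (slit_atlas A) u" "rho \<xi> = v"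
proof -
  obtain V \<psi> x y where V: "(V, \<psi>) \<in> A" "x \<in> V" "y \<noteq> 0" "u = slit_chart A \<psi> (x, y)"
    and t: "\<And>v. v \<in> tangent_space A (fst u) \<Longrightarrow> \<exists>a. v = dir_deriv A \<psi> x a"
    using tangent_fibreE[OF assms(1,2)] by metis
  obtain a where a: "v = dir_deriv A \<psi> x a" using t assms(3) by metis
  have z: "(x, y) \<in> V \<times> (- {0})" using V by simp
  show ?thesis
  proof (rule that)
    show "dir_deriv (slit_atlas A) (slit_chart A \<psi>) (x, y) (a, 0) \<in> tangent_space (slit_atlas A) u"
      using tangent_space_chart[OF smooth_atlas_slit[OF assms(1)] slit_atlas_chart[OF V(1)] z] V(4) by simp
    show "rho (dir_deriv (slit_atlas A) (slit_chart A \<psi>) (x, y) (a, 0)) = v"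
      using rho_dir_deriv[OF assms(1) V(1-3)] a by simp
  qed
qed

text \<open>The axiom yields a pi-vector field only for derivatives along a field, so the vector
  \<xi> is first extended to a field on the slit bundle.\<close>

lemma connection_tangent:
  assumes "smooth_atlas A" "Hausdorff_space (atlas_topology A)" "linear_connection A D"
    and "u \<in> slit_tangent A" "\<xi> \<in> tangent_space (slit_atlas A) u" "pi_vector_field A Y"
  shows "D u \<xi> Y \<in> tangent_space A (fst u)"
proof -
  obtain X where X: "vector_field (slit_atlas A) X" "X u = \<xi>"
    using slit_vector_field_extension[OF assms(1,2,5)] .
  have "\<forall>X Y. vector_field (slit_atlas A) X \<and> pi_vector_field A Y \<longrightarrow>
        pi_vector_field A (\<lambda>u. D u (X u) Y)"
    using assms(3) unfolding linear_connection_def by (elim conjE)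
  from this[rule_format, of X Y] X(1) assms(6) have "pi_vector_field A (\<lambda>u. D u (X u) Y)" by metis
  from pi_vector_field_tangent[OF this assms(4)] X(2) show ?thesis by simp
qed

lemma connection_cong:
  assumes "linear_connection A D" "u \<in> slit_tangent A" "\<xi> \<in> tangent_space (slit_atlas A) u"
    and "pi_vector_field A Y" "pi_vector_field A Z" "\<And>w. w \<in> slit_tangent A \<Longrightarrow> Y w = Z w"
  shows "D u \<xi> Y = D u \<xi> Z"
proof -
  have "\<forall>u\<in>slit_tangent A. \<forall>\<xi>\<in>tangent_space (slit_atlas A) u. \<forall>Y Z.
        pi_vector_field A Y \<and> pi_vector_field A Z \<and> (\<forall>w\<in>slit_tangent A. Y w = Z w) \<longrightarrow>
        D u \<xi> Y = D u \<xi> Z"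
    using assms(1) unfolding linear_connection_def by (elim conjE)
  from this[rule_format, OF assms(2,3), of Y Z] assms(4-6) show ?thesis by metis
qed

lemma connection_linear:
  assumes "linear_connection A D" "u \<in> slit_tangent A" "\<xi> \<in> tangent_space (slit_atlas A) u"
    and "\<zeta> \<in> tangent_space (slit_atlas A) u" "pi_vector_field A Y"
  shows "D u (tv_add (tv_scale a \<xi>) (tv_scale b \<zeta>)) Y = tv_add (tv_scale a (D u \<xi> Y)) (tv_scale b (D u \<zeta> Y))"
proof -
  have "\<forall>u\<in>slit_tangent A. \<forall>\<xi>\<in>tangent_space (slit_atlas A) u. \<forall>\<zeta>\<in>tangent_space (slit_atlas A) u.
        \<forall>a b Y. pi_vector_field A Y \<longrightarrow>
        D u (tv_add (tv_scale a \<xi>) (tv_scale b \<zeta>)) Y =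
        tv_add (tv_scale a (D u \<xi> Y)) (tv_scale b (D u \<zeta> Y))"
    using assms(1) unfolding linear_connection_def by (elim conjE)
  from this[rule_format, OF assms(2-5)] show ?thesis .
qed

lemma connection_add:
  assumes "linear_connection A D" "u \<in> slit_tangent A" "\<xi> \<in> tangent_space (slit_atlas A) u"
    and "\<zeta> \<in> tangent_space (slit_atlas A) u" "pi_vector_field A Y"
  shows "D u (tv_add \<xi> \<zeta>) Y = tv_add (D u \<xi> Y) (D u \<zeta> Y)"
  using connection_linear[OF assms, of 1 1] by (simp add: tv_scale_one)

lemma connection_zero:
  assumes "linear_connection A D" "u \<in> slit_tangent A" "\<xi> \<in> tangent_space (slit_atlas A) u" "pi_vector_field A Y"
  shows "D u tv_zero Y = tv_zero"
  using connection_linear[OF assms(1-3,3,4), of 0 0] by (simp add: tv_scale_zero tv_add_zero)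

lemma connection_zero_field:
  assumes "smooth_atlas A" "linear_connection A D" "u \<in> slit_tangent A" "\<xi> \<in> tangent_space (slit_atlas A) u"
  shows "D u \<xi> (\<lambda>w. tv_zero) = tv_zero"
proof -
  have "\<forall>u\<in>slit_tangent A. \<forall>\<xi>\<in>tangent_space (slit_atlas A) u. \<forall>Y Z.
        pi_vector_field A Y \<and> pi_vector_field A Z \<longrightarrow>
        D u \<xi> (\<lambda>w. tv_add (Y w) (Z w)) = tv_add (D u \<xi> Y) (D u \<xi> Z)"
    using assms(2) unfolding linear_connection_def by (elim conjE)
  from this[rule_format, OF assms(3,4), of "\<lambda>w. tv_zero" "\<lambda>w. tv_zero"] pi_vector_field_zero[OF assms(1)]
  have "D u \<xi> (\<lambda>w. tv_add tv_zero tv_zero) = tv_add (D u \<xi> (\<lambda>w. tv_zero)) (D u \<xi> (\<lambda>w. tv_zero))"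
    by metis
  then show ?thesis by (simp add: tv_add_def tv_zero_def fun_eq_iff)
qed

lemma regular_connection_linear: "regular_connection A D \<Longrightarrow> linear_connection A D"
  unfolding regular_connection_def by blast

lemma hbeta:
  assumes "smooth_atlas A" "regular_connection A D" "u \<in> slit_tangent A" "v \<in> tangent_space A (fst u)"
  shows hbeta_horizontal: "hbeta A D u v \<in> horizontal_space A D u"
    and rho_hbeta: "rho (hbeta A D u v) = v"
proof -
  obtain \<xi> where \<xi>: "\<xi> \<in> tangent_space (slit_atlas A) u" "rho \<xi> = v"
    using rho_surjective[OF assms(1,3,4)] .
  \<comment> \<open>The horizontal part of any preimage of \<open>v\<close> is again a preimage,
    because \<open>rho\<close> kills the vertical part.\<close>
  then obtain \<nu> \<mu> where \<mu>: "\<nu> \<in> vertical_space A u" "\<mu> \<in> horizontal_space A D u" "\<xi> = tv_add \<nu> \<mu>"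
    using assms(2,3) unfolding regular_connection_def by blast
  have "v = rho (tv_add \<nu> \<mu>)" using \<xi>(2) \<mu>(3) by simp
  also have "\<dots> = tv_add (rho \<nu>) (rho \<mu>)" by (rule rho_add)
  also have "\<dots> = rho \<mu>" using \<mu>(1) by (simp add: vertical_space_def tv_add_def tv_zero_def)
  finally have "v \<in> rho ` horizontal_space A D u" using \<mu>(2) by blast
  then show "hbeta A D u v \<in> horizontal_space A D u" "rho (hbeta A D u v) = v"
    unfolding hbeta_def by (auto simp: inv_into_into f_inv_into_f)
qed

lemma hbeta_tangent:
  assumes "smooth_atlas A" "regular_connection A D" "u \<in> slit_tangent A" "v \<in> tangent_space A (fst u)"
  shows "hbeta A D u v \<in> tangent_space (slit_atlas A) u"
  using hbeta_horizontal[OF assms] by (auto simp: horizontal_space_def)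

text \<open>On a function from the base the bracket sees the inner fields only through
  \<open>rho\<close>; for horizontal lifts it thus reduces to derivatives of the fields that are
  lifted.\<close>

lemma rho_lie_bracket:
  assumes "smooth_atlas A" "u \<in> slit_tangent A"
  shows "rho (lie_bracket (slit_atlas A) P R u) f =
    (if smooth_near A (fst u) f then P u (\<lambda>q. rho (R q) f) - R u (\<lambda>q. rho (P q) f) else 0)"
  using smooth_near_fst_iff[OF assms, of f] by (simp add: rho_def lie_bracket_def o_def)

lemma cartan_connectionD:
  assumes "cartan_connection A L D"
  shows cartan_regular: "regular_connection A D"
    and cartan_metric: "metric_connection A L D"
    and cartan_linear: "linear_connection A D"
  using assms unfolding cartan_connection_def regular_connection_def by auto

text \<open>Vanishing horizontal torsion turns the projected bracket into a difference of covariant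
  derivatives, hence into a tangent vector. Its action on functions is a commutator in which the
  lifts occur at \<open>u\<close> only.\<close>

lemma cartan_bracket:
  assumes "smooth_atlas A" "Hausdorff_space (atlas_topology A)" "cartan_connection A L D"
    and "pi_vector_field A Y" "pi_vector_field A Z" "u \<in> slit_tangent A"
  defines "R \<equiv> rho (lie_bracket (slit_atlas A) (\<lambda>w. hbeta A D w (Y w)) (\<lambda>w. hbeta A D w (Z w)) u)"
  shows cartan_bracket_eq: "R = tv_diff (D u (hbeta A D u (Y u)) Z) (D u (hbeta A D u (Z u)) Y)"
    and cartan_bracket_tangent: "R \<in> tangent_space A (fst u)"
    and cartan_bracket_apply: "smooth_near A (fst u) f \<Longrightarrow>
      R f = hbeta A D u (Y u) (\<lambda>w. Z w f) - hbeta A D u (Z u) (\<lambda>w. Y w f)"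
proof -
  note reg = cartan_regular[OF assms(3)] and lin = cartan_linear[OF assms(3)]
  note B = smooth_atlas_slit[OF assms(1)]
  have eq: "rho (hbeta A D w (X w)) = X w" if "pi_vector_field A X" "w \<in> slit_tangent A" for X w
    by (rule rho_hbeta[OF assms(1) reg that(2) pi_vector_field_tangent[OF that]])
  have pi: "pi_vector_field A (\<lambda>w. rho (hbeta A D w (X w)))" if "pi_vector_field A X" for X
    by (rule pi_vector_field_cong[OF assms(1) that]) (simp add: eq[OF that])
  have t: "hbeta A D u (X u) \<in> tangent_space (slit_atlas A) u" if "pi_vector_field A X" for X
    by (rule hbeta_tangent[OF assms(1) reg assms(6) pi_vector_field_tangent[OF that assms(6)]])
  have D: "D u \<xi> (\<lambda>w. rho (hbeta A D w (X w))) = D u \<xi> X"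
    if "\<xi> \<in> tangent_space (slit_atlas A) u" "pi_vector_field A X" for \<xi> X
    by (rule connection_cong[OF lin assms(6) that(1) pi[OF that(2)] that(2)]) (simp add: eq[OF that(2)])
  have "hh_torsion A D Y Z u = tv_zero"
    using assms(3-6) unfolding cartan_connection_def by blast
  then show 1: "R = tv_diff (D u (hbeta A D u (Y u)) Z) (D u (hbeta A D u (Z u)) Y)"
    unfolding hh_torsion_def torsion_def R_def D[OF t[OF assms(4)] assms(5)] D[OF t[OF assms(5)] assms(4)]
    by (simp add: tv_diff_eq_zero)
  show "R \<in> tangent_space A (fst u)"
    unfolding 1
    by (intro tangent_space_diff connection_tangent[OF assms(1,2) lin assms(6)] t assms)
  assume f: "smooth_near A (fst u) f"
  have "hbeta A D u (X u) (\<lambda>w. rho (hbeta A D w (X' w)) f) = hbeta A D u (X u) (\<lambda>w. X' w f)"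
    if "pi_vector_field A X" "pi_vector_field A X'" for X X'
    by (rule tangent_cong_carrier[OF B t[OF that(1)]])
      (simp add: eq[OF that(2)] carrier_slit_atlas[OF assms(1)])
  then show "R f = hbeta A D u (Y u) (\<lambda>w. Z w f) - hbeta A D u (Z u) (\<lambda>w. Y w f)"
    using f assms(4,5) unfolding R_def rho_lie_bracket[OF assms(1,6)] by simp
qed

text \<open>The terms \<open>hbeta A D u (Y u) (\<lambda>w. Z w f)\<close> cancel against the
  bracket, and a lift acts on the pullback of \<tau> as the lifted vector acts on \<tau>; no trace
  of \<open>D\<close> remains. Used for \<open>\<tau> = 0\<close> and for twice \<sigma>.\<close>

lemma dbar_weighted_differential:
  assumes "smooth_atlas A" "Hausdorff_space (atlas_topology A)" "cartan_connection A L D"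
    and "smooth_fun_on A (atlas_carrier A) \<tau>" "smooth_fun_on A (atlas_carrier A) f"
    and "\<And>w v. w \<in> slit_tangent A \<Longrightarrow> v \<in> tangent_space A (fst w) \<Longrightarrow> \<omega> w v = exp (\<tau> (fst w)) * v f"
    and "pi_vector_field A Y" "pi_vector_field A Z" "u \<in> slit_tangent A"
  shows "dbar A D \<omega> Y Z u = exp (\<tau> (fst u)) * (Y u \<tau> * Z u f - Z u \<tau> * Y u f)"
proof -
  note reg = cartan_regular[OF assms(3)]
  note B = smooth_atlas_slit[OF assms(1)]
  have near: "smooth_near A (fst w) h"
    if "smooth_fun_on A (atlas_carrier A) h" "w \<in> slit_tangent A" for h w
    using that unfolding smooth_near_def slit_tangent_def by auto
  have t: "hbeta A D u (X u) \<in> tangent_space (slit_atlas A) u" if "pi_vector_field A X" for X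
    by (rule hbeta_tangent[OF assms(1) reg assms(9) pi_vector_field_tangent[OF that assms(9)]])
  have "hbeta A D u (X u) (\<lambda>w. \<omega> w (X' w)) =
      exp (\<tau> (fst u)) * (X u \<tau> * X' u f + hbeta A D u (X u) (\<lambda>w. X' w f))"
    if X: "pi_vector_field A X" "pi_vector_field A X'" for X X'
  proof -
    have \<tau>: "smooth_near (slit_atlas A) u (\<lambda>w. \<tau> (fst w))"
      using smooth_near_fst_iff[OF assms(1,9)] near[OF assms(4,9)] by blast
    have X': "smooth_near (slit_atlas A) u (\<lambda>w. X' w f)"
      by (rule pi_vector_field_smooth[OF assms(1) X(2) assms(9) near[OF assms(5,9)]])
    have "hbeta A D u (X u) (\<lambda>w. \<omega> w (X' w)) = hbeta A D u (X u) (\<lambda>w. exp (\<tau> (fst w)) * X' w f)"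
      by (rule tangent_cong_carrier[OF B t[OF X(1)]])
        (simp add: carrier_slit_atlas[OF assms(1)] assms(6) pi_vector_field_tangent[OF X(2)])
    also have "\<dots> = exp (\<tau> (fst u)) * hbeta A D u (X u) (\<lambda>w. \<tau> (fst w)) * X' u f
        + exp (\<tau> (fst u)) * hbeta A D u (X u) (\<lambda>w. X' w f)"
      using tangent_mult[OF B t[OF X(1)] smooth_near_exp[OF B \<tau>] X'] tangent_exp[OF B t[OF X(1)] \<tau>] by simp
    also have "hbeta A D u (X u) (\<lambda>w. \<tau> (fst w)) = X u \<tau>"
      using fun_cong[OF rho_hbeta[OF assms(1) reg assms(9) pi_vector_field_tangent[OF X(1) assms(9)]], of \<tau>]
      by (simp add: rho_def o_def)
    finally show ?thesis by (simp add: algebra_simps)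
  qed
  note 1 = this[OF assms(7,8)] this[OF assms(8,7)]
  note b = cartan_bracket[OF assms(1-3,7-9)]
  have "\<omega> u (rho (lie_bracket (slit_atlas A) (\<lambda>w. hbeta A D w (Y w)) (\<lambda>w. hbeta A D w (Z w)) u)) =
      exp (\<tau> (fst u)) * (hbeta A D u (Y u) (\<lambda>w. Z w f) - hbeta A D u (Z u) (\<lambda>w. Y w f))"
    using assms(6)[OF assms(9) b(2)] b(3)[OF near[OF assms(5,9)]] by simp
  with 1 show ?thesis unfolding dbar_def by (simp add: algebra_simps)
qed

section \<open>Constancy of the conformal factor\<close>

lemma locally_constant_imp_constant:
  assumes "smooth_atlas A" "connected_space (atlas_topology A)" "smooth_fun_on A (atlas_carrier A) \<sigma>"
    and "\<And>p v. v \<in> tangent_space A p \<Longrightarrow> v \<sigma> = 0"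
  shows "\<sigma> constant_on atlas_carrier A"
proof -
  let ?N = "\<lambda>c. {p\<in>atlas_carrier A. \<sigma> p = c}"
  have nbhd: "\<exists>U. openin (atlas_topology A) U \<and> p \<in> U \<and> U \<subseteq> ?N (\<sigma> p)" if p: "p \<in> atlas_carrier A" for p
  proof -
    obtain V \<psi> x where V: "(V, \<psi>) \<in> A" "x \<in> V" "p = \<psi> x" using carrierE[OF p] .
    obtain r where r: "r > 0" "ball x r \<subseteq> V"
      using chart_open[OF assms(1) V(1)] V(2) open_contains_ball by blast
    have "((\<lambda>z. \<sigma> (\<psi> z)) has_derivative (\<lambda>h. 0)) (at z within ball x r)" if "z \<in> ball x r" for z
    proof -
      have z: "z \<in> V" using that r(2) by blast
      have near: "smooth_near A (\<psi> z) \<sigma>"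
        using assms(3) carrierI[OF V(1) z] unfolding smooth_near_def by blast
      have "frechet_derivative (\<sigma> \<circ> \<psi>) (at z) y = 0" for y
        using assms(4)[of "dir_deriv A \<psi> z y" "\<psi> z"] tangent_space_chart[OF assms(1) V(1) z] near
        by (simp add: dir_deriv_def)
      then have "frechet_derivative (\<sigma> \<circ> \<psi>) (at z) = (\<lambda>h. 0)" by auto
      with smooth_near_chartD[OF assms(1) V(1) z near] show ?thesis
        by (metis has_derivative_at_withinI)
    qed
    then have "\<exists>c. \<forall>z\<in>ball x r. \<sigma> (\<psi> z) = c"
      by (intro has_derivative_zero_constant) auto
    then have "\<psi> ` ball x r \<subseteq> ?N (\<sigma> p)"
      using r V carrierI[OF V(1)] by (auto simp del: mem_ball)
    moreover have "openin (atlas_topology A) (\<psi> ` ball x r)"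
      by (rule openin_chart_image[OF assms(1) V(1) open_ball r(2)])
    moreover have "p \<in> \<psi> ` ball x r" using r(1) V(3) by auto
    ultimately show ?thesis by blast
  qed
  \<comment> \<open>Every set described by values of \<sigma> is open, in particular a level set and
    its complement.\<close>
  have N: "openin (atlas_topology A) {p\<in>atlas_carrier A. P (\<sigma> p)}" for P
    by (subst openin_subopen) (use nbhd in fastforce)
  have "\<sigma> p = \<sigma> q" if pq: "p \<in> atlas_carrier A" "q \<in> atlas_carrier A" for p q
  proof (rule ccontr)
    let ?E = "{a\<in>atlas_carrier A. \<sigma> a = \<sigma> p}" and ?F = "{a\<in>atlas_carrier A. \<sigma> a \<noteq> \<sigma> p}"
    assume "\<sigma> p \<noteq> \<sigma> q"
    with pq have "?E \<noteq> {}" "?F \<noteq> {}" "atlas_carrier A \<subseteq> ?E \<union> ?F" "?E \<inter> ?F = {}" by auto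
    with N[of "\<lambda>c. c = \<sigma> p"] N[of "\<lambda>c. c \<noteq> \<sigma> p"] assms(2) show False
      unfolding connected_space_def topspace_atlas_topology[OF assms(1)] by metis
  qed
  then show ?thesis unfolding constant_on_def by metis
qed

text \<open>The argument works at one point: for given \<open>v\<close> take a nonzero coordinate
  vector \<open>b\<close> that the differential of \<sigma> annihilates and a function
  \<open>f\<close> whose differential there is the inner product with \<open>b\<close>. The wedge of
  the two differentials, evaluated at \<open>v\<close> and \<open>b\<close>, is
  \<open>v \<sigma>\<close> times \<open>b \<bullet> b\<close>.\<close>

lemma closed_preserved_imp_constant:
  fixes A :: "('e::euclidean_space, 'a) atlas"
  assumes "smooth_atlas A" "Hausdorff_space (atlas_topology A)" "connected_space (atlas_topology A)"
    and "DIM('e) \<ge> 2" "finsler_structure A L" "smooth_fun_on A (atlas_carrier A) \<sigma>"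
    and "cartan_connection A L D" "cartan_connection A (conformal_change \<sigma> L) D'"
    and closed: "\<And>X. pi_vector_field A X \<Longrightarrow> dbar_closed A L D X \<Longrightarrow>
      dbar_closed A (conformal_change \<sigma> L) D' X"
  shows "\<sigma> constant_on atlas_carrier A"
proof (rule locally_constant_imp_constant[OF assms(1,3,6)])
  note sm = finsler_structure_smooth[OF assms(5)]
  fix p v assume v: "v \<in> tangent_space A p"
  have near: "smooth_near A p \<sigma>"
    using assms(6) tangent_space_carrier[OF v] unfolding smooth_near_def by blast
  obtain V \<psi> x where V: "(V, \<psi>) \<in> A" "x \<in> V" "p = \<psi> x" using carrierE[OF tangent_space_carrier[OF v]] .
  obtain a where a: "v = dir_deriv A \<psi> x a"
    using v tangent_space_chart[OF assms(1) V(1,2)] V(3) by auto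
  let ?d = "dir_deriv A \<psi> x"
  have lin: "linear (\<lambda>y. ?d y \<sigma>)"
    using dir_deriv_add[OF assms(1) V(1,2)] dir_deriv_scale[OF assms(1) V(1,2)]
    by (auto simp: linear_iff tv_add_def tv_scale_def)
  obtain b where b: "b \<noteq> 0" "?d b \<sigma> = 0"
  proof -
    obtain i j :: 'e where ij: "i \<in> Basis" "j \<in> Basis" "i \<noteq> j"
      using assms(4) by (meson card_2_iff' obtain_subset_with_card_n subsetD)
    \<comment> \<open>In the span of two basis vectors this combination is annihilated by the
      differential of \<sigma>; if it is 0, then \<open>i\<close> itself is annihilated.\<close>
    let ?b = "(?d i \<sigma>) *\<^sub>R j - (?d j \<sigma>) *\<^sub>R i"
    have "?d ?b \<sigma> = 0" by (simp add: linear_diff[OF lin] linear_scale[OF lin])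
    moreover have "?d i \<sigma> = 0" if "?b = 0"
    proof -
      from that have "?b \<bullet> j = 0" by simp
      then show ?thesis using ij by (simp add: inner_diff_left inner_not_same_Basis)
    qed
    ultimately show ?thesis using that[of ?b] that[of i] ij(1) nonzero_Basis by blast
  qed
  obtain \<theta> N where \<theta>: "smooth_fun_on A (atlas_carrier A) \<theta>" "\<theta> (\<psi> x) = 1"
    "openin (atlas_topology A) N" "atlas_carrier A \<subseteq> N \<union> \<psi> ` V" "\<And>q. q \<in> N \<Longrightarrow> \<theta> q = 0"
    using bump_function[OF assms(1,2) V(1,2)] by blast
  let ?c = "\<lambda>q. inv_into V \<psi> q \<bullet> b"
  \<comment> \<open>The coordinate is shifted to vanish at \<open>x\<close>, so the derivative of
    \<theta> contributes nothing there and it suffices that \<theta> is 1 at this single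
    point.\<close>
  define f where "f q = \<theta> q * (?c q - x \<bullet> b)" for q
  have cnear: "smooth_near A q (\<lambda>q. ?c q - x \<bullet> b)" if "q \<in> \<psi> ` V" for q
  proof -
    have "smooth_near A q ?c"
      using coordinate_smooth[OF assms(1) V(1)] that unfolding smooth_fun_on_iff[OF assms(1)] by blast
    then show ?thesis
      by (rule smooth_near_lift[OF assms(1), where h = ?c and G = "\<lambda>s t. s - x \<bullet> b"])
        (auto intro: smooth_on_diff smooth_on_const \<open>smooth_near A q ?c\<close>)
  qed
  have f: "smooth_fun_on A (atlas_carrier A) f"
    unfolding smooth_fun_on_iff[OF assms(1)]
  proof (intro conjI ballI openin_carrier[OF assms(1)])
    fix q assume q: "q \<in> atlas_carrier A"
    show "smooth_near A q f"
    proof (cases "q \<in> N")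
      case True
      then show ?thesis
        by (rule smooth_near_cong[OF assms(1) \<theta>(3) _ _ smooth_near_const[OF assms(1) q, of 0]])
          (simp add: f_def \<theta>(5))
    next
      case False
      then have "q \<in> \<psi> ` V" using \<theta>(4) q by blast
      moreover have "smooth_near A q \<theta>" using \<theta>(1) q unfolding smooth_near_def by blast
      ultimately show ?thesis unfolding f_def by (intro smooth_near_mult[OF assms(1)] cnear)
    qed
  qed
  have df: "?d y f = y \<bullet> b" for y
  proof -
    have t: "?d y \<in> tangent_space A (\<psi> x)" using tangent_space_chart[OF assms(1) V(1,2)] by blast
    have c: "smooth_near A (\<psi> x) ?c"
      using coordinate_smooth[OF assms(1) V(1)] V(2) unfolding smooth_fun_on_iff[OF assms(1)] by blast
    have "((\<lambda>z :: real \<times> real. fst z - x \<bullet> b) has_derivative fst) (at (?c (\<psi> x), ?c (\<psi> x)))"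
      by (auto intro!: derivative_eq_intros)
    from tangent_chain[OF assms(1) t c c _ this] have "?d y (\<lambda>q. ?c q - x \<bullet> b) = y \<bullet> b"
      using cnear[of "\<psi> x"] V(2) dir_deriv_coordinate[OF assms(1) V(1,2)] by simp
    moreover have "?c (\<psi> x) = x \<bullet> b" using inv_into_f_f[OF chart_inj[OF assms(1) V(1)] V(2)] by simp
    moreover have "smooth_near A (\<psi> x) \<theta>" using \<theta>(1) carrierI[OF V(1,2)] unfolding smooth_near_def by blast
    ultimately show ?thesis
      unfolding f_def using tangent_mult[OF assms(1) t, of \<theta> "\<lambda>q. ?c q - x \<bullet> b"] cnear[of "\<psi> x"] V(2) \<theta>(2)
      by simp
  qed
  obtain X where X: "pi_vector_field A X"
    "\<And>u v. u \<in> slit_tangent A \<Longrightarrow> v \<in> tangent_space A (fst u) \<Longrightarrow> finsler_metric L u (X u) v = v f"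
    using finsler_gradient[OF assms(1,5) f] by blast
  have zero: "smooth_fun_on A (atlas_carrier A) (\<lambda>q. 0)"
    unfolding smooth_fun_on_iff[OF assms(1)] using openin_carrier[OF assms(1)] smooth_near_const[OF assms(1)] by blast
  \<comment> \<open>With the weight 0 each product in the formula contains the derivative of a
    constant.\<close>
  have "dbar A D (\<lambda>w. finsler_metric L w (X w)) Y Z u = 0"
    if "pi_vector_field A Y" "pi_vector_field A Z" "u \<in> slit_tangent A" for Y Z u
    using dbar_weighted_differential[OF assms(1,2,7) zero f _ that, of "\<lambda>w. finsler_metric L w (X w)"] X(2)
      tangent_const[OF assms(1) pi_vector_field_tangent[OF that(1,3)]]
      tangent_const[OF assms(1) pi_vector_field_tangent[OF that(2,3)]] by simp
  then have cl: "dbar_closed A (conformal_change \<sigma> L) D' X"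
    using closed[OF X(1)] unfolding dbar_closed_def by blast
  \<comment> \<open>Any point of the fibre over \<open>p\<close> would do; \<open>b\<close> is a
    nonzero vector at hand.\<close>
  let ?u = "slit_chart A \<psi> (x, b)"
  have u: "?u \<in> slit_tangent A" using slit_chart_in_slit_tangent[OF assms(1) V(1)] V(2) b(1) by blast
  have t: "?d y \<in> tangent_space A p" for y using tangent_space_chart[OF assms(1) V(1,2)] V(3) by blast
  obtain Y where Y: "pi_vector_field A (\<lambda>u. Y (fst u))" "Y p = ?d a" using basic_extension[OF assms(1,2) t] .
  obtain Z where Z: "pi_vector_field A (\<lambda>u. Z (fst u))" "Z p = ?d b" using basic_extension[OF assms(1,2) t] .
  let ?\<tau> = "\<lambda>q. 2 * \<sigma> q"
  have \<tau>: "smooth_fun_on A (atlas_carrier A) ?\<tau>"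
    using assms(6) smooth_near_cmult[OF assms(1)] unfolding smooth_fun_on_iff[OF assms(1)] by blast
  have "finsler_metric (conformal_change \<sigma> L) w (X w) v = exp (2 * \<sigma> (fst w)) * v f"
    if "w \<in> slit_tangent A" "v \<in> tangent_space A (fst w)" for w v
    using finsler_metric_conformal[OF assms(1) sm that(1) pi_vector_field_tangent[OF X(1) that(1)] that(2)]
      X(2)[OF that] by simp
  from dbar_weighted_differential[where \<omega> = "\<lambda>w. finsler_metric (conformal_change \<sigma> L) w (X w)" and
      Y = "\<lambda>u. Y (fst u)" and Z = "\<lambda>u. Z (fst u)", OF assms(1,2,8) \<tau> f this Y(1) Z(1) u]
  have "0 = exp (2 * \<sigma> p) * (?d a ?\<tau> * ?d b f - ?d b ?\<tau> * ?d a f)"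
    using cl Y Z u V(3) unfolding dbar_closed_def by (simp add: fst_slit_chart)
  moreover have "?d y ?\<tau> = 2 * ?d y \<sigma>" for y by (rule tangent_cmult[OF assms(1) t near])
  ultimately have "?d a \<sigma> * (b \<bullet> b) = 0" using b(2) df by simp
  then show "v \<sigma> = 0" using b(1) a by simp
qed

section \<open>Uniqueness of the horizontal lift\<close>

text \<open>Lifts of vector fields on the base have \<open>k = 0\<close>, the fundamental field has \<open>k = 1\<close>.  These fields
  suffice to test the torsion conditions, and their brackets with vertical fields are explicit.\<close>

definition vertical_multiple ::
  "('e::euclidean_space, 'a) atlas \<Rightarrow> 'a \<times> 'a tvec \<Rightarrow> ('a \<times> 'a tvec \<Rightarrow> 'a tvec) \<Rightarrow> real \<Rightarrow> bool" where
  "vertical_multiple A u Y k \<longleftrightarrow> pi_vector_field A Y \<and>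
     (\<forall>n\<in>tangent_space A (fst u). \<forall>f. smooth_near A (fst u) f \<longrightarrow> vgamma A u n (\<lambda>w. Y w f) = k * n f)"

lemma vertical_multiple_basic:
  assumes "pi_vector_field A (\<lambda>w. Y (fst w))"
  shows "vertical_multiple A u (\<lambda>w. Y (fst w)) 0"
  using assms by (simp add: vertical_multiple_def vgamma_def)

lemma vertical_multiple_eta:
  assumes "smooth_atlas A" "u \<in> slit_tangent A"
  shows "vertical_multiple A u eta 1"
  unfolding vertical_multiple_def
proof (intro conjI ballI allI impI pi_vector_field_eta assms)
  fix n f assume "smooth_near A (fst u) f"
  then have "smooth_near (slit_atlas A) u (\<lambda>w. eta w f)"
    by (rule pi_vector_field_smooth[OF assms(1) pi_vector_field_eta[OF assms(1)] assms(2)])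
  moreover have "((\<lambda>t. snd u f + t * n f) has_real_derivative n f) (at 0)"
    by (auto intro!: derivative_eq_intros)
  ultimately show "vgamma A u n (\<lambda>w. eta w f) = 1 * n f"
    by (simp add: vgamma_def eta_def tv_add_def tv_scale_def DERIV_imp_deriv)
qed

text \<open>This is \<open>rho\<close> of the bracket of a vertical lift with the horizontal lift of
  \<open>Y\<close>, and it is the same for all regular connections. The case distinction supplies
  the default value that tangent vectors have.\<close>

definition fibre_derivative ::
  "('e::euclidean_space, 'a) atlas \<Rightarrow> 'a \<times> 'a tvec \<Rightarrow> 'a tvec \<Rightarrow> ('a \<times> 'a tvec \<Rightarrow> 'a tvec) \<Rightarrow> 'a tvec" where
  "fibre_derivative A u n Y = (\<lambda>f. if smooth_near A (fst u) f then vgamma A u n (\<lambda>w. Y w f) else 0)"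

lemma fibre_derivative_vertical_multiple:
  assumes "vertical_multiple A u Y k" "n \<in> tangent_space A (fst u)"
  shows "fibre_derivative A u n Y = tv_scale k n"
  using assms tangent_not_smooth[OF assms(2)]
  by (auto simp: fibre_derivative_def vertical_multiple_def tv_scale_def fun_eq_iff)

text \<open>The components of \<open>Y\<close> in a chart, differentiated along the fibre, are the
  components of the result. Tangency is needed because the rules for the metric hold on tangent
  vectors.\<close>

lemma fibre_derivative_tangent:
  fixes A :: "('e::euclidean_space, 'a) atlas"
  assumes "smooth_atlas A" "u \<in> slit_tangent A" "n \<in> tangent_space A (fst u)" "pi_vector_field A Y"
  shows "fibre_derivative A u n Y \<in> tangent_space A (fst u)"
proof -
  obtain V \<psi> x y where V: "(V, \<psi>) \<in> A" "x \<in> V" "y \<noteq> 0" "u = slit_chart A \<psi> (x, y)"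
    and t: "\<And>v. v \<in> tangent_space A (fst u) \<Longrightarrow> \<exists>a. v = dir_deriv A \<psi> x a"
    using tangent_fibreE[OF assms(1,2)] by metis
  obtain b where b: "n = dir_deriv A \<psi> x b" using t assms(3) by metis
  let ?S = "V \<times> (- {0 :: 'e})"
  have S: "open ?S" by (rule open_slit[OF chart_open[OF assms(1) V(1)]])
  have z: "(x, y) \<in> ?S" using V by simp
  obtain \<xi> where \<xi>: "smooth_on \<xi> ?S" "\<And>z. z \<in> ?S \<Longrightarrow> Y (slit_chart A \<psi> z) = dir_deriv A \<psi> (fst z) (\<xi> z)"
    using pi_vector_field_chart[OF assms(1,4) V(1)] by blast
  let ?a = "frechet_derivative \<xi> (at (x, y)) (0, b)"
  have "fibre_derivative A u n Y f = dir_deriv A \<psi> x ?a f" for f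
  proof (cases "smooth_near A (\<psi> x) f")
    case True
    let ?D = "frechet_derivative (f \<circ> \<psi>) (at x)"
    have D: "bounded_linear ?D"
      by (rule has_derivative_bounded_linear[OF smooth_near_chartD[OF assms(1) V(1,2) True]])
    have "((\<lambda>z. ?D (\<xi> z)) has_derivative (\<lambda>h. ?D (frechet_derivative \<xi> (at (x, y)) h))) (at (x, y))"
      by (rule bounded_linear.has_derivative[OF D smooth_on_has_derivative[OF \<xi>(1) z]])
    from frechet_derivative_at[OF this]
    have "frechet_derivative (\<lambda>z. ?D (\<xi> z)) (at (x, y)) (0, b) = ?D ?a" by metis
    with has_real_derivative_along_line[OF smooth_on_bounded_linear[OF S D \<xi>(1)], of "(x, y)" 0 "(0, b)"] z
    have der: "((\<lambda>t. ?D (\<xi> (x, y + t *\<^sub>R b))) has_real_derivative ?D ?a) (at 0)" by simp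
    have "smooth_near (slit_atlas A) u (\<lambda>w. Y w f)"
      by (rule pi_vector_field_smooth[OF assms(1,4,2)]) (use True V(4) in \<open>simp add: fst_slit_chart\<close>)
    then have "fibre_derivative A u n Y f = deriv (\<lambda>t. Y (fst u, tv_add (snd u) (tv_scale t n)) f) 0"
      using True V(4) by (simp add: fibre_derivative_def vgamma_def fst_slit_chart)
    also have "\<dots> = deriv (\<lambda>t. ?D (\<xi> (x, y + t *\<^sub>R b))) 0"
    proof (rule deriv_cong_ev[OF _ refl])
      show "\<forall>\<^sub>F t in nhds 0. Y (fst u, tv_add (snd u) (tv_scale t n)) f = ?D (\<xi> (x, y + t *\<^sub>R b))"
        using eventually_translate_nonzero[OF V(3), of b]
      proof (rule eventually_mono)
        fix t assume "y + t *\<^sub>R b \<noteq> 0"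
        then have "(x, y + t *\<^sub>R b) \<in> ?S" using V(2) by simp
        from \<xi>(2)[OF this] True
        show "Y (fst u, tv_add (snd u) (tv_scale t n)) f = ?D (\<xi> (x, y + t *\<^sub>R b))"
          using slit_chart_translate[OF assms(1) V(1,2), of y t b]
          by (simp add: V(4) b slit_chart_apply dir_deriv_def)
      qed
    qed
    also have "\<dots> = ?D ?a" by (rule DERIV_imp_deriv[OF der])
    finally show ?thesis using True by (simp add: dir_deriv_def)
  next
    case False
    then show ?thesis by (simp add: fibre_derivative_def dir_deriv_def V(4) fst_slit_chart)
  qed
  then show ?thesis
    using tangent_space_chart[OF assms(1) V(1,2)] V(4) by (auto simp: fst_slit_chart)
qed

section \<open>The mixed torsion of a Cartan connection\<close>

lemma metric_connection_eq:
  assumes "metric_connection A L D" "u \<in> slit_tangent A" "\<xi> \<in> tangent_space (slit_atlas A) u"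
    and "pi_vector_field A Y" "pi_vector_field A Z"
  shows "\<xi> (\<lambda>w. finsler_metric L w (Y w) (Z w)) =
    finsler_metric L u (D u \<xi> Y) (Z u) + finsler_metric L u (Y u) (D u \<xi> Z)"
  using assms unfolding metric_connection_def by blast

text \<open>One covariant derivative is that of \<open>rho\<close> of a vertical field, hence of 0,
  and the bracket projects to the fibre derivative; the horizontal lift disappears.\<close>

lemma hv_torsion_eq:
  assumes "smooth_atlas A" "regular_connection A D" "u \<in> slit_tangent A"
    and "pi_vector_field A X" "pi_vector_field A Y"
  shows "hv_torsion A D X Y u = tv_diff (D u (vgamma A u (X u)) Y) (fibre_derivative A u (X u) Y)"
proof -
  note lin = regular_connection_linear[OF assms(2)] and B = smooth_atlas_slit[OF assms(1)]
  have n: "X u \<in> tangent_space A (fst u)" by (rule pi_vector_field_tangent[OF assms(4,3)])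
  have g: "vgamma A u (X u) \<in> tangent_space (slit_atlas A) u" by (rule vgamma_in_tangent_space[OF assms(1,3) n])
  have b: "hbeta A D u (Y u) \<in> tangent_space (slit_atlas A) u"
    by (rule hbeta_tangent[OF assms(1-3) pi_vector_field_tangent[OF assms(5,3)]])
  have rb: "rho (hbeta A D w (Y w)) = Y w" if "w \<in> slit_tangent A" for w
    by (rule rho_hbeta[OF assms(1,2) that pi_vector_field_tangent[OF assms(5) that]])
  have rg: "rho (vgamma A w (X w)) = tv_zero" if "w \<in> slit_tangent A" for w
    by (rule rho_vgamma[OF assms(1) that pi_vector_field_tangent[OF assms(4) that]])
  have 1: "D u (vgamma A u (X u)) (\<lambda>w. rho (hbeta A D w (Y w))) = D u (vgamma A u (X u)) Y"
    by (rule connection_cong[OF lin assms(3) g pi_vector_field_cong[OF assms(1,5)] assms(5)]) (simp_all add: rb)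
  have "D u (hbeta A D u (Y u)) (\<lambda>w. rho (vgamma A w (X w))) = D u (hbeta A D u (Y u)) (\<lambda>w. tv_zero)"
    by (rule connection_cong[OF lin assms(3) b pi_vector_field_cong[OF assms(1) pi_vector_field_zero[OF assms(1)]]
          pi_vector_field_zero[OF assms(1)]]) (simp_all add: rg)
  also have "\<dots> = tv_zero" by (rule connection_zero_field[OF assms(1) lin assms(3) b])
  finally have 2: "D u (hbeta A D u (Y u)) (\<lambda>w. rho (vgamma A w (X w))) = tv_zero" .
  have 3: "rho (lie_bracket (slit_atlas A) (\<lambda>w. vgamma A w (X w)) (\<lambda>w. hbeta A D w (Y w)) u) =
      fibre_derivative A u (X u) Y"
  proof
    fix f
    have "vgamma A u (X u) (\<lambda>w. rho (hbeta A D w (Y w)) f) = vgamma A u (X u) (\<lambda>w. Y w f)"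
      by (rule tangent_cong_carrier[OF B g]) (simp add: carrier_slit_atlas[OF assms(1)] rb)
    moreover have "hbeta A D u (Y u) (\<lambda>w. rho (vgamma A w (X w)) f) = hbeta A D u (Y u) (\<lambda>w. 0)"
      by (rule tangent_cong_carrier[OF B b]) (simp add: carrier_slit_atlas[OF assms(1)] rg tv_zero_def)
    moreover have "hbeta A D u (Y u) (\<lambda>w. 0) = 0" by (rule tangent_const[OF B b])
    ultimately show "rho (lie_bracket (slit_atlas A) (\<lambda>w. vgamma A w (X w)) (\<lambda>w. hbeta A D w (Y w)) u) f =
        fibre_derivative A u (X u) Y f"
      by (simp add: rho_lie_bracket[OF assms(1,3)] fibre_derivative_def)
  qed
  show ?thesis unfolding hv_torsion_def torsion_def 1 2 3 by (simp add: tv_diff_zero)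
qed

lemma hv_torsion_tangent:
  assumes "smooth_atlas A" "Hausdorff_space (atlas_topology A)" "regular_connection A D" "u \<in> slit_tangent A"
    and "pi_vector_field A X" "pi_vector_field A Y"
  shows "hv_torsion A D X Y u \<in> tangent_space A (fst u)"
proof -
  note n = pi_vector_field_tangent[OF assms(5,4)]
  note D = connection_tangent[OF assms(1,2) regular_connection_linear[OF assms(3)] assms(4)
      vgamma_in_tangent_space[OF assms(1,4) n] assms(6)]
  show ?thesis
    unfolding hv_torsion_eq[OF assms(1,3-6)]
    by (rule tangent_space_diff[OF assms(1) D fibre_derivative_tangent[OF assms(1,4) n assms(6)]])
qed

text \<open>On test fields the fibre derivative is a multiple of \<open>n\<close>, so the symmetry
  of the mixed torsion becomes an identity between vertical covariant derivatives.\<close>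

lemma cartan_vertical_symmetric:
  assumes "smooth_atlas A" "Hausdorff_space (atlas_topology A)" "smooth_fun_on (slit_atlas A) (slit_tangent A) L"
    and "cartan_connection A L D"
    and "u \<in> slit_tangent A" "n \<in> tangent_space A (fst u)"
    and "vertical_multiple A u Y k" "vertical_multiple A u Z l"
  shows "finsler_metric L u (D u (vgamma A u n) Y) (Z u) - k * finsler_metric L u n (Z u) =
    finsler_metric L u (D u (vgamma A u n) Z) (Y u) - l * finsler_metric L u n (Y u)"
proof -
  obtain X where X: "pi_vector_field A (\<lambda>w. X (fst w))" "X (fst u) = n"
    using basic_extension[OF assms(1,2,6)] .
  have Y: "pi_vector_field A Y" and Z: "pi_vector_field A Z"
    using assms(7,8) by (auto simp: vertical_multiple_def)
  note reg = cartan_regular[OF assms(4)] and lin = cartan_linear[OF assms(4)]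
  note g = vgamma_in_tangent_space[OF assms(1,5,6)]
  have "finsler_metric L u (hv_torsion A D (\<lambda>w. X (fst w)) Y u) (Z u) =
      finsler_metric L u (hv_torsion A D (\<lambda>w. X (fst w)) Z u) (Y u)"
    using assms(4) X(1) Y Z assms(5) unfolding cartan_connection_def by blast
  moreover have "finsler_metric L u (hv_torsion A D (\<lambda>w. X (fst w)) Y' u) w =
      finsler_metric L u (D u (vgamma A u n) Y') w - k' * finsler_metric L u n w"
    if "vertical_multiple A u Y' k'" "w \<in> tangent_space A (fst u)" for Y' k' w
  proof -
    have Y': "pi_vector_field A Y'" using that(1) by (simp add: vertical_multiple_def)
    note d = connection_tangent[OF assms(1,2) lin assms(5) g Y']
    show ?thesis
      using finsler_metric_diff[OF assms(1,3,5) d tangent_space_scale[OF assms(1,6)] that(2), of k']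
        finsler_metric_scale[OF assms(1,3,5,6) that(2), of k']
      using fibre_derivative_vertical_multiple[OF that(1) assms(6)]
      by (simp add: hv_torsion_eq[OF assms(1) reg assms(5) X(1) Y'] X(2))
  qed
  ultimately show ?thesis
    using assms(7,8) pi_vector_field_tangent[OF Y assms(5)] pi_vector_field_tangent[OF Z assms(5)] by simp
qed

text \<open>Differentiating along the vertical lift of \<open>n\<close>, write \<open>P\<close> for
  \<open>g(D Y, eta)\<close>, \<open>Q\<close> for \<open>g(D eta, Y)\<close> and \<open>N\<close>
  for \<open>g(n, Y)\<close>. The metric condition gives \<open>N = P + Q\<close>, the symmetric
  mixed torsion gives \<open>P = Q - N\<close>; hence \<open>P = 0\<close> and \<open>Q = N\<close>.
  In particular the connection map is a left inverse of \<open>vgamma\<close>.\<close>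

lemma cartan_vertical_eta:
  assumes "smooth_atlas A" "Hausdorff_space (atlas_topology A)" "finsler_structure A L"
    and "cartan_connection A L D" "u \<in> slit_tangent A" "n \<in> tangent_space A (fst u)"
  shows cartan_vertical_eta_left: "D u (vgamma A u n) eta = n"
    and cartan_vertical_eta_right: "pi_vector_field A (\<lambda>w. Y (fst w)) \<Longrightarrow>
      finsler_metric L u (D u (vgamma A u n) (\<lambda>w. Y (fst w))) (snd u) = 0"
proof -
  note sm = finsler_structure_smooth[OF assms(3)]
  note lin = cartan_linear[OF assms(4)] and met = cartan_metric[OF assms(4)]
  note g = vgamma_in_tangent_space[OF assms(1,5,6)]
  note pe = pi_vector_field_eta[OF assms(1)] and ve = vertical_multiple_eta[OF assms(1,5)]
  note de = connection_tangent[OF assms(1,2) lin assms(5) g pe]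
  have *: "finsler_metric L u (D u (vgamma A u n) (\<lambda>w. Y (fst w))) (snd u) = 0"
    "finsler_metric L u (D u (vgamma A u n) eta) (Y (fst u)) = finsler_metric L u n (Y (fst u))"
    if Y: "pi_vector_field A (\<lambda>w. Y (fst w))" for Y
  proof -
    have Yt: "Y (fst u) \<in> tangent_space A (fst u)" using pi_vector_field_tangent[OF Y assms(5)] .
    have "finsler_metric L u n (Y (fst u)) = finsler_metric L u (D u (vgamma A u n) (\<lambda>w. Y (fst w))) (eta u) +
        finsler_metric L u (Y (fst u)) (D u (vgamma A u n) eta)"
      using metric_connection_eq[OF met assms(5) g Y pe]
      by (simp add: vgamma_finsler_metric_eta[OF assms(1,3,5,6) Y])
    moreover have "finsler_metric L u (Y (fst u)) (D u (vgamma A u n) eta) =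
        finsler_metric L u (D u (vgamma A u n) eta) (Y (fst u))"
      by (rule finsler_metric_commute[OF assms(1) sm assms(5) Yt de])
    moreover have "finsler_metric L u (D u (vgamma A u n) (\<lambda>w. Y (fst w))) (eta u) =
        finsler_metric L u (D u (vgamma A u n) eta) (Y (fst u)) - finsler_metric L u n (Y (fst u))"
      using cartan_vertical_symmetric[OF assms(1,2) sm assms(4-6) vertical_multiple_basic[OF Y] ve] by simp
    ultimately show "finsler_metric L u (D u (vgamma A u n) (\<lambda>w. Y (fst w))) (snd u) = 0"
      "finsler_metric L u (D u (vgamma A u n) eta) (Y (fst u)) = finsler_metric L u n (Y (fst u))"
      by (auto simp: eta_def)
  qed
  show "D u (vgamma A u n) eta = n"
  proof (rule finsler_metric_nondegenerate[OF assms(1,3,5) de assms(6)])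
    fix z assume "z \<in> tangent_space A (fst u)"
    then obtain Y where "pi_vector_field A (\<lambda>w. Y (fst w))" "Y (fst u) = z"
      by (rule basic_extension[OF assms(1,2)])
    then show "finsler_metric L u (D u (vgamma A u n) eta) z = finsler_metric L u n z" using *(2) by blast
  qed
  show "finsler_metric L u (D u (vgamma A u n) (\<lambda>w. Y (fst w))) (snd u) = 0"
    if "pi_vector_field A (\<lambda>w. Y (fst w))" by (rule *(1)[OF that])
qed

text \<open>Below, \<open>s\<close> is the difference of the connections, which is skew, and \<open>n v\<close> is the vertical
  difference of the two lifts of \<open>v\<close>; \<open>g(n y, z)\<close> turns out to be both symmetric and skew.\<close>

lemma cartan_hbeta_unique:
  fixes A :: "('e::euclidean_space, 'a) atlas"
  assumes A: "smooth_atlas A" and H: "Hausdorff_space (atlas_topology A)" and F: "finsler_structure A L"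
    and C: "cartan_connection A L D" and C': "cartan_connection A L D'"
    and u: "u \<in> slit_tangent A" and v: "v \<in> tangent_space A (fst u)"
  shows "hbeta A D u v = hbeta A D' u v"
proof -
  let ?T = "tangent_space A (fst u)" and ?TT = "tangent_space (slit_atlas A) u"
  let ?g = "finsler_metric L u" and ?\<gamma> = "vgamma A u" and ?\<beta> = "hbeta A D u" and ?\<beta>' = "hbeta A D' u"
  let ?e = "snd u" and ?pi = "pi_vector_field A"
  note B = smooth_atlas_slit[OF A] and sm = finsler_structure_smooth[OF F]
  note reg = cartan_regular[OF C] and reg' = cartan_regular[OF C']
  note lin = cartan_linear[OF C] and lin' = cartan_linear[OF C']
  note met = cartan_metric[OF C] and met' = cartan_metric[OF C']
  note \<gamma>t = vgamma_in_tangent_space[OF A u]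
  note \<beta>t = hbeta_tangent[OF A reg u] and \<beta>t' = hbeta_tangent[OF A reg' u]
  note Dt = connection_tangent[OF A H lin u] and Dt' = connection_tangent[OF A H lin' u]
  note pe = pi_vector_field_eta[OF A] and ve = vertical_multiple_eta[OF A u]
  have et: "?e \<in> ?T" by (rule eta_tangent[OF u])
  have eta_u: "eta u = ?e" by (simp add: eta_def)
  note g_add = finsler_metric_add[OF A sm u] and g_scale = finsler_metric_scale[OF A sm u]
    and g_diff = finsler_metric_diff[OF A sm u] and g_commute = finsler_metric_commute[OF A sm u]

  \<comment> \<open>Both lifts project to \<open>y\<close>, so they differ by a vertical
    vector.\<close>
  have "\<exists>n. n \<in> ?T \<and> ?\<beta>' y = tv_add (?\<beta> y) (?\<gamma> n)" if y: "y \<in> ?T" for y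
  proof -
    let ?\<xi> = "tv_diff (?\<beta>' y) (?\<beta> y)"
    have "?\<xi> \<in> ?TT" by (intro tangent_space_diff B \<beta>t \<beta>t' y)
    moreover have "rho ?\<xi> = tv_zero"
      unfolding tv_diff_eq rho_add rho_scale rho_hbeta[OF A reg u y] rho_hbeta[OF A reg' u y]
      by (simp add: tv_add_def tv_scale_def tv_zero_def)
    ultimately obtain n where "n \<in> ?T" "?\<xi> = ?\<gamma> n" by (rule vertical_vgamma[OF A])
    moreover have "?\<beta>' y = tv_add (?\<beta> y) ?\<xi>" by (simp add: tv_add_def tv_diff_def)
    ultimately show ?thesis by auto
  qed
  then obtain n where n: "\<And>y. y \<in> ?T \<Longrightarrow> n y \<in> ?T" "\<And>y. y \<in> ?T \<Longrightarrow> ?\<beta>' y = tv_add (?\<beta> y) (?\<gamma> (n y))"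
    by metis

  have "\<exists>Y. ?pi (\<lambda>w. Y (fst w)) \<and> Y (fst u) = y" if "y \<in> ?T" for y
    using basic_extension[OF A H that] by metis
  then obtain X where X: "\<And>y. y \<in> ?T \<Longrightarrow> ?pi (\<lambda>w. X y (fst w))" "\<And>y. y \<in> ?T \<Longrightarrow> X y (fst u) = y"
    by metis
  define X' where "X' y = (\<lambda>w :: 'a \<times> 'a tvec. X y (fst w))" for y
  have X': "?pi (X' y)" "X' y u = y" "vertical_multiple A u (X' y) 0" if "y \<in> ?T" for y
    using X[OF that] vertical_multiple_basic[OF X(1)[OF that]] by (auto simp: X'_def)

  define s where "s \<xi> Y z = ?g (D' u \<xi> Y) z - ?g (D u \<xi> Y) z" for \<xi> Y z
  \<comment> \<open>For a test field this is the mixed torsion of \<open>D'\<close> along the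
    vertical lift of \<open>m\<close>, paired with \<open>z\<close>.\<close>
  define c where "c m Y k z = ?g (D' u (?\<gamma> m) Y) z - k * ?g m z" for m Y k z

  \<comment> \<open>Both connections preserve the same metric, so subtracting the two metric
    conditions leaves a skew difference.\<close>
  have skew: "s \<xi> Y (Z u) = - s \<xi> Z (Y u)" if "\<xi> \<in> ?TT" "?pi Y" "?pi Z" for \<xi> Y Z
    using metric_connection_eq[OF met u that] metric_connection_eq[OF met' u that]
      g_commute[OF pi_vector_field_tangent[OF that(2) u] Dt[OF that(1,3)]]
      g_commute[OF pi_vector_field_tangent[OF that(2) u] Dt'[OF that(1,3)]]
    by (simp add: s_def)

  \<comment> \<open>On vertical vectors the symmetry of both mixed torsions makes \<open>s\<close>
    symmetric too, hence zero, so \<open>D\<close> and \<open>D'\<close> yield the same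
    \<open>c\<close>.\<close>
  have c_D: "?g (D u (?\<gamma> m) Y) z - k * ?g m z = c m Y k z"
    if m: "m \<in> ?T" and Y: "vertical_multiple A u Y k" and z: "z \<in> ?T" for m Y k z
  proof -
    have pY: "?pi Y" using Y by (simp add: vertical_multiple_def)
    have "s (?\<gamma> m) Y z = s (?\<gamma> m) (X' z) (Y u)"
      using cartan_vertical_symmetric[OF A H sm C u m Y X'(3)[OF z]]
        cartan_vertical_symmetric[OF A H sm C' u m Y X'(3)[OF z]] X'(2)[OF z] by (simp add: s_def)
    moreover have "s (?\<gamma> m) Y z = - s (?\<gamma> m) (X' z) (Y u)"
      using skew[OF \<gamma>t[OF m] pY X'(1)[OF z]] X'(2)[OF z] by simp
    ultimately show ?thesis by (simp add: s_def c_def)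
  qed
  have c_eta: "c m eta 1 z = 0" if "m \<in> ?T" for m z
    using cartan_vertical_eta_left[OF A H F C' u that] by (simp add: c_def)
  have c_e: "c m (X' y) 0 ?e = 0" if "m \<in> ?T" "y \<in> ?T" for m y
    using cartan_vertical_eta_right[OF A H F C' u that(1) X(1)[OF that(2)]] by (simp add: c_def X'_def)

  \<comment> \<open>The projected brackets of the two lifts are compared twice: through covariant
    derivatives, because both horizontal torsions vanish, and as commutators, where the vertical
    difference acts on the test fields by the multiples \<open>k\<close> and
    \<open>l\<close>.\<close>
  have main: "s (?\<beta> (Y u)) Z z + c (n (Y u)) Z l z = s (?\<beta> (Z u)) Y z + c (n (Z u)) Y k z"
    if Y: "vertical_multiple A u Y k" and Z: "vertical_multiple A u Z l" and z: "z \<in> ?T" for Y Z k l z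
  proof -
    have pY: "?pi Y" and pZ: "?pi Z" using Y Z by (auto simp: vertical_multiple_def)
    have yt: "Y u \<in> ?T" and zt: "Z u \<in> ?T" using pi_vector_field_tangent[OF pY u] pi_vector_field_tangent[OF pZ u] by blast+
    have split: "D' u (?\<beta>' y) W = tv_add (D' u (?\<beta> y) W) (D' u (?\<gamma> (n y)) W)" if "y \<in> ?T" "?pi W" for y W
      unfolding n(2)[OF that(1)] by (rule connection_add[OF lin' u \<beta>t[OF that(1)] \<gamma>t[OF n(1)[OF that(1)]] that(2)])
    let ?R = "tv_diff (D u (?\<beta> (Y u)) Z) (D u (?\<beta> (Z u)) Y)"
    let ?R' = "tv_diff (D' u (?\<beta>' (Y u)) Z) (D' u (?\<beta>' (Z u)) Y)"
    let ?E = "tv_diff (tv_scale l (n (Y u))) (tv_scale k (n (Z u)))"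
    note b = cartan_bracket[OF A H C pY pZ u] and b' = cartan_bracket[OF A H C' pY pZ u]
    have Rt: "?R \<in> ?T" and Rt': "?R' \<in> ?T"
      by (intro tangent_space_diff[OF A] Dt Dt' \<beta>t \<beta>t' yt zt pY pZ)+
    have Et: "?E \<in> ?T" by (intro tangent_space_diff tangent_space_scale A n yt zt)
    have "?R' = tv_add ?R ?E"
    proof
      fix f
      show "?R' f = tv_add ?R ?E f"
      proof (cases "smooth_near A (fst u) f")
        case True
        have R: "?R f = ?\<beta> (Y u) (\<lambda>w. Z w f) - ?\<beta> (Z u) (\<lambda>w. Y w f)"
          using b(3)[OF True] unfolding b(1) .
        have R': "?R' f = ?\<beta>' (Y u) (\<lambda>w. Z w f) - ?\<beta>' (Z u) (\<lambda>w. Y w f)"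
          using b'(3)[OF True] unfolding b'(1) .
        have "?\<gamma> (n (Y u)) (\<lambda>w. Z w f) = l * n (Y u) f" "?\<gamma> (n (Z u)) (\<lambda>w. Y w f) = k * n (Z u) f"
          using Y Z n(1)[OF yt] n(1)[OF zt] True by (auto simp: vertical_multiple_def)
        then have "?\<beta>' (Y u) (\<lambda>w. Z w f) - ?\<beta>' (Z u) (\<lambda>w. Y w f) = tv_add ?R ?E f"
          unfolding n(2)[OF yt] n(2)[OF zt]
          using R by (simp add: tv_add_def tv_diff_def tv_scale_def)
        with R' show ?thesis by (rule trans)
      next
        case False
        then show ?thesis
          using tangent_not_smooth[OF Rt'] tangent_not_smooth[OF tangent_space_add[OF A Rt Et]] by metis
      qed
    qed
    then have "?g ?R' z = ?g ?R z + ?g ?E z" using g_add[OF Rt z Et] by simp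
    moreover have "?g ?R z = ?g (D u (?\<beta> (Y u)) Z) z - ?g (D u (?\<beta> (Z u)) Y) z"
      by (intro g_diff Dt \<beta>t yt zt pY pZ z)
    moreover have "?g ?R' z = ?g (D' u (?\<beta>' (Y u)) Z) z - ?g (D' u (?\<beta>' (Z u)) Y) z"
      by (intro g_diff Dt' \<beta>t' yt zt pY pZ z)
    moreover have "?g ?E z = l * ?g (n (Y u)) z - k * ?g (n (Z u)) z"
      using g_diff[OF tangent_space_scale[OF A n(1)[OF yt]] tangent_space_scale[OF A n(1)[OF zt]] z]
        g_scale[OF n(1)[OF yt] z] g_scale[OF n(1)[OF zt] z] by simp
    moreover have "?g (D' u (?\<beta>' y) W) z = ?g (D' u (?\<beta> y) W) z + ?g (D' u (?\<gamma> (n y)) W) z"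
      if "y \<in> ?T" "?pi W" for y W
      unfolding split[OF that] by (intro g_add Dt' \<beta>t \<gamma>t n that z)
    ultimately show ?thesis using yt zt pY pZ by (simp add: s_def c_def)
  qed

  \<comment> \<open>\<open>eta\<close> is parallel along the horizontal vectors of either
    connection. Splitting the lift of \<open>D'\<close> into that of \<open>D\<close> and the
    vertical lift of \<open>n y\<close>, along which \<open>eta\<close> has derivative
    \<open>n y\<close>, gives the value.\<close>
  have s_eta: "s (?\<beta> y) eta z = - ?g (n y) z" if y: "y \<in> ?T" and z: "z \<in> ?T" for y z
  proof -
    have "D' u (?\<beta>' y) eta = tv_zero" "D u (?\<beta> y) eta = tv_zero"
      using hbeta_horizontal[OF A reg u y] hbeta_horizontal[OF A reg' u y] by (auto simp: horizontal_space_def)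
    moreover have "D' u (?\<beta>' y) eta = tv_add (D' u (?\<beta> y) eta) (n y)"
      unfolding n(2)[OF y] connection_add[OF lin' u \<beta>t[OF y] \<gamma>t[OF n(1)[OF y]] pe]
        cartan_vertical_eta_left[OF A H F C' u n(1)[OF y]] ..
    ultimately have "?g (D' u (?\<beta> y) eta) z + ?g (n y) z = 0" "?g (D u (?\<beta> y) eta) z = 0"
      using g_add[OF Dt'[OF \<beta>t[OF y] pe] z n(1)[OF y]] finsler_metric_zero[OF A sm u z] by auto
    then show ?thesis by (simp add: s_def)
  qed

  have zero: "m = tv_zero" if "m \<in> ?T" "\<And>z. z \<in> ?T \<Longrightarrow> ?g m z = 0" for m
    using that finsler_metric_zero[OF A sm u] tangent_space_zero[OF A tangent_space_carrier[OF that(1)]]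
    by (intro finsler_metric_nondegenerate[OF A F u]) auto
  have \<gamma>0: "?\<gamma> tv_zero = tv_zero"
    using vgamma_scale[OF A u et, of 0] by (simp add: tv_scale_zero)

  \<comment> \<open>The lifts agree on the fundamental direction, so both connections have the same
    spray. This is \<open>main\<close> for a base field and \<open>eta\<close>, paired with
    \<open>eta\<close>: skewness removes the term that contains \<open>eta\<close> twice.\<close>
  have ne: "n ?e = tv_zero"
  proof (rule zero[OF n(1)[OF et]])
    fix y assume y: "y \<in> ?T"
    have "s (?\<beta> y) eta ?e = 0"
      using skew[OF \<beta>t[OF y] pe pe] by (simp add: eta_u)
    then have "s (?\<beta> ?e) (X' y) ?e = 0"
      using main[OF X'(3)[OF y] ve et] c_eta[OF n(1)[OF y]] c_e[OF n(1)[OF et] y]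
      by (simp add: X'(2)[OF y] eta_u)
    then have "s (?\<beta> ?e) eta y = 0"
      using skew[OF \<beta>t[OF et] pe X'(1)[OF y]] by (simp add: X'(2)[OF y] eta_u)
    then show "?g (n ?e) y = 0" using s_eta[OF et y] by simp
  qed
  have c_ne: "c (n ?e) (X' y) 0 z = 0" if y: "y \<in> ?T" and z: "z \<in> ?T" for y z
    unfolding c_def ne \<gamma>0 connection_zero[OF lin' u \<beta>t[OF et] X'(1)[OF y]]
    using finsler_metric_zero[OF A sm u z] by simp
  \<comment> \<open>As \<open>n ?e\<close> vanishes, no vertical terms are left in
    \<open>main\<close>, and \<open>g(n y, z)\<close> is up to sign the form
    \<open>s (?\<beta> ?e)\<close>, which is skew.\<close>
  have eta_skew: "- ?g (n y) z = s (?\<beta> ?e) (X' y) z" if y: "y \<in> ?T" and z: "z \<in> ?T" for y z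
    using main[OF X'(3)[OF y] ve z] c_eta[OF n(1)[OF y]] c_ne[OF y z] s_eta[OF y z]
    by (simp add: X'(2)[OF y] eta_u)
  have anti: "?g (n y) z = - ?g (n z) y" if y: "y \<in> ?T" and z: "z \<in> ?T" for y z
    using eta_skew[OF y z] eta_skew[OF z y] skew[OF \<beta>t[OF et] X'(1)[OF y] X'(1)[OF z]]
    by (simp add: X'(2)[OF y] X'(2)[OF z])
  \<comment> \<open>\<open>main\<close> for two base fields, paired with \<open>eta\<close>, where
    both \<open>c\<close> terms vanish.\<close>
  have sym: "?g (n y) z = ?g (n z) y" if y: "y \<in> ?T" and z: "z \<in> ?T" for y z
  proof -
    have "s (?\<beta> y) (X' z) ?e = s (?\<beta> z) (X' y) ?e"
      using main[OF X'(3)[OF y] X'(3)[OF z] et] c_e[OF n(1)[OF y] z] c_e[OF n(1)[OF z] y]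
      by (simp add: X'(2)[OF y] X'(2)[OF z])
    then have "s (?\<beta> y) eta z = s (?\<beta> z) eta y"
      using skew[OF \<beta>t[OF y] pe X'(1)[OF z]] skew[OF \<beta>t[OF z] pe X'(1)[OF y]]
      by (simp add: X'(2)[OF y] X'(2)[OF z] eta_u)
    then show ?thesis using s_eta[OF y z] s_eta[OF z y] by simp
  qed
  have "?g (n v) z = 0" if "z \<in> ?T" for z using anti[OF v that] sym[OF v that] by simp
  then have "n v = tv_zero" by (rule zero[OF n(1)[OF v]])
  with n(2)[OF v] \<gamma>0 show ?thesis by (simp add: tv_add_zero)
qed

text \<open>Regularity and horizontal torsion do not mention the metric, and the other two
  conditions are homogeneous in it, so a constant factor cancels. The scaling law is known for
  tangent vectors, hence the appeal to the tangency of the mixed torsion.\<close>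

lemma cartan_connection_homothety:
  assumes "smooth_atlas A" "Hausdorff_space (atlas_topology A)" "finsler_structure A L"
    and "cartan_connection A (conformal_change \<sigma> L) D" "\<And>p. p \<in> atlas_carrier A \<Longrightarrow> \<sigma> p = c"
  shows "cartan_connection A L D"
proof -
  note sm = finsler_structure_smooth[OF assms(3)]
  note reg = cartan_regular[OF assms(4)] and lin = cartan_linear[OF assms(4)]
  let ?L = "conformal_change \<sigma> L"
  have g: "finsler_metric ?L u v w = exp (2 * c) * finsler_metric L u v w"
    if "u \<in> slit_tangent A" "v \<in> tangent_space A (fst u)" "w \<in> tangent_space A (fst u)" for u v w
  proof -
    have "\<sigma> (fst u) = c" using assms(5) tangent_space_carrier[OF that(2)] by blast
    with finsler_metric_conformal[OF assms(1) sm that, of \<sigma>] show ?thesis by simp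
  qed
  have "metric_connection A L D"
    unfolding metric_connection_def
  proof (intro ballI allI impI; elim conjE)
    fix u \<xi> Y Z assume u: "u \<in> slit_tangent A" and \<xi>: "\<xi> \<in> tangent_space (slit_atlas A) u"
      and Y: "pi_vector_field A Y" and Z: "pi_vector_field A Z"
    note Yt = pi_vector_field_tangent[OF Y] and Zt = pi_vector_field_tangent[OF Z]
    note D = connection_tangent[OF assms(1,2) lin u \<xi>]
    have "\<xi> (\<lambda>w. finsler_metric ?L w (Y w) (Z w)) = \<xi> (\<lambda>w. exp (2 * c) * finsler_metric L w (Y w) (Z w))"
      by (rule tangent_cong_carrier[OF smooth_atlas_slit[OF assms(1)] \<xi>])
        (simp add: carrier_slit_atlas[OF assms(1)] g Yt Zt)
    also have "\<dots> = exp (2 * c) * \<xi> (\<lambda>w. finsler_metric L w (Y w) (Z w))"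
      by (rule tangent_cmult[OF smooth_atlas_slit[OF assms(1)] \<xi> finsler_metric_smooth[OF assms(1) sm Y Z u]])
    finally have "exp (2 * c) * \<xi> (\<lambda>w. finsler_metric L w (Y w) (Z w)) =
        exp (2 * c) * (finsler_metric L u (D u \<xi> Y) (Z u) + finsler_metric L u (Y u) (D u \<xi> Z))"
      using metric_connection_eq[OF cartan_metric[OF assms(4)] u \<xi> Y Z]
      by (simp add: g u Yt Zt D Y Z distrib_left)
    then show "\<xi> (\<lambda>w. finsler_metric L w (Y w) (Z w)) =
        finsler_metric L u (D u \<xi> Y) (Z u) + finsler_metric L u (Y u) (D u \<xi> Z)" by simp
  qed
  moreover have "finsler_metric L u (hv_torsion A D X Y u) (Z u) = finsler_metric L u (hv_torsion A D X Z u) (Y u)"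
    if X: "pi_vector_field A X" and Y: "pi_vector_field A Y" and Z: "pi_vector_field A Z"
      and u: "u \<in> slit_tangent A" for X Y Z u
  proof -
    have "finsler_metric ?L u (hv_torsion A D X Y u) (Z u) = finsler_metric ?L u (hv_torsion A D X Z u) (Y u)"
      using assms(4) that unfolding cartan_connection_def by blast
    then show ?thesis
      using hv_torsion_tangent[OF assms(1,2) reg u X] Y Z pi_vector_field_tangent[OF _ u] by (simp add: g u)
  qed
  ultimately show ?thesis
    using assms(4) reg unfolding cartan_connection_def by blast
qed

text \<open>Once \<open>D'\<close> is a Cartan connection of \<open>L\<close> as well, its lift is
  that of \<open>D\<close>, and every term of \<open>dbar\<close> acquires the same factor
  \<open>exp (2 * c)\<close>.\<close>

lemma dbar_closed_homothety:
  assumes "smooth_atlas A" "Hausdorff_space (atlas_topology A)" "finsler_structure A L"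
    and "cartan_connection A L D" "cartan_connection A (conformal_change \<sigma> L) D'"
    and "\<And>p. p \<in> atlas_carrier A \<Longrightarrow> \<sigma> p = c"
    and "pi_vector_field A X" "dbar_closed A L D X"
  shows "dbar_closed A (conformal_change \<sigma> L) D' X"
  unfolding dbar_closed_def
proof (intro allI impI ballI; elim conjE)
  fix Y Z u assume Y: "pi_vector_field A Y" and Z: "pi_vector_field A Z" and u: "u \<in> slit_tangent A"
  note sm = finsler_structure_smooth[OF assms(3)] and B = smooth_atlas_slit[OF assms(1)]
  have C': "cartan_connection A L D'"
    by (rule cartan_connection_homothety[OF assms(1-3,5)]) (rule assms(6))
  note unique = cartan_hbeta_unique[OF assms(1-4) C' u]
  let ?g = "finsler_metric L" and ?g' = "finsler_metric (conformal_change \<sigma> L)"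
  have g: "?g' w (X w) v = exp (2 * c) * ?g w (X w) v"
    if "w \<in> slit_tangent A" "v \<in> tangent_space A (fst w)" for w v
    using finsler_metric_conformal[OF assms(1) sm that(1) pi_vector_field_tangent[OF assms(7) that(1)] that(2), of \<sigma>]
      assms(6)[OF tangent_space_carrier[OF that(2)]] by simp
  have h: "hbeta A D' u (W u) (\<lambda>w. ?g' w (X w) (W' w)) = exp (2 * c) * hbeta A D u (W u) (\<lambda>w. ?g w (X w) (W' w))"
    if W: "pi_vector_field A W" "pi_vector_field A W'" for W W'
  proof -
    note t = hbeta_tangent[OF assms(1) cartan_regular[OF assms(4)] u pi_vector_field_tangent[OF W(1) u]]
    have "hbeta A D' u (W u) (\<lambda>w. ?g' w (X w) (W' w)) = hbeta A D u (W u) (\<lambda>w. exp (2 * c) * ?g w (X w) (W' w))"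
      unfolding unique[OF pi_vector_field_tangent[OF W(1) u], symmetric]
      by (rule tangent_cong_carrier[OF B t])
        (simp add: carrier_slit_atlas[OF assms(1)] g pi_vector_field_tangent[OF W(2)])
    then show ?thesis
      using tangent_cmult[OF B t finsler_metric_smooth[OF assms(1) sm assms(7) W(2) u]] by simp
  qed
  let ?R = "\<lambda>D. rho (lie_bracket (slit_atlas A) (\<lambda>w. hbeta A D w (Y w)) (\<lambda>w. hbeta A D w (Z w)) u)"
  note b = cartan_bracket[OF assms(1,2,4) Y Z u] and b' = cartan_bracket[OF assms(1,2) C' Y Z u]
  \<comment> \<open>By \<open>cartan_bracket_apply\<close> the projected bracket involves the lifts
    at \<open>u\<close> only, where they agree; if \<open>f\<close> is not smooth near the base
    point, both sides are 0.\<close>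
  have "?R D' f = ?R D f" for f
  proof (cases "smooth_near A (fst u) f")
    case True
    then show ?thesis
      unfolding b(3)[OF True] b'(3)[OF True]
      using unique[OF pi_vector_field_tangent[OF Y u]] unique[OF pi_vector_field_tangent[OF Z u]] by simp
  next
    case False
    then show ?thesis using tangent_not_smooth[OF b(2)] tangent_not_smooth[OF b'(2)] by simp
  qed
  then have "?R D' = ?R D" by blast
  then have "dbar A D' (\<lambda>w. ?g' w (X w)) Y Z u = exp (2 * c) * dbar A D (\<lambda>w. ?g w (X w)) Y Z u"
    unfolding dbar_def using h[OF Y Z] h[OF Z Y] g[OF u b(2)] by (simp add: right_diff_distrib)
  then show "dbar A D' (\<lambda>w. ?g' w (X w)) Y Z u = 0"
    using assms(8) Y Z u unfolding dbar_closed_def by simp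
qed

theorem theorem2p17:
  fixes A :: "('e::euclidean_space, 'a) atlas"
    and L :: "'a \<times> 'a tvec \<Rightarrow> real"
    and \<sigma> :: "'a \<Rightarrow> real"
    and D D' :: "'a pi_conn"
  assumes "smooth_manifold A"
    and "connected_space (atlas_topology A)"
    and "DIM('e) \<ge> 2"
    and "finsler_structure A L"
    and "smooth_fun_on A (atlas_carrier A) \<sigma>"
    and "cartan_connection A L D"
    and "cartan_connection A (conformal_change \<sigma> L) D'"
  shows "(\<forall>X. pi_vector_field A X \<and> dbar_closed A L D X \<longrightarrow>
            dbar_closed A (conformal_change \<sigma> L) D' X)
         \<longleftrightarrow> \<sigma> constant_on (atlas_carrier A)"
proof -
  have A: "smooth_atlas A" "Hausdorff_space (atlas_topology A)"
    using assms(1) by (auto simp: smooth_manifold_def)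
  show ?thesis
  proof
    assume "\<forall>X. pi_vector_field A X \<and> dbar_closed A L D X \<longrightarrow>
            dbar_closed A (conformal_change \<sigma> L) D' X"
    then show "\<sigma> constant_on (atlas_carrier A)"
      by (intro closed_preserved_imp_constant[OF A assms(2-7)]) blast
  next
    assume "\<sigma> constant_on (atlas_carrier A)"
    then obtain c where "\<And>p. p \<in> atlas_carrier A \<Longrightarrow> \<sigma> p = c" unfolding constant_on_def by blast
    then show "\<forall>X. pi_vector_field A X \<and> dbar_closed A L D X \<longrightarrow>
            dbar_closed A (conformal_change \<sigma> L) D' X"
      using dbar_closed_homothety[OF A assms(4,6,7)] by blast
  qed
qed

end
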